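(* Let $\mathbf{G}$ be a locally linear GLUE-scheme with linear companion $\mathbf{A}$, spread $n$, and regularity parameter $\nu$. Let $\alpha\in(0,1]$. If the chain $\mathbf{P}\in\mathbb{E}^{\ge n}$ is straightened by $\mathbf{G}$ and if $\mathbf{A}$ is almost $C^{2,\alpha}$, then $\mathbf{G}$ is almost $C^{2,\beta}$ at $\mathbf{P}$, where $\beta:=\min\{\alpha,\nu\}$.
   Context: **Chains.** Fix $d\in\mathbb{N}=\{1,2,\dots\}$ and let $\mathbb{E}:=\mathbb{R}^d$ with Euclidean norm $\|\cdot\|$; points are row vectors. $\mathbb{E}^N$ is the set of chains $\mathbf{P}=[p_0;\dots;p_{N-1}]$ of $N$ points $p_i\in\mathbb{E}$ (identified with $N\times d$ matrices); $\#\mathbf{P}:=N$; $\mathbb{E}^{\ge n}:=\bigcup_{N\ge n}\mathbb{E}^N$. Subchains: $T^n_i\mathbf{P}:=[p_i;\dots;p_{i+n-1}]$, $0\le i\le\#\mathbf{P}-n$, and $T^n\mathbf{P}$ is the set of all of these. Let $e:=[1,0,\dots,0]\in\mathbb{E}$, $\mathbf{E}_N:=[e;2e;\dots;Ne]$ and $\mathbf{e}:=\mathbf{E}_n$. Forward differences: $(\Delta\mathbf{P})_i:=p_{i+1}-p_i$, with iterates $\Delta^k$. Set $|\mathbf{P}|_0:=\max_i\|p_i\|$ and $|\mathbf{P}|_j:=|\Delta^j\mathbf{P}|_0$. Let $\mathbb{L}^n:=\{\mathbf{p}\in\mathbb{E}^n:\Delta^2\mathbf{p}=0\}$ and let $\Pi:\mathbb{E}^n\to\mathbb{L}^n$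 be the orthogonal projection with respect to $\langle\mathbf{p},\mathbf{q}\rangle_n=\sum_i\langle p_i,q_i\rangle$. The relative distortion of $\mathbf{p}\in\mathbb{E}^n$ is $\kappa(\mathbf{p}):=|\mathbf{p}|_2/|\Pi\mathbf{p}|_1$ if $\Delta\Pi\mathbf{p}\ne0$ and $\kappa(\mathbf{p}):=\infty$ otherwise; for $\mathbf{P}\in\mathbb{E}^{\ge n}$, $\kappa(\mathbf{P}):=\max\{\kappa(\mathbf{p}):\mathbf{p}\in T^n\mathbf{P}\}$. A similarity is a map $S(p)=\varrho pQ+s$ with $\varrho>0$, $Q\in\mathbb{R}^{d\times d}$ orthogonal, $s\in\mathbb{E}$; it acts on chains pointwise. **GLUE-schemes.** Let $m\in\mathbb{N}$ and $n=2m+1$. A map $\mathbf{G}:\mathbb{E}^{\ge n}\to\mathbb{E}^{\ge n}$ with $\#\mathbf{G}(\mathbf{P})=2\#\mathbf{P}-n+1$ is a GLUE-scheme with spread $n$ if: (G) $\mathbf{G}\circ S=S\circ\mathbf{G}$ for all similarities $S$; (L),(U) there are functions $g_0,g_1:\mathbb{E}^{m+1}\to\mathbb{E}$ such that $\mathbf{P}'=\mathbf{G}(\mathbf{P})$ has points $p'_{2i+\lambda}=g_\lambda(p_i,\dots,p_{i+m})$ for $\lambda\in\{0,1\}$, $0\le i<\#\mathbf{P}-m$, and $g_0,g_1$ are $C^{1,\nu}$ in a neighborhood of $\mathbf{E}_{m+1}$ for some $\nu>0$ (the regularity parameter); (E) $\mathbf{G}(\mathbf{e})=(\mathbf{E}_{n+1}+(m+\tau)e)/2$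 for some $\tau\in[0,1)$ (the shift), where $(m+\tau)e$ is added to every point. Write $\mathbf{P}^\ell:=\mathbf{G}^\ell(\mathbf{P})$ with points $p^\ell_i$. The associated self-maps $\mathbf{g}_0,\mathbf{g}_1:\mathbb{E}^n\to\mathbb{E}^n$ are $\mathbf{g}_\lambda(\mathbf{p}):=T^n_\lambda\mathbf{G}(\mathbf{p})$, and $M_\lambda:=D\mathbf{g}_\lambda(\mathbf{e})$ is the derivative of $\mathbf{g}_\lambda$ at $\mathbf{e}$. **Straightening.** $\mathbf{P}$ is straightened by $\mathbf{G}$ if $\kappa(\mathbf{P}^\ell)\to0$ as $\ell\to\infty$ (finitely many infinite values allowed). **Limit curves and regularity.** For $N=\#\mathbf{P}$ let $I:=(0,N-n+1)$, $I_z:=[z,N-n+1-z]$ for $z>0$, $I^\ell_z:=\mathbb{N}\cap2^\ell I_z$, and $|\Phi|_z:=\max_{t\in I_z}\|\Phi(t)\|$. A GLUE-scheme is convergent at $\mathbf{P}$ if there is a continuous limit curve $\Phi[\mathbf{P}]:\mathbb{R}\to\mathbb{E}$ with $\lim_{\ell\to\infty}\sup_{i\in I^\ell_z}\|\Phi[\mathbf{P}](2^{-\ell}i)-p^\ell_i\|=0$ for every $z>0$. A curve $\Phi$ is $C^k$ if its $k$-th derivative $\partial^k\Phi$ exists and is continuous on $I$; it is $C^{k,\alpha}$ if moreover, for some $h_0>0$ and every $z>0$, $\sup_{0<h\le h_0}h^{-\alpha}\omega_z(\partial^k\Phi,h)<\infty$, where $\omega_z(\Psi,h):=|\Psi(\cdot+h/2)-\Psi(\cdot-h/2)|_{z+h/2}$.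 A GLUE-scheme is $C^{k,\alpha}$ at $\mathbf{P}$ if it is convergent at $\mathbf{P}$ and $\Phi[\mathbf{P}]$ is $C^{k,\alpha}$; it is almost $C^{k,\alpha}$ at $\mathbf{P}$ if it is $C^{k,\alpha'}$ at $\mathbf{P}$ for every $\alpha'<\alpha$ (with $\alpha'>0$). **Linear schemes.** A GLUE-scheme is linear if its rules have the form $a_\lambda(p_i,\dots,p_{i+m})=\sum_{j=0}^m a_{\lambda,j}p_{i+j}$, $\lambda\in\{0,1\}$, with real weights satisfying $\sum_j a_{\lambda,j}=1$; its self-maps are then $\mathbf{p}\mapsto A_\lambda\mathbf{p}$ with $n\times n$ matrices $A_0,A_1$. A linear scheme is called almost $C^{k,\alpha}$ if it is almost $C^{k,\alpha}$ at all $\mathbf{P}\in\mathbb{E}^{\ge n}$ and non-degenerate in the sense that a constant limit can only be attained for constant initial data. **Locally linear.** $\mathbf{G}$ is locally linear if there exist real $n\times n$ matrices $A_0,A_1$ with $M_\lambda\cdot\mathbf{p}'=A_\lambda\mathbf{p}'$ for all $\mathbf{p}'\in\mathbb{E}^n$, $\lambda\in\{0,1\}$; the linear scheme $\mathbf{A}$ corresponding to $A_0,A_1$ is its linear companion. *)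

theory Defs
  imports "HOL-Analysis.Analysis"
begin

section \<open>Chains\<close>

text \<open>
  The space \<open>\<real>\<^sup>d\<close> is \<open>real ^ 'd\<close>; the linear order on the index type only serves to say which
  coordinate is the first one. Chains of arbitrary length are lists. Chains of a fixed length
  \<open>N\<close> on which a derivative is taken are elements of \<open>(real ^ 'd) ^ 'k\<close> with \<open>CARD('k) = N\<close>;
  there the index \<open>i\<close> plays the role of the number \<open>pos i \<in> {0..<N}\<close>.
\<close>

type_synonym 'd point = "real ^ 'd"
type_synonym 'd chain = "'d point list"
type_synonym ('d, 'k) tuple = "(real ^ 'd) ^ 'k"
type_synonym 'n sq_matrix = "real ^ 'n ^ 'n"

definition pos :: "'k::{finite,linorder} \<Rightarrow> nat" where
  "pos i = card {j. j < i}"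

definition tup_of :: "'a list \<Rightarrow> 'a ^ ('k::{finite,linorder})" where
  "tup_of p = (\<chi> i. p ! pos i)"

definition list_of :: "'a ^ ('k::{finite,linorder}) \<Rightarrow> 'a list" where
  "list_of v = map (\<lambda>i. v $ i) (sorted_list_of_set UNIV)"

definition subchain :: "nat \<Rightarrow> nat \<Rightarrow> 'a list \<Rightarrow> 'a list" where
  "subchain n i P = take n (drop i P)"

definition subchains :: "nat \<Rightarrow> 'a list \<Rightarrow> 'a list set" where
  "subchains n P = {subchain n i P | i. i + n \<le> length P}"

definition e1 :: "('d::{finite,linorder}) point" where
  "e1 = axis (Min UNIV) 1"

definition std_chain :: "nat \<Rightarrow> ('d::{finite,linorder}) chain" where
  "std_chain N = map (\<lambda>k. real k *\<^sub>R e1) [1..<N+1]"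

definition fdiff :: "('d::finite) chain \<Rightarrow> 'd chain" where
  "fdiff P = map (\<lambda>i. P ! (i + 1) - P ! i) [0..<length P - 1]"

definition seminorm :: "nat \<Rightarrow> ('d::finite) chain \<Rightarrow> real" where
  "seminorm j P = Max (norm ` set ((fdiff ^^ j) P))"

abbreviation null_chain :: "('d::finite) chain \<Rightarrow> bool" where
  "null_chain P \<equiv> \<forall>v\<in>set P. v = 0"

definition linear_chains :: "nat \<Rightarrow> ('d::finite) chain set" where
  "linear_chains n = {p. length p = n \<and> null_chain (fdiff (fdiff p))}"

definition chain_inner :: "('d::finite) chain \<Rightarrow> 'd chain \<Rightarrow> real" where
  "chain_inner p q = (\<Sum>i<length p. (p ! i) \<bullet> (q ! i))"

definition line_proj :: "('d::finite) chain \<Rightarrow> 'd chain" where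
  "line_proj p = (THE q. q \<in> linear_chains (length p) \<and>
     (\<forall>r \<in> linear_chains (length p). chain_inner (map2 (-) p q) r = 0))"

definition rel_distortion :: "('d::finite) chain \<Rightarrow> ereal" where
  "rel_distortion p =
     (if \<not> null_chain (fdiff (line_proj p))
      then ereal (seminorm 2 p / seminorm 1 (line_proj p)) else \<infinity>)"

definition chain_distortion :: "nat \<Rightarrow> ('d::finite) chain \<Rightarrow> ereal" where
  "chain_distortion n P = Max (rel_distortion ` subchains n P)"

definition similarity :: "(('d::finite) point \<Rightarrow> 'd point) \<Rightarrow> bool" where
  "similarity S \<longleftrightarrow> (\<exists>\<rho> Q s. \<rho> > 0 \<and> orthogonal_matrix Q \<and> S = (\<lambda>p. \<rho> *\<^sub>R (p v* Q) + s))"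


section \<open>GLUE-schemes\<close>

definition C1_holder_near ::
  "real \<Rightarrow> ('a::real_normed_vector \<Rightarrow> 'b::real_normed_vector) \<Rightarrow> 'a \<Rightarrow> bool" where
  "C1_holder_near \<nu> f x \<longleftrightarrow>
     (\<exists>U (D :: 'a \<Rightarrow> 'a \<Rightarrow>\<^sub>L 'b) C. open U \<and> x \<in> U \<and>
        (\<forall>y\<in>U. (f has_derivative blinfun_apply (D y)) (at y)) \<and>
        (\<forall>y\<in>U. \<forall>z\<in>U. norm (D y - D z) \<le> C * dist y z powr \<nu>))"

text \<open>
  \<open>glue_scheme m G g \<tau> \<nu>\<close>: the map \<open>G\<close>, whose values matter only on chains of length at least
  the spread \<open>2 * m + 1\<close>, is a GLUE-scheme with rules \<open>g 0\<close>, \<open>g 1\<close>, shift \<open>\<tau>\<close> and regularity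
  parameter \<open>\<nu>\<close>. It is meant for \<open>m \<ge> 1\<close> and \<open>CARD('k) = m + 1\<close>.
\<close>

definition glue_scheme ::
  "nat \<Rightarrow> (('d::{finite,linorder}) chain \<Rightarrow> 'd chain) \<Rightarrow>
   (nat \<Rightarrow> ('d, 'k::{finite,linorder}) tuple \<Rightarrow> 'd point) \<Rightarrow> real \<Rightarrow> real \<Rightarrow> bool" where
  "glue_scheme m G g \<tau> \<nu> \<longleftrightarrow>
     (\<forall>P. 2 * m + 1 \<le> length P \<longrightarrow> length (G P) = 2 * length P - (2 * m + 1) + 1) \<and>
     (\<forall>S P. similarity S \<and> 2 * m + 1 \<le> length P \<longrightarrow> G (map S P) = map S (G P)) \<and>
     (\<forall>P. 2 * m + 1 \<le> length P \<longrightarrow>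
        (\<forall>i < length P - m. \<forall>l\<in>{0,1}.
           G P ! (2 * i + l) = g l (tup_of (subchain (m + 1) i P)))) \<and>
     0 < \<nu> \<and>
     (\<forall>l\<in>{0,1}. C1_holder_near \<nu> (g l) (tup_of (std_chain (m + 1)))) \<and>
     0 \<le> \<tau> \<and> \<tau> < 1 \<and>
     G (std_chain (2 * m + 1)) =
       map (\<lambda>p. (1/2) *\<^sub>R (p + (real m + \<tau>) *\<^sub>R e1)) (std_chain (2 * m + 2))"

definition self_map ::
  "(('d::finite) chain \<Rightarrow> 'd chain) \<Rightarrow> nat \<Rightarrow>
   ('d, 'n::{finite,linorder}) tuple \<Rightarrow> ('d, 'n) tuple" where
  "self_map G l p = tup_of (subchain CARD('n) l (G (list_of p)))"

definition mat_chain_mult ::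
  "('n::finite) sq_matrix \<Rightarrow> ('d::finite, 'n) tuple \<Rightarrow> ('d, 'n) tuple" where
  "mat_chain_mult B p = (\<chi> i. \<Sum>j\<in>UNIV. B $ i $ j *\<^sub>R p $ j)"

definition straightened :: "nat \<Rightarrow> (('d::finite) chain \<Rightarrow> 'd chain) \<Rightarrow> 'd chain \<Rightarrow> bool" where
  "straightened n G P \<longleftrightarrow> (\<lambda>l. chain_distortion n ((G ^^ l) P)) \<longlonglongrightarrow> 0"

definition locally_linear_with ::
  "(('d::{finite,linorder}) chain \<Rightarrow> 'd chain) \<Rightarrow>
   (nat \<Rightarrow> ('n::{finite,linorder}) sq_matrix) \<Rightarrow> bool" where
  "locally_linear_with G B \<longleftrightarrow>
     (\<forall>l\<in>{0,1}. ((self_map G l :: ('d, 'n) tuple \<Rightarrow> ('d, 'n) tuple)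
        has_derivative mat_chain_mult (B l)) (at (tup_of (std_chain CARD('n)))))"

definition linear_glue_scheme ::
  "nat \<Rightarrow> (('d::{finite,linorder}) chain \<Rightarrow> 'd chain) \<Rightarrow>
   (nat \<Rightarrow> ('d, 'k::{finite,linorder}) tuple \<Rightarrow> 'd point) \<Rightarrow>
   (nat \<Rightarrow> real ^ ('k::{finite,linorder})) \<Rightarrow> real \<Rightarrow> real \<Rightarrow> bool" where
  "linear_glue_scheme m A a w \<tau> \<nu> \<longleftrightarrow> glue_scheme m A a \<tau> \<nu> \<and>
     (\<forall>l\<in>{0,1}. (\<Sum>j\<in>UNIV. w l $ j) = 1 \<and> (\<forall>p. a l p = (\<Sum>j\<in>UNIV. (w l $ j) *\<^sub>R (p $ j))))"

definition corresponds_to ::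
  "(('d::finite) chain \<Rightarrow> 'd chain) \<Rightarrow> (nat \<Rightarrow> ('n::{finite,linorder}) sq_matrix) \<Rightarrow> bool" where
  "corresponds_to A B \<longleftrightarrow>
     (\<forall>l\<in>{0,1}. \<forall>p :: ('d, 'n) tuple. self_map A l p = mat_chain_mult (B l) p)"


section \<open>Limit curves and their regularity\<close>

text \<open>
  With \<open>L = param_length n P\<close> the parameter interval of the limit curve is \<open>{0<..<L}\<close>, and
  \<open>{z..L - z}\<close> is its compact part at distance \<open>z\<close> from the ends. That part is empty for
  large \<open>z\<close>; suprema are taken in \<open>ennreal\<close>, where the supremum of the empty set is \<open>0\<close>.
\<close>

definition param_length :: "nat \<Rightarrow> 'a list \<Rightarrow> real" where
  "param_length n P = real (length P) - real n + 1"

definition limit_curve ::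
  "nat \<Rightarrow> (('d::finite) chain \<Rightarrow> 'd chain) \<Rightarrow> 'd chain \<Rightarrow> (real \<Rightarrow> 'd point) \<Rightarrow> bool" where
  "limit_curve n G P \<Phi> \<longleftrightarrow> continuous_on UNIV \<Phi> \<and>
     (\<forall>z>0. (\<lambda>l. SUP i \<in> {i::nat. 0 < i \<and> real i / 2 ^ l \<in> {z..param_length n P - z}}.
               ennreal (norm (\<Phi> (real i / 2 ^ l) - ((G ^^ l) P) ! i))) \<longlonglongrightarrow> 0)"

definition kth_derivative_on ::
  "nat \<Rightarrow> real set \<Rightarrow> (real \<Rightarrow> 'b::real_normed_vector) \<Rightarrow> (real \<Rightarrow> 'b) \<Rightarrow> bool" where
  "kth_derivative_on k I \<Phi> \<Psi> \<longleftrightarrow>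
     (\<exists>D. D 0 = \<Phi> \<and> D k = \<Psi> \<and>
        (\<forall>j<k. \<forall>t\<in>I. (D j has_vector_derivative D (Suc j) t) (at t)))"

definition modulus :: "real \<Rightarrow> real \<Rightarrow> (real \<Rightarrow> 'b::real_normed_vector) \<Rightarrow> real \<Rightarrow> ennreal" where
  "modulus L z \<Psi> h =
     (SUP t \<in> {z + h/2..L - (z + h/2)}. ennreal (norm (\<Psi> (t + h/2) - \<Psi> (t - h/2))))"

definition Ck_holder_curve ::
  "nat \<Rightarrow> real \<Rightarrow> real \<Rightarrow> (real \<Rightarrow> 'b::real_normed_vector) \<Rightarrow> bool" where
  "Ck_holder_curve k \<alpha> L \<Phi> \<longleftrightarrow>
     (\<exists>\<Psi>. kth_derivative_on k {0<..<L} \<Phi> \<Psi> \<and> continuous_on {0<..<L} \<Psi> \<and>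
        (\<exists>h0>0. \<forall>z>0. (SUP h\<in>{0<..h0}. ennreal (h powr (- \<alpha>)) * modulus L z \<Psi> h) < \<infinity>))"

definition Ck_holder_at ::
  "nat \<Rightarrow> nat \<Rightarrow> real \<Rightarrow> (('d::finite) chain \<Rightarrow> 'd chain) \<Rightarrow> 'd chain \<Rightarrow> bool" where
  "Ck_holder_at n k \<alpha> G P \<longleftrightarrow>
     (\<exists>\<Phi>. limit_curve n G P \<Phi> \<and> Ck_holder_curve k \<alpha> (param_length n P) \<Phi>)"

definition almost_Ck_holder_at ::
  "nat \<Rightarrow> nat \<Rightarrow> real \<Rightarrow> (('d::finite) chain \<Rightarrow> 'd chain) \<Rightarrow> 'd chain \<Rightarrow> bool" where
  "almost_Ck_holder_at n k \<alpha> G P \<longleftrightarrow> (\<forall>\<alpha>'. 0 < \<alpha>' \<and> \<alpha>' < \<alpha> \<longrightarrow> Ck_holder_at n k \<alpha>' G P)"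

text \<open>
  A limit curve is determined by the scheme only on the parameter interval, so
  constancy of the limit means constancy there.
\<close>

definition linear_almost_Ck_holder ::
  "nat \<Rightarrow> nat \<Rightarrow> real \<Rightarrow> (('d::finite) chain \<Rightarrow> 'd chain) \<Rightarrow> bool" where
  "linear_almost_Ck_holder n k \<alpha> A \<longleftrightarrow>
     (\<forall>P. n \<le> length P \<longrightarrow> almost_Ck_holder_at n k \<alpha> A P) \<and>
     (\<forall>P \<Phi>. n \<le> length P \<and> limit_curve n A P \<Phi> \<and> \<Phi> constant_on {0<..<param_length n P}
        \<longrightarrow> (\<exists>c. \<forall>p\<in>set P. p = c))"

end

(*
  Write P^l for the iterates of G and S for the linear companion, acting on bi-infinite sequences.
  On nearly straight chains G differs from S only by R^l := P^{l+1} - S P^l, and by similarity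
  invariance and the C^{1,nu} regularity of the rules, |R^l| <= const * |step| * kappa^{1+nu}.

  Let phi be the limit function of S for the unit impulse. Since sum_k phi(2t - k) (S f)(k) =
  sum_j phi(t - j) f(j), the limit curve of G is the telescoping series
    sum_j phi(t - j) P_j + sum_l sum_k phi(2^{l+1} t - k) R^l_k,
  so it inherits the regularity of phi as soon as 2^{(2+beta)l} |R^l| decays geometrically.

  The decay is obtained from the quantity sup_k 4^k |Delta^2 S^k p|, which is finite because the
  limit curves of S are C^2 and determine their data: in this seminorm S contracts by 1/4 while step
  lengths shrink by 1/2 only, hence for G the relative distortion decays like theta^l for every
  theta > 1/2 and |R^l| = O(theta^{(2+nu)l}).
*)

theory Submission
  imports Defs
begin

section \<open>Subdivision operators\<close>

text \<open>The obstacle is a constant. C^2 limits yield |Delta^2 S^k p| <= C 4^-k |Delta^2 p| with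
  C larger than 1 in general, and a comparison of G with S level by level would pick up this factor
  at every level. The supremum over k absorbs C once, at a start level; afterwards a level costs 1/4
  plus a perturbation that vanishes with the distortion. The estimate rests on Taylor's formula:
  over a dyadic interval of length 2^-k the limit curve is within const 4^-k of its tangent, and the
  tangent is itself the limit of straight data. Since limits determine their data, the data are
  equally close to straight ones. All estimates are local to windows of n = 2m+1 consecutive points.
  A window determines the windows below it at every finer level, so the ends of the chain cause no
  trouble. The exponent 2+nu is 1+nu from linearization plus 1 from the step length. The Hoelder
  quotient of the second derivative costs 2^(2+beta) per level, so beta < nu leaves room for theta
  slightly above 1/2.\<close>

definition subdiv :: "nat \<Rightarrow> (nat \<Rightarrow> nat \<Rightarrow> real) \<Rightarrow> (int \<Rightarrow> 'a::real_vector) \<Rightarrow> int \<Rightarrow> 'a" where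
  "subdiv m c f i = (\<Sum>j\<le>m. c (nat (i mod 2)) j *\<^sub>R f (i div 2 + int j))"

definition diff2 :: "(int \<Rightarrow> 'a::real_vector) \<Rightarrow> int \<Rightarrow> 'a" where
  "diff2 f i = f (i + 2) - 2 *\<^sub>R f (i + 1) + f i"

definition unit_impulse :: "int \<Rightarrow> real" where
  "unit_impulse i = (if i = 0 then 1 else 0)"

lemma div_2_pow_Suc: "i div 2 ^ Suc k = i div 2 ^ k div (2::int)"
  using zdiv_zmult2_eq[of 2 i "2 ^ k"] by (simp add: mult.commute)

lemma subdiv_pow_add:
  "(subdiv m c ^^ k) (\<lambda>i. f i + h i) = (\<lambda>i. (subdiv m c ^^ k) f i + (subdiv m c ^^ k) h i)"
proof (induction k arbitrary: f h)
  case (Suc k)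
  have "subdiv m c (\<lambda>i. f i + h i) = (\<lambda>i. subdiv m c f i + subdiv m c h i)"
    by (auto simp: subdiv_def scaleR_add_right sum.distrib)
  then show ?case by (simp add: funpow_Suc_right Suc del: funpow.simps)
qed simp

lemma subdiv_pow_scaleR:
  "(subdiv m c ^^ k) (\<lambda>i. f i *\<^sub>R v) = (\<lambda>i. (subdiv m c ^^ k) f i *\<^sub>R v)"
proof (induction k arbitrary: f)
  case (Suc k)
  have "subdiv m c (\<lambda>i. f i *\<^sub>R v) = (\<lambda>i. subdiv m c f i *\<^sub>R v)"
    by (auto simp: subdiv_def scaleR_sum_left)
  then show ?case by (simp add: funpow_Suc_right Suc del: funpow.simps)
qed simp

lemma subdiv_pow_linear:
  assumes "linear L"
  shows "(subdiv m c ^^ k) (\<lambda>i. L (f i)) = (\<lambda>i. L ((subdiv m c ^^ k) f i))"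
proof (induction k arbitrary: f)
  case (Suc k)
  interpret linear L by fact
  have "subdiv m c (\<lambda>i. L (f i)) = (\<lambda>i. L (subdiv m c f i))"
    by (auto simp: subdiv_def sum scaleR)
  then show ?case by (simp add: funpow_Suc_right Suc del: funpow.simps)
qed simp

lemma subdiv_pow_zero: "(subdiv m c ^^ k) (\<lambda>i. 0) = (\<lambda>i. 0 :: 'a::real_vector)"
  using subdiv_pow_scaleR[where f = "\<lambda>_. 0" and v = "0::'a"] by simp

lemma subdiv_pow_sum:
  assumes "finite J"
  shows "(subdiv m c ^^ k) (\<lambda>i. \<Sum>j\<in>J. f j i) = (\<lambda>i. \<Sum>j\<in>J. (subdiv m c ^^ k) (f j) i)"
  using assms by induction (simp_all add: subdiv_pow_zero subdiv_pow_add)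

lemma subdiv_pow_shift:
  "(subdiv m c ^^ k) (\<lambda>i. f (i + a)) i = (subdiv m c ^^ k) f (i + 2 ^ k * a)"
proof (induction k arbitrary: f a i)
  case (Suc k)
  have "subdiv m c (\<lambda>i. f (i + a)) = (\<lambda>i. subdiv m c f (i + 2 * a))"
    by (auto simp: subdiv_def algebra_simps)
  then show ?case by (simp add: funpow_Suc_right Suc algebra_simps del: funpow.simps)
qed simp

text \<open>A window of \<open>2 * m + 1\<close> entries reproduces itself: halving a position in
  \<open>{b..b + 2 * m}\<close> and reading up to \<open>m\<close> entries further lands in
  \<open>{b div 2..b div 2 + 2 * m}\<close>. So the width of the dependence does not grow with
  \<open>k\<close>; it is the spread.\<close>

lemma subdiv_pow_cong:
  assumes "\<And>j. j \<in> {i div 2 ^ k..i div 2 ^ k + 2 * int m} \<Longrightarrow> f j = h j"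
  shows "(subdiv m c ^^ k) f i = (subdiv m c ^^ k) h i"
  using assms
proof (induction k arbitrary: f h)
  case (Suc k)
  have "subdiv m c f j = subdiv m c h j"
    if j: "j \<in> {i div 2 ^ k..i div 2 ^ k + 2 * int m}" for j
    unfolding subdiv_def
  proof (rule sum.cong[OF refl])
    fix x assume "x \<in> {..m}"
    then have "j div 2 + int x \<in> {i div 2 ^ Suc k..i div 2 ^ Suc k + 2 * int m}"
      using j unfolding div_2_pow_Suc by auto
    then show "c (nat (j mod 2)) x *\<^sub>R f (j div 2 + int x) = c (nat (j mod 2)) x *\<^sub>R h (j div 2 + int x)"
      using Suc.prems by simp
  qed
  then have "(subdiv m c ^^ k) (subdiv m c f) i = (subdiv m c ^^ k) (subdiv m c h) i"
    by (rule Suc.IH)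
  then show ?case by (simp add: funpow_Suc_right del: funpow.simps)
qed simp

text \<open>Only the window matters, so \<open>f\<close> may be replaced there by a finite
  combination of shifted impulses. After \<open>k\<close> steps a shift by \<open>j\<close> has
  become a shift by \<open>2 ^ k * j\<close>.\<close>

lemma subdiv_pow_eq_sum_impulse:
  fixes f :: "int \<Rightarrow> 'a::real_vector" and i :: int and k :: nat
  defines "b \<equiv> i div 2 ^ k"
  shows "(subdiv m c ^^ k) f i =
    (\<Sum>j\<in>{b..b + 2 * int m}. (subdiv m c ^^ k) unit_impulse (i - 2 ^ k * j) *\<^sub>R f j)"
proof -
  have "(subdiv m c ^^ k) f i
      = (subdiv m c ^^ k) (\<lambda>i. \<Sum>j\<in>{b..b + 2 * int m}. unit_impulse (i + - j) *\<^sub>R f j) i"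
  proof (rule subdiv_pow_cong)
    fix l assume "l \<in> {i div 2 ^ k..i div 2 ^ k + 2 * int m}"
    then show "f l = (\<Sum>j\<in>{b..b + 2 * int m}. unit_impulse (l + - j) *\<^sub>R f j)"
      unfolding b_def unit_impulse_def
      by (subst sum.remove[of _ l]) (auto intro!: sum.neutral)
  qed
  also have "\<dots> = (\<Sum>j\<in>{b..b + 2 * int m}. (subdiv m c ^^ k) (\<lambda>i. unit_impulse (i + - j)) i *\<^sub>R f j)"
    by (simp add: subdiv_pow_sum subdiv_pow_scaleR)
  also have "\<dots> = (\<Sum>j\<in>{b..b + 2 * int m}. (subdiv m c ^^ k) unit_impulse (i - 2 ^ k * j) *\<^sub>R f j)"
    by (simp only: subdiv_pow_shift) simp
  finally show ?thesis .
qed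

lemma norm_diff2_le:
  assumes "\<And>j. 0 \<le> j \<Longrightarrow> j \<le> 2 * int m \<Longrightarrow> norm (f (b + j)) \<le> \<rho>" "0 \<le> j" "j \<le> 2 * int m - 2"
  shows "norm (diff2 f (b + j)) \<le> 4 * \<rho>"
proof -
  have "norm (diff2 f (b + j)) \<le> norm (f (b + j + 2) - 2 *\<^sub>R f (b + j + 1)) + norm (f (b + j))"
    unfolding diff2_def by (rule norm_triangle_ineq)
  also have "\<dots> \<le> norm (f (b + j + 2)) + norm (2 *\<^sub>R f (b + j + 1)) + norm (f (b + j))"
    by (intro add_right_mono norm_triangle_ineq4)
  also have "\<dots> \<le> 4 * \<rho>"
    using assms(1)[of "j + 2"] assms(1)[of "j + 1"] assms(1)[of j] assms(2,3)
    by (simp add: add.assoc)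
  finally show ?thesis .
qed

text \<open>A discrete Taylor estimate: first differences drift away from the first one by at most
  \<open>M\<close> per index, and summing them gives the quadratic bound.\<close>

lemma norm_sub_line_le:
  fixes f :: "int \<Rightarrow> 'a::real_normed_vector"
  assumes "\<And>j. 0 \<le> j \<Longrightarrow> j \<le> int N - 2 \<Longrightarrow> norm (diff2 f (b + j)) \<le> M" and "j \<le> N" and "0 \<le> M"
  shows "norm (f (b + int j) - f b - real j *\<^sub>R (f (b + 1) - f b)) \<le> real j ^ 2 * M"
proof -
  have d: "norm (f (b + int j + 1) - f (b + int j) - (f (b + 1) - f b)) \<le> real j * M" if "j < N" for j
    using that
  proof (induction j)
    case (Suc j)
    have "f (b + int (Suc j) + 1) - f (b + int (Suc j)) - (f (b + 1) - f b) =
        (f (b + int j + 1) - f (b + int j) - (f (b + 1) - f b)) + diff2 f (b + int j)"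
      by (simp add: diff2_def algebra_simps scaleR_2)
    also have "norm \<dots> \<le> real j * M + M"
      using Suc assms(1)[of "int j"] by (intro norm_triangle_mono) auto
    finally show ?case by (simp add: algebra_simps)
  qed simp
  show "norm (f (b + int j) - f b - real j *\<^sub>R (f (b + 1) - f b)) \<le> real j ^ 2 * M"
    using assms(2)
  proof (induction j)
    case (Suc j)
    have "f (b + int (Suc j)) - f b - real (Suc j) *\<^sub>R (f (b + 1) - f b) =
        (f (b + int j) - f b - real j *\<^sub>R (f (b + 1) - f b)) +
        (f (b + int j + 1) - f (b + int j) - (f (b + 1) - f b))"
      by (simp add: algebra_simps)
    also have "norm \<dots> \<le> real j ^ 2 * M + real j * M"
      using Suc d[of j] by (intro norm_triangle_mono) auto
    also have "\<dots> = (real j ^ 2 + real j) * M" by (simp add: algebra_simps)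
    also have "\<dots> \<le> real (Suc j) ^ 2 * M"
      using assms(3) by (intro mult_right_mono) (auto simp: power2_eq_square algebra_simps)
    finally show ?case .
  qed simp
qed

text \<open>Rounding \<open>t * 2 ^ k\<close> down gives dyadic points that tend to \<open>t\<close>
  and finally lie in \<open>U\<close>. Limits of schemes are computed at dyadic parameters; this
  transfers the resulting identities to all parameters.\<close>

lemma eq_if_eq_on_dyadics:
  fixes f g :: "real \<Rightarrow> 'a::t2_space"
  assumes "isCont f t" "isCont g t" "open U" "t \<in> U"
    and "\<And>k i. of_int i / 2 ^ k \<in> U \<Longrightarrow> f (of_int i / 2 ^ k) = g (of_int i / 2 ^ k)"
  shows "f t = g t"
proof -
  define s where "s k = of_int \<lfloor>t * 2 ^ k\<rfloor> / (2::real) ^ k" for k :: nat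
  have s_le: "\<bar>s k - t\<bar> \<le> (1/2) ^ k" for k
  proof -
    have "\<bar>of_int \<lfloor>t * 2 ^ k\<rfloor> - t * 2 ^ k\<bar> \<le> 1" by linarith
    moreover have "s k - t = (of_int \<lfloor>t * 2 ^ k\<rfloor> - t * 2 ^ k) * (1/2) ^ k"
      by (simp add: s_def field_simps power_divide)
    ultimately show ?thesis
      using mult_right_mono[of "\<bar>of_int \<lfloor>t * 2 ^ k\<rfloor> - t * 2 ^ k\<bar>" 1 "(1/2) ^ k"] by (simp add: abs_mult)
  qed
  have "(\<lambda>k. s k - t) \<longlonglongrightarrow> 0"
    by (rule tendsto_rabs_zero_cancel, rule tendsto_sandwich[OF _ _ tendsto_const LIMSEQ_power_zero[of "1/2"]])
      (use s_le in auto)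
  then have s: "s \<longlonglongrightarrow> t" by (simp add: LIM_zero_iff)
  have "(\<lambda>k. f (s k)) \<longlonglongrightarrow> f t" "(\<lambda>k. g (s k)) \<longlonglongrightarrow> g t"
    using assms(1,2) s by (auto intro: isCont_tendsto_compose)
  moreover have "\<forall>\<^sub>F k in sequentially. f (s k) = g (s k)"
    using topological_tendstoD[OF s assms(3,4)] by eventually_elim (auto simp: s_def assms(5))
  ultimately show ?thesis using LIMSEQ_unique Lim_transform_eventually by metis
qed

section \<open>Limit functions of a linear scheme\<close>

lemma sum_int_window: "(\<Sum>j\<in>{b..b + int N}. F j) = (\<Sum>k\<le>N. F (b + int k))"
  by (rule sum.reindex_bij_witness[of _ "\<lambda>k. b + int k" "\<lambda>j. nat (j - b)"]) auto

text \<open>The impulse response \<open>\<phi>\<close> of a linear scheme, with the properties that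
  are later read off from limit curves. Its support reflects that the rules look to the right only:
  index 0 influences parameters between \<open>- 2 * m\<close> and 1. The number
  \<open>\<tau>\<close> is the offset in the first moment of the weights; for a GLUE-scheme it is
  the shift plus \<open>m - 1\<close>.\<close>

locale refinable_function =
  fixes m :: nat and c :: "nat \<Rightarrow> nat \<Rightarrow> real" and \<tau> :: real
    and \<phi> \<phi>' \<phi>'' :: "real \<Rightarrow> real" and \<beta> K :: real
  assumes m_pos: "1 \<le> m"
    and sum_weights: "l < 2 \<Longrightarrow> (\<Sum>j\<le>m. c l j) = 1"
    and sum_weights_id: "l < 2 \<Longrightarrow> (\<Sum>j\<le>m. c l j * real j) = (real l + \<tau>) / 2"
    and supp: "\<phi> t \<noteq> 0 \<Longrightarrow> - 2 * real m < t \<and> t < 1"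
    and supp': "\<phi>' t \<noteq> 0 \<Longrightarrow> - 2 * real m \<le> t \<and> t \<le> 1"
    and supp'': "\<phi>'' t \<noteq> 0 \<Longrightarrow> - 2 * real m \<le> t \<and> t \<le> 1"
    and deriv: "(\<phi> has_field_derivative \<phi>' t) (at t)"
    and deriv': "(\<phi>' has_field_derivative \<phi>'' t) (at t)"
    and beta_pos: "0 < \<beta>"
    and hoelder: "\<bar>\<phi>'' s - \<phi>'' t\<bar> \<le> K * \<bar>s - t\<bar> powr \<beta>"
    and cascade: "0 < \<epsilon> \<Longrightarrow>
      \<forall>\<^sub>F k in sequentially. \<forall>i. \<bar>\<phi> (of_int i / 2 ^ k) - (subdiv m c ^^ k) unit_impulse i\<bar> < \<epsilon>"
begin

abbreviation S :: "(int \<Rightarrow> 'a::real_vector) \<Rightarrow> int \<Rightarrow> 'a" where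
  "S \<equiv> subdiv m c"

text \<open>The index range is the window that starts at \<lfloor>t\<rfloor>. It jumps with
  \<open>t\<close>; \<open>sum_eq_curve\<close> allows a larger range that stays fixed, which is
  what continuity requires.\<close>

definition curve :: "(int \<Rightarrow> 'a::real_vector) \<Rightarrow> real \<Rightarrow> 'a" where
  "curve f t = (\<Sum>j\<in>{\<lfloor>t\<rfloor>..\<lfloor>t\<rfloor> + 2 * int m}. \<phi> (t - of_int j) *\<^sub>R f j)"

lemma K_nonneg: "0 \<le> K"
  using hoelder[of 0 1] by (simp add: order_trans[OF abs_ge_zero])

lemma sum_eq_curve:
  assumes "finite J" "\<And>j. t - 1 < of_int j \<Longrightarrow> of_int j < t + 2 * real m \<Longrightarrow> j \<in> J"
  shows "(\<Sum>j\<in>J. \<phi> (t - of_int j) *\<^sub>R f j) = curve f t"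
proof -
  let ?I = "{\<lfloor>t\<rfloor>..\<lfloor>t\<rfloor> + 2 * int m}"
  have "j \<in> J \<inter> ?I" if "\<phi> (t - of_int j) \<noteq> 0" for j
    using supp[OF that] assms(2)[of j] by (auto simp: floor_le_iff) linarith+
  then have "(\<Sum>j\<in>J. \<phi> (t - of_int j) *\<^sub>R f j) = (\<Sum>j\<in>J \<inter> ?I. \<phi> (t - of_int j) *\<^sub>R f j)"
    and "curve f t = (\<Sum>j\<in>J \<inter> ?I. \<phi> (t - of_int j) *\<^sub>R f j)"
    unfolding curve_def using assms(1) by (auto intro!: sum.mono_neutral_right)
  then show ?thesis by simp
qed

lemma isCont_phi: "isCont \<phi> t" and isCont_phi': "isCont \<phi>' t"
  using deriv deriv' DERIV_isCont by blast+

lemma isCont_phi'': "isCont \<phi>'' t"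
proof -
  have "((\<lambda>s. K * \<bar>s - t\<bar> powr \<beta>) \<longlongrightarrow> K * \<bar>t - t\<bar> powr \<beta>) (at t)"
    using beta_pos by (intro tendsto_intros) auto
  then have "((\<lambda>s. K * \<bar>s - t\<bar> powr \<beta>) \<longlongrightarrow> 0) (at t)" by simp
  then have "((\<lambda>s. \<phi>'' s - \<phi>'' t) \<longlongrightarrow> 0) (at t)"
    by (rule Lim_null_comparison[rotated]) (simp add: hoelder)
  then show ?thesis by (simp add: isCont_def LIM_zero_iff)
qed

lemma ex_bound_if_supp:
  assumes "\<And>t. isCont \<psi> t" "\<And>t. \<psi> t \<noteq> 0 \<Longrightarrow> - 2 * real m \<le> t \<and> t \<le> 1"
  obtains B where "0 < B" "\<And>t. \<bar>\<psi> t\<bar> \<le> (B::real)"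
proof -
  have "compact (\<psi> ` {- 2 * real m..1})"
    using assms(1) by (intro compact_continuous_image continuous_at_imp_continuous_on) auto
  then obtain B where B: "\<forall>x \<in> \<psi> ` {- 2 * real m..1}. norm x \<le> B"
    using compact_imp_bounded bounded_iff by metis
  show thesis
  proof (rule that[of "max B 1"])
    show "\<bar>\<psi> t\<bar> \<le> max B 1" for t
      using assms(2)[of t] B by (cases "\<psi> t = 0") (auto simp: le_max_iff_disj)
  qed simp
qed

lemma isCont_curve:
  fixes f :: "int \<Rightarrow> 'a::real_normed_vector"
  shows "isCont (curve f) t"
proof -
  let ?J = "{\<lfloor>t\<rfloor> - 2..\<lfloor>t\<rfloor> + 2 + 2 * int m}"
  have "curve f s = (\<Sum>j\<in>?J. \<phi> (s - of_int j) *\<^sub>R f j)" if "dist s t < 1" for s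
    by (rule sum_eq_curve[symmetric]) (use that in \<open>auto simp: dist_real_def floor_le_iff le_floor_iff\<close>, linarith+)
  then have ev: "\<forall>\<^sub>F s in nhds t. curve f s = (\<Sum>j\<in>?J. \<phi> (s - of_int j) *\<^sub>R f j)"
    unfolding eventually_nhds_metric by (meson zero_less_one)
  have "isCont (\<lambda>s. \<Sum>j\<in>?J. \<phi> (s - of_int j) *\<^sub>R f j) t"
    by (intro continuous_intros isCont_o2[OF _ isCont_phi])
  then show ?thesis using isCont_cong[OF ev] by blast
qed

lemma subdiv_pow_sub_curve_le:
  fixes f :: "int \<Rightarrow> 'a::real_normed_vector"
  assumes "\<forall>i. \<bar>\<phi> (of_int i / 2 ^ k) - (S ^^ k) unit_impulse i\<bar> < \<epsilon>"
  shows "norm ((S ^^ k) f i - curve f (of_int i / 2 ^ k)) \<le>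
    \<epsilon> * (\<Sum>j\<in>{i div 2 ^ k..i div 2 ^ k + 2 * int m}. norm (f j))"
proof -
  have b: "\<lfloor>of_int i / (2::real) ^ k\<rfloor> = i div 2 ^ k"
    using floor_divide_of_int_eq[of i "2 ^ k"] by simp
  have "norm (((S ^^ k) unit_impulse (i - 2 ^ k * j) - \<phi> (of_int i / 2 ^ k - of_int j)) *\<^sub>R f j)
      \<le> \<epsilon> * norm (f j)" for j
  proof -
    have "of_int i / 2 ^ k - of_int j = (of_int (i - 2 ^ k * j) :: real) / 2 ^ k"
      by (simp add: field_simps)
    then have "\<bar>(S ^^ k) unit_impulse (i - 2 ^ k * j) - \<phi> (of_int i / 2 ^ k - of_int j)\<bar> \<le> \<epsilon>"
      using assms[rule_format, of "i - 2 ^ k * j"] by (simp add: abs_minus_commute)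
    then show ?thesis by (simp add: mult_right_mono)
  qed
  then show ?thesis
    unfolding curve_def b subdiv_pow_eq_sum_impulse[of k m c f i] sum_subtractf[symmetric] sum_distrib_left
      scaleR_diff_left[symmetric]
    by (intro sum_norm_le) auto
qed

text \<open>Index \<open>i * 2 ^ p\<close> at level \<open>k + p\<close> stays over the parameter
  \<open>i / 2 ^ k\<close>, so the window of data in the error bound is the same for all
  \<open>p\<close> and the bound is \<open>\<epsilon>\<close> times a constant.\<close>

lemma subdiv_pow_tendsto_curve:
  fixes f :: "int \<Rightarrow> 'a::real_normed_vector"
  shows "(\<lambda>p. (S ^^ (k + p)) f (i * 2 ^ p)) \<longlonglongrightarrow> curve f (of_int i / 2 ^ k)"
proof (rule LIMSEQ_I)
  fix r :: real assume "0 < r"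
  define V where "V = (\<Sum>j\<in>{i div 2 ^ k..i div 2 ^ k + 2 * int m}. norm (f j))"
  have V: "0 \<le> V" unfolding V_def by (rule sum_nonneg) simp
  define \<epsilon> where "\<epsilon> = r / (V + 1)"
  have "0 < \<epsilon>" using \<open>0 < r\<close> V by (simp add: \<epsilon>_def)
  from cascade[OF this] obtain p0 where
    p0: "\<forall>p\<ge>p0. \<forall>i. \<bar>\<phi> (of_int i / 2 ^ p) - (S ^^ p) unit_impulse i\<bar> < \<epsilon>"
    unfolding eventually_sequentially by blast
  have "norm ((S ^^ (k + p)) f (i * 2 ^ p) - curve f (of_int i / 2 ^ k)) < r" if "p0 \<le> p" for p
  proof -
    have "norm ((S ^^ (k + p)) f (i * 2 ^ p) - curve f (of_int (i * 2 ^ p) / 2 ^ (k + p))) \<le>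
      \<epsilon> * (\<Sum>j\<in>{(i * 2 ^ p) div 2 ^ (k + p)..(i * 2 ^ p) div 2 ^ (k + p) + 2 * int m}. norm (f j))"
      using p0 that by (intro subdiv_pow_sub_curve_le) auto
    also have "(i * 2 ^ p) div 2 ^ (k + p) = i div 2 ^ k"
      by (simp add: power_add)
    also have "of_int (i * 2 ^ p) / 2 ^ (k + p) = (of_int i :: real) / 2 ^ k"
      by (simp add: power_add)
    also have "\<epsilon> * (\<Sum>j\<in>{i div 2 ^ k..i div 2 ^ k + 2 * int m}. norm (f j)) < r"
      using \<open>0 < r\<close> V unfolding V_def[symmetric] \<epsilon>_def by (simp add: field_simps)
    finally show ?thesis .
  qed
  then show "\<exists>no. \<forall>p\<ge>no. norm ((S ^^ (k + p)) f (i * 2 ^ p) - curve f (of_int i / 2 ^ k)) < r"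
    by blast
qed

text \<open>The refinement equation in summed form. At dyadic parameters both sides are limits of
  the same values, one step being counted either among the data or among the iterations.\<close>

lemma curve_subdiv:
  fixes f :: "int \<Rightarrow> 'a::real_normed_vector"
  shows "curve (S f) (2 * t) = curve f t"
proof (rule eq_if_eq_on_dyadics[where g = "curve f" and f = "\<lambda>t. curve (S f) (2 * t)" and U = UNIV])
  show "isCont (\<lambda>t. curve (S f) (2 * t)) t"
    by (intro isCont_o2[OF _ isCont_curve] continuous_intros)
  show "curve (S f) (2 * (of_int i / 2 ^ k)) = curve f (of_int i / 2 ^ k)" for k i
  proof -
    have "(\<lambda>p. (S ^^ (k + p)) (S f) (2 * i * 2 ^ p)) \<longlonglongrightarrow> curve (S f) (of_int (2 * i) / 2 ^ k)"
      by (rule subdiv_pow_tendsto_curve)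
    moreover have "(\<lambda>p. (S ^^ (k + Suc p)) f (i * 2 ^ Suc p)) \<longlonglongrightarrow> curve f (of_int i / 2 ^ k)"
      by (rule LIMSEQ_Suc[OF subdiv_pow_tendsto_curve])
    moreover have "(S ^^ (k + Suc p)) f (i * 2 ^ Suc p) = (S ^^ (k + p)) (S f) (2 * i * 2 ^ p)" for p
    proof -
      have "i * 2 ^ Suc p = 2 * i * 2 ^ p" by simp
      then show ?thesis by (simp only: add_Suc_right funpow_Suc_right o_apply)
    qed
    ultimately show ?thesis using LIMSEQ_unique by auto
  qed
qed (auto intro: isCont_curve)

lemma curve_subdiv_pow:
  fixes f :: "int \<Rightarrow> 'a::real_normed_vector"
  shows "curve ((S ^^ k) f) (2 ^ k * t) = curve f t"
proof (induction k)
  case (Suc k)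
  then show ?case using curve_subdiv[of "(S ^^ k) f" "2 ^ k * t"] by (simp add: mult.assoc)
qed simp

lemma nat_mod_2_less: "nat (i mod 2) < 2"
  by simp

text \<open>The sum of the weights preserves position and their first moment halves the slope. The
  parity of \<open>i\<close> drops out because the moment contains the term
  \<open>l / 2\<close>.\<close>

lemma subdiv_line:
  fixes v x :: "'a::real_vector"
  shows "S (\<lambda>j. x + of_int j *\<^sub>R v) = (\<lambda>j. (x + (\<tau> / 2) *\<^sub>R v) + of_int j *\<^sub>R ((1/2) *\<^sub>R v))"
proof
  fix i
  let ?l = "nat (i mod 2)"
  have "S (\<lambda>j. x + of_int j *\<^sub>R v) i
      = (\<Sum>j\<le>m. c ?l j) *\<^sub>R (x + of_int (i div 2) *\<^sub>R v) + (\<Sum>j\<le>m. c ?l j * real j) *\<^sub>R v"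
    unfolding subdiv_def by (simp add: scaleR_sum_left scaleR_left_distrib scaleR_right_distrib sum.distrib sum_distrib_right)
  also have "\<dots> = x + (of_int (i div 2) + (of_int (i mod 2) + \<tau>) / 2) *\<^sub>R v"
    by (simp add: sum_weights[OF nat_mod_2_less] sum_weights_id[OF nat_mod_2_less] scaleR_left_distrib add.assoc)
  also have "of_int (i div 2) + (of_int (i mod 2) + \<tau>) / 2 = \<tau> / 2 + of_int i * (1/2)"
  proof -
    have "real_of_int i = 2 * of_int (i div 2) + of_int (i mod 2)"
      by (metis mult_div_mod_eq of_int_add of_int_mult of_int_numeral)
    then show ?thesis by (simp add: add_divide_distrib)
  qed
  finally show "S (\<lambda>j. x + of_int j *\<^sub>R v) i = (x + (\<tau> / 2) *\<^sub>R v) + of_int i *\<^sub>R ((1/2) *\<^sub>R v)"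
    by (simp add: scaleR_left_distrib add.assoc)
qed

lemma subdiv_pow_line:
  fixes v x :: "'a::real_vector"
  shows "(S ^^ k) (\<lambda>j. x + of_int j *\<^sub>R v) =
    (\<lambda>j. (x + (\<tau> * (1 - (1/2) ^ k)) *\<^sub>R v) + of_int j *\<^sub>R ((1/2) ^ k *\<^sub>R v))"
proof (induction k)
  case (Suc k)
  have e: "(x + (\<tau> * (1 - (1/2) ^ k)) *\<^sub>R v) + (\<tau> / 2) *\<^sub>R ((1/2) ^ k *\<^sub>R v) =
      x + (\<tau> * (1 - (1/2) ^ Suc k)) *\<^sub>R v"
    by (simp add: add.assoc flip: scaleR_left_distrib) (simp add: algebra_simps)
  show ?case by (simp only: funpow.simps o_apply Suc.IH subdiv_line e) simp
qed simp

text \<open>The displacements \<tau>/2, \<tau>/4, ... add up to \<open>\<tau>\<close>, which is the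
  shift of the parameter in the limit.\<close>

lemma curve_line:
  fixes v x :: "'a::real_normed_vector"
  shows "curve (\<lambda>j. x + of_int j *\<^sub>R v) t = x + (t + \<tau>) *\<^sub>R v"
proof (rule eq_if_eq_on_dyadics[where g = "\<lambda>t. x + (t + \<tau>) *\<^sub>R v" and U = UNIV])
  show "curve (\<lambda>j. x + of_int j *\<^sub>R v) (of_int i / 2 ^ k) = x + (of_int i / 2 ^ k + \<tau>) *\<^sub>R v" for k i
  proof (rule LIMSEQ_unique[OF subdiv_pow_tendsto_curve])
    have "(\<lambda>p. (x + (\<tau> * (1 - (1/2) ^ k * (1/2) ^ p)) *\<^sub>R v) + (of_int i / 2 ^ k) *\<^sub>R v) \<longlonglongrightarrow>
      (x + (\<tau> * (1 - (1/2) ^ k * 0)) *\<^sub>R v) + (of_int i / 2 ^ k) *\<^sub>R v"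
      by (intro tendsto_intros LIMSEQ_power_zero) auto
    moreover have "(S ^^ (k + p)) (\<lambda>j. x + of_int j *\<^sub>R v) (i * 2 ^ p) =
      (x + (\<tau> * (1 - (1/2) ^ k * (1/2) ^ p)) *\<^sub>R v) + (of_int i / 2 ^ k) *\<^sub>R v" for p
      unfolding subdiv_pow_line by (simp add: power_add power_divide)
    moreover have "(x + (\<tau> * (1 - (1/2) ^ k * 0)) *\<^sub>R v) + (of_int i / 2 ^ k) *\<^sub>R v =
        x + (of_int i / 2 ^ k + \<tau>) *\<^sub>R v"
      by (simp add: algebra_simps)
    ultimately show "(\<lambda>p. (S ^^ (k + p)) (\<lambda>j. x + of_int j *\<^sub>R v) (i * 2 ^ p)) \<longlonglongrightarrow>
        x + (of_int i / 2 ^ k + \<tau>) *\<^sub>R v"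
      by (simp only:)
  qed
qed (auto intro!: isCont_curve continuous_intros)

lemma curve_window:
  fixes f :: "int \<Rightarrow> 'a::real_vector"
  assumes "0 \<le> t" "t \<le> 1"
  shows "curve f (of_int a + t) = (\<Sum>j\<le>2 * m. \<phi> (t - real j) *\<^sub>R f (a + int j))"
proof -
  have "curve f (of_int a + t) = (\<Sum>j\<in>{a..a + int (2 * m)}. \<phi> (of_int a + t - of_int j) *\<^sub>R f j)"
  proof (rule sum_eq_curve[symmetric])
    show "j \<in> {a..a + int (2 * m)}" if "of_int a + t - 1 < of_int j" "of_int j < of_int a + t + 2 * real m" for j
    proof -
      have "real_of_int (a - 1) < of_int j" "real_of_int j < of_int (a + 1 + 2 * int m)" using that assms by simp_all
      then show ?thesis unfolding of_int_less_iff by simp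
    qed
  qed simp
  then show ?thesis unfolding sum_int_window by simp
qed

end

section \<open>Second differences and the adapted seminorm\<close>

lemma diff2_line: "diff2 (\<lambda>j. x + of_int j *\<^sub>R v) i = (0 :: 'a::real_vector)"
  by (simp add: diff2_def scaleR_2 scaleR_left_distrib)

lemma diff2_add: "diff2 (\<lambda>i. f i + h i) i = diff2 f i + diff2 h i"
  by (simp add: diff2_def algebra_simps)

lemma abs_Taylor2_le:
  fixes g g' g'' :: "real \<Rightarrow> real"
  assumes g: "\<And>x. (g has_field_derivative g' x) (at x)"
    and g': "\<And>x. (g' has_field_derivative g'' x) (at x)"
    and B: "\<And>x. \<bar>g'' x\<bar> \<le> B" and x: "0 \<le> x"
  shows "\<bar>g (y + x) - g y - x * g' y\<bar> \<le> B * x\<^sup>2"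
proof -
  have g'B: "\<bar>g' (y + z) - g' y\<bar> \<le> B * x" if "0 \<le> z" "z \<le> x" for z
  proof -
    have "norm (g' (y + z) - g' y) \<le> B * norm (y + z - y)"
      by (rule field_differentiable_bound[of UNIV g' g''])
        (auto intro: has_field_derivative_at_within g' B)
    also have "\<dots> \<le> B * x"
      using that order_trans[OF abs_ge_zero B] by (intro mult_left_mono) auto
    finally show ?thesis by simp
  qed
  have "norm ((g (y + x) - x * g' y) - (g (y + 0) - 0 * g' y)) \<le> (B * x) * norm (x - 0)"
  proof (rule field_differentiable_bound[of "{0..x}" "\<lambda>z. g (y + z) - z * g' y" "\<lambda>z. g' (y + z) - g' y"])
    show "((\<lambda>z. g (y + z) - z * g' y) has_field_derivative g' (y + z) - g' y) (at z within {0..x})" for z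
      by (rule has_field_derivative_at_within) (auto intro!: derivative_eq_intros DERIV_chain2[OF g])
  qed (use x g'B in auto)
  then show ?thesis using x by (simp add: power2_eq_square algebra_simps)
qed

text \<open>\<open>coercive\<close> is the quantitative form of linear independence on
  \<open>{0..1}\<close> of the \<open>2 * m + 1\<close> translates of \<open>\<phi>\<close> that
  live there: the limit over a unit interval controls the window of data behind it.\<close>

locale refinable = refinable_function m c \<tau> \<phi> \<phi>' \<phi>'' \<beta> K
  for m c \<tau> \<phi> \<phi>' \<phi>'' \<beta> K +
  fixes C0 :: real
  assumes coercive: "\<lbrakk>\<And>t. 0 \<le> t \<Longrightarrow> t \<le> 1 \<Longrightarrow> \<bar>\<Sum>j\<le>2*m. h j * \<phi> (t - real j)\<bar> \<le> \<epsilon>; j \<le> 2 * m\<rbrakk>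
      \<Longrightarrow> \<bar>h j\<bar> \<le> C0 * \<epsilon>"
begin

lemma C0_nonneg: "0 \<le> C0"
  using coercive[of "\<lambda>_. 0" 1 0] by simp

text \<open>\<open>flat f b M\<close> says that the seminorm with built-in contraction factor \<open>1/4\<close> of the window of
  \<open>f\<close> starting at \<open>b\<close> is at most \<open>M\<close>.\<close>

definition flat :: "(int \<Rightarrow> 'a::real_normed_vector) \<Rightarrow> int \<Rightarrow> real \<Rightarrow> bool" where
  "flat f b M \<longleftrightarrow> (\<forall>k s j. s div 2 ^ k = b \<and> 0 \<le> j \<and> j \<le> 2 * int m - 2 \<longrightarrow>
     norm (diff2 ((S ^^ k) f) (s + j)) \<le> M / 4 ^ k)"

lemma flatD: "flat f b M \<Longrightarrow> 0 \<le> j \<Longrightarrow> j \<le> 2 * int m - 2 \<Longrightarrow> norm (diff2 f (b + j)) \<le> M"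
  unfolding flat_def by (elim allE[of _ 0] allE[of _ b] allE[of _ j]) auto

lemma flat_mono:
  assumes "flat f b M" "M \<le> M'"
  shows "flat f b M'"
  using assms(1)
  unfolding flat_def
  by (fastforce intro: order_trans[OF _ divide_right_mono[OF assms(2) zero_le_power[OF zero_le_numeral]]])

text \<open>Iterate \<open>k\<close> of \<open>S f\<close> is iterate \<open>k + 1\<close> of
  \<open>f\<close>, and windows below \<open>b'\<close> are windows below \<open>b\<close>. The
  factor 1/4 is a mere shift of the index in the supremum.\<close>

lemma flat_subdiv:
  assumes "flat f b M" "b' div 2 = b"
  shows "flat (S f) b' (M / 4)"
  unfolding flat_def
proof (intro allI impI)
  fix k s j assume *: "s div 2 ^ k = b' \<and> 0 \<le> j \<and> j \<le> 2 * int m - 2"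
  then have "s div 2 ^ Suc k = b"
    using assms(2) by (simp only: div_2_pow_Suc)
  with * assms(1) have "norm (diff2 ((S ^^ Suc k) f) (s + j)) \<le> M / 4 ^ Suc k"
    unfolding flat_def by blast
  then show "norm (diff2 ((S ^^ k) (S f)) (s + j)) \<le> M / 4 / 4 ^ k"
    by (simp add: funpow_Suc_right del: funpow.simps)
qed

lemma flat_add:
  assumes "flat f b M" "flat h b M'"
  shows "flat (\<lambda>i. f i + h i) b (M + M')"
  using assms unfolding flat_def subdiv_pow_add diff2_add add_divide_distrib
  by (blast intro: norm_triangle_mono)

text \<open>Finiteness of the seminorm. Once the straight part of the data is removed, the limit
  curve has second derivative O(M). Over an interval of length \<open>1 / 2 ^ k\<close> it deviates
  from its tangent by O(M / 4^k), the tangent is the limit of straight data by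
  \<open>curve_line\<close>, and \<open>coercive\<close> carries the deviation back to the data at
  level \<open>k\<close>. Straight data have no second differences.\<close>

lemma flat_if_diff2_real:
  "\<exists>C\<ge>0. \<forall>(f :: int \<Rightarrow> real) b M. (\<forall>j. 0 \<le> j \<and> j \<le> 2 * int m - 2 \<longrightarrow> \<bar>diff2 f (b + j)\<bar> \<le> M) \<longrightarrow>
     flat f b (C * M)"
proof -
  obtain B where B: "0 < B" "\<And>t. \<bar>\<phi>'' t\<bar> \<le> B"
    using ex_bound_if_supp[OF isCont_phi'' supp''] by blast
  \<comment> \<open>The number of terms, times the bound of \<open>\<phi>''\<close>, times the bound
    of the remainders \<open>r\<close> relative to \<open>M\<close>.\<close>
  define D where "D = real (2 * m + 1) * (B * (real (2 * m))\<^sup>2)"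
  have D: "0 \<le> D" using B by (simp add: D_def)
  have "flat f b (4 * C0 * D * M)"
    if f: "\<forall>j. 0 \<le> j \<and> j \<le> 2 * int m - 2 \<longrightarrow> \<bar>diff2 f (b + j)\<bar> \<le> M" for f :: "int \<Rightarrow> real" and b M
    unfolding flat_def
  proof (intro allI impI)
    fix k s j assume *: "s div 2 ^ k = b \<and> 0 \<le> j \<and> j \<le> 2 * int m - 2"
    have M: "0 \<le> M" using f[rule_format, of 0] m_pos by linarith
    define v x where "v = f (b + 1) - f b" and "x = f b - of_int b * v"
    define r where "r i = f i - (x + of_int i *\<^sub>R v)" for i
    have r: "\<bar>r (b + int i)\<bar> \<le> (real (2 * m))\<^sup>2 * M" if "i \<le> 2 * m" for i
    proof -
      have "\<bar>r (b + int i)\<bar> \<le> (real i)\<^sup>2 * M"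
        using norm_sub_line_le[of "2 * m" f b M i] f M that
        by (simp add: r_def x_def v_def algebra_simps)
      also have "\<dots> \<le> (real (2 * m))\<^sup>2 * M"
        using that M by (intro mult_right_mono power_mono) auto
      finally show ?thesis .
    qed
    define g g' g'' where "g y = (\<Sum>i\<le>2 * m. \<phi> (y - real i) * r (b + int i))"
      and "g' y = (\<Sum>i\<le>2 * m. \<phi>' (y - real i) * r (b + int i))"
      and "g'' y = (\<Sum>i\<le>2 * m. \<phi>'' (y - real i) * r (b + int i))" for y
    have dg: "(g has_field_derivative g' y) (at y)" "(g' has_field_derivative g'' y) (at y)" for y
      unfolding g_def g'_def g''_def
      by (auto intro!: derivative_eq_intros DERIV_chain2[OF deriv] DERIV_chain2[OF deriv'])
    have g'': "\<bar>g'' y\<bar> \<le> D * M" for y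
    proof -
      have "\<bar>g'' y\<bar> \<le> (\<Sum>i\<le>2 * m. B * ((real (2 * m))\<^sup>2 * M))"
        unfolding g''_def
      proof (rule order_trans[OF sum_abs sum_mono])
        fix i assume "i \<in> {..2 * m}"
        then show "\<bar>\<phi>'' (y - real i) * r (b + int i)\<bar> \<le> B * ((real (2 * m))\<^sup>2 * M)"
          unfolding abs_mult using B r by (intro mult_mono) auto
      qed
      then show ?thesis by (simp add: D_def algebra_simps)
    qed
    \<comment> \<open>The position, within the unit interval that belongs to \<open>b\<close>, of
      the dyadic interval that belongs to \<open>s\<close>.\<close>
    define y0 :: real where "y0 = of_int s / 2 ^ k - of_int b"
    have s: "of_int s = 2 ^ k * real_of_int b + of_int (s mod 2 ^ k)"
      using * by (metis mult_div_mod_eq of_int_add of_int_mult of_int_numeral of_int_power)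
    have y0: "0 \<le> y0" "y0 + 1 / 2 ^ k \<le> 1"
    proof -
      have e: "y0 = of_int (s mod 2 ^ k) / 2 ^ k" unfolding y0_def s by (simp add: field_simps)
      then show "0 \<le> y0" by simp
      have "s mod 2 ^ k < 2 ^ k" by simp
      then have "s mod 2 ^ k + 1 \<le> 2 ^ k" by linarith
      then have "real_of_int (s mod 2 ^ k + 1) \<le> of_int (2 ^ k)" by (simp only: of_int_le_iff)
      then have "real_of_int (s mod 2 ^ k) + 1 \<le> 2 ^ k" by simp
      then show "y0 + 1 / 2 ^ k \<le> 1" unfolding e by (simp add: field_simps)
    qed
    \<comment> \<open>One index at level \<open>k\<close> is a parameter step of
      \<open>1 / 2 ^ k\<close>, so \<open>q\<close> is the slope of the tangent per index. The
      constant in \<open>h\<close> compensates for the displacement by \<open>\<tau>\<close> in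
      \<open>curve_line\<close> and for indices being counted from 0 instead of
      \<open>s\<close>.\<close>
    define q where "q = (1/2) ^ k * g' y0"
    define h where "h i = (S ^^ k) r i + (- (g y0 - q * \<tau> - of_int s * q) + of_int i *\<^sub>R (- q))" for i
    have h: "\<bar>h (s + int i)\<bar> \<le> C0 * (D * M / 4 ^ k)" if "i \<le> 2 * m" for i
    proof (rule coercive[of "\<lambda>i. h (s + int i)", OF _ that])
      fix t :: real assume t: "0 \<le> t" "t \<le> 1"
      define x where "x = (1/2) ^ k * t"
      have x: "0 \<le> x" "x \<le> 1 / 2 ^ k" using t by (auto simp: x_def field_simps)
      have "(\<Sum>i\<le>2 * m. \<phi> (t - real i) *\<^sub>R (S ^^ k) r (s + int i)) = curve ((S ^^ k) r) (of_int s + t)"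
        by (rule curve_window[OF t, symmetric])
      also have "of_int s + t = 2 ^ k * (of_int b + (y0 + x))"
        by (simp add: y0_def x_def field_simps power_divide)
      also have "curve ((S ^^ k) r) \<dots> = curve r (of_int b + (y0 + x))"
        by (rule curve_subdiv_pow)
      also have "\<dots> = g (y0 + x)"
        using x y0 by (subst curve_window) (auto simp: g_def)
      finally have 1: "(\<Sum>i\<le>2 * m. \<phi> (t - real i) *\<^sub>R (S ^^ k) r (s + int i)) = g (y0 + x)" .
      have "(\<Sum>i\<le>2 * m. \<phi> (t - real i) *\<^sub>R (- (g y0 - q * \<tau> - of_int s * q) + of_int (s + int i) *\<^sub>R (- q)))
          = curve (\<lambda>i. - (g y0 - q * \<tau> - of_int s * q) + of_int i *\<^sub>R (- q)) (of_int s + t)"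
        by (rule curve_window[OF t, symmetric])
      also have "\<dots> = - g y0 - x * g' y0"
        unfolding curve_line by (simp add: q_def x_def algebra_simps)
      finally have 2: "(\<Sum>i\<le>2 * m. \<phi> (t - real i) *\<^sub>R
          (- (g y0 - q * \<tau> - of_int s * q) + of_int (s + int i) *\<^sub>R (- q))) = - g y0 - x * g' y0" .
      have "(\<Sum>i\<le>2 * m. h (s + int i) * \<phi> (t - real i)) = g (y0 + x) + (- g y0 - x * g' y0)"
        unfolding 1[symmetric] 2[symmetric] sum.distrib[symmetric] h_def
        by (rule sum.cong) (simp_all add: algebra_simps)
      then have "\<bar>\<Sum>i\<le>2 * m. h (s + int i) * \<phi> (t - real i)\<bar> \<le> D * M * x\<^sup>2"
        using abs_Taylor2_le[OF dg g'' x(1), of y0] by (simp add: algebra_simps)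
      also have "\<dots> \<le> D * M * (1 / 2 ^ k)\<^sup>2"
        using x D M by (intro mult_left_mono power_mono) auto
      also have "\<dots> = D * M / 4 ^ k"
        by (simp add: power_divide power2_eq_square flip: power_mult_distrib)
      finally show "\<bar>\<Sum>i\<le>2 * m. h (s + int i) * \<phi> (t - real i)\<bar> \<le> D * M / 4 ^ k" .
    qed
    have "norm (diff2 h (s + j)) \<le> 4 * (C0 * (D * M / 4 ^ k))"
    proof (rule norm_diff2_le)
      fix j assume "0 \<le> j" "j \<le> 2 * int m"
      then show "norm (h (s + j)) \<le> C0 * (D * M / 4 ^ k)"
        using h[of "nat j"] by auto
    qed (use * in auto)
    moreover have "f = (\<lambda>i. r i + (x + of_int i *\<^sub>R v))" by (simp add: r_def fun_eq_iff)
    then have "(S ^^ k) f = (\<lambda>i. (S ^^ k) r i + (S ^^ k) (\<lambda>i. x + of_int i *\<^sub>R v) i)"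
      by (simp only: subdiv_pow_add)
    then have "diff2 ((S ^^ k) f) (s + j) = diff2 ((S ^^ k) r) (s + j)"
      by (simp only: subdiv_pow_line) (simp only: diff2_add[of "(S ^^ k) r"] diff2_line add_0_right)
    moreover have "diff2 h (s + j) = diff2 ((S ^^ k) r) (s + j)"
      unfolding h_def by (simp only: diff2_add[of "(S ^^ k) r"] diff2_line add_0_right)
    ultimately show "norm (diff2 ((S ^^ k) f) (s + j)) \<le> 4 * C0 * D * M / 4 ^ k" by simp
  qed
  then show ?thesis using C0_nonneg D by (intro exI[of _ "4 * C0 * D"]) auto
qed

text \<open>Vectors are tested against the direction \<open>u\<close> of the second difference to be
  bounded. Since \<open>S\<close> commutes with the inner product with \<open>u\<close>, the scalar
  constant serves again.\<close>

lemma flat_if_diff2: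
  obtains C where "0 \<le> C" "\<And>(f :: int \<Rightarrow> 'a::real_inner) b M.
    (\<And>j. 0 \<le> j \<Longrightarrow> j \<le> 2 * int m - 2 \<Longrightarrow> norm (diff2 f (b + j)) \<le> M) \<Longrightarrow> flat f b (C * M)"
proof -
  obtain C where C: "0 \<le> C" "\<And>(f :: int \<Rightarrow> real) b M.
    (\<forall>j. 0 \<le> j \<and> j \<le> 2 * int m - 2 \<longrightarrow> \<bar>diff2 f (b + j)\<bar> \<le> M) \<Longrightarrow> flat f b (C * M)"
    using flat_if_diff2_real by blast
  have "flat f b (C * M)"
    if f: "\<And>j. 0 \<le> j \<Longrightarrow> j \<le> 2 * int m - 2 \<Longrightarrow> norm (diff2 f (b + j)) \<le> M"
    for f :: "int \<Rightarrow> 'a" and b M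
    unfolding flat_def
  proof (intro allI impI)
    fix k s j assume *: "s div 2 ^ k = b \<and> 0 \<le> j \<and> j \<le> 2 * int m - 2"
    define u where "u = sgn (diff2 ((S ^^ k) f) (s + j))"
    have u: "norm u \<le> 1" by (simp add: u_def norm_sgn)
    have lin: "linear (\<lambda>x. x \<bullet> u)" by (rule bounded_linear.linear[OF bounded_linear_inner_left])
    have d: "diff2 (\<lambda>i. h i \<bullet> u) i = diff2 h i \<bullet> u" for h i
      by (simp add: diff2_def inner_diff_left inner_add_left)
    have "\<bar>diff2 f (b + j) \<bullet> u\<bar> \<le> M" if "0 \<le> j" "j \<le> 2 * int m - 2" for j
      using Cauchy_Schwarz_ineq2[of "diff2 f (b + j)" u] mult_left_mono[OF u, of "norm (diff2 f (b + j))"]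
        f[OF that] by simp
    then have "flat (\<lambda>i. f i \<bullet> u) b (C * M)" by (intro C) (simp add: d)
    then have "\<bar>diff2 ((S ^^ k) f) (s + j) \<bullet> u\<bar> \<le> C * M / 4 ^ k"
      using * unfolding flat_def by (simp add: subdiv_pow_linear[OF lin] d)
    moreover have "diff2 ((S ^^ k) f) (s + j) \<bullet> u = norm (diff2 ((S ^^ k) f) (s + j))"
    proof (cases "diff2 ((S ^^ k) f) (s + j) = 0")
      case False
      then show ?thesis
        by (simp add: u_def sgn_div_norm dot_square_norm power2_eq_square)
    qed simp
    ultimately show "norm (diff2 ((S ^^ k) f) (s + j)) \<le> C * M / 4 ^ k" by linarith
  qed
  with C(1) show thesis by (rule that)
qed

end

section \<open>Quasi-linear perturbations\<close>

text \<open>The iterates of a scheme as sequences whose relevant part lies over \<open>L\<close>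
  unit intervals: windows at level \<open>l\<close> start at the indices in
  \<open>{0..<2 ^ l * L}\<close>. In \<open>close\<close>, a window accounts for the
  \<open>2 * m + 2\<close> points that a chain of \<open>2 * m + 1\<close> points produces, with an
  error superlinear in its deviation \<open>\<rho>\<close> from the line through its first two
  points.\<close>

locale perturbed = refinable m c \<tau> \<phi> \<phi>' \<phi>'' \<beta> K C0
  for m c \<tau> \<phi> \<phi>' \<phi>'' \<beta> K C0 +
  fixes X :: "nat \<Rightarrow> int \<Rightarrow> 'a::euclidean_space" and L :: int and \<delta> C \<nu> :: real
  assumes L_pos: "1 \<le> L" and nu_pos: "0 < \<nu>" and delta_pos: "0 < \<delta>" and C_nonneg: "0 \<le> C"
    and close: "\<lbrakk>0 \<le> b; b < 2 ^ l * L; X l (b + 1) \<noteq> X l b;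
        \<And>j. j \<le> 2 * m \<Longrightarrow> norm (X l (b + int j) - X l b - real j *\<^sub>R (X l (b + 1) - X l b)) \<le> \<rho>;
        \<rho> \<le> \<delta> * norm (X l (b + 1) - X l b); 2 * b \<le> i; i \<le> 2 * b + 2 * int m + 1\<rbrakk>
      \<Longrightarrow> norm (X (Suc l) i - S (X l) i) \<le> C * \<rho> * (\<rho> / norm (X l (b + 1) - X l b)) powr \<nu>"
    and straight: "0 < \<eta> \<Longrightarrow> \<exists>l. \<forall>b. 0 \<le> b \<and> b < 2 ^ l * L \<longrightarrow> X l (b + 1) \<noteq> X l b \<and>
        (\<forall>j. 0 \<le> j \<and> j \<le> 2 * int m - 2 \<longrightarrow>
          norm (diff2 (X l) (b + j)) \<le> \<eta> * norm (X l (b + 1) - X l b))"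
begin

abbreviation step :: "nat \<Rightarrow> int \<Rightarrow> 'a" where
  "step l b \<equiv> X l (b + 1) - X l b"

definition R :: "nat \<Rightarrow> int \<Rightarrow> 'a" where
  "R l i = X (Suc l) i - S (X l) i"

lemma norm_subdiv_le:
  fixes r :: "int \<Rightarrow> 'a"
  assumes "\<And>j. j \<le> m \<Longrightarrow> norm (r (i div 2 + int j)) \<le> \<rho>"
  shows "norm (S r i) \<le> (\<Sum>j\<le>m. \<bar>c 0 j\<bar> + \<bar>c 1 j\<bar>) * \<rho>"
proof -
  have "norm (S r i) \<le> (\<Sum>j\<le>m. (\<bar>c 0 j\<bar> + \<bar>c 1 j\<bar>) * \<rho>)"
    unfolding subdiv_def
  proof (rule sum_norm_le)
    fix j assume "j \<in> {..m}"
    moreover have "nat (i mod 2) = 0 \<or> nat (i mod 2) = 1" by linarith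
    then have "\<bar>c (nat (i mod 2)) j\<bar> \<le> \<bar>c 0 j\<bar> + \<bar>c 1 j\<bar>" by auto
    ultimately show "norm (c (nat (i mod 2)) j *\<^sub>R r (i div 2 + int j)) \<le> (\<bar>c 0 j\<bar> + \<bar>c 1 j\<bar>) * \<rho>"
      unfolding norm_scaleR using assms by (intro mult_mono) auto
  qed
  then show ?thesis by (simp add: sum_distrib_right)
qed

text \<open>From a window to a child the seminorm is multiplied by about 1/4 and the step by about
  1/2, hence their ratio by about 1/2. The slack in \<open>1/2 < \<theta>\<close> absorbs all errors
  once \<open>\<eta>\<close> is below a threshold, so that \<open>\<eta>\<close> may be replaced by
  \<open>\<theta> * \<eta>\<close>.\<close>

lemma one_step:
  assumes \<theta>: "1/2 < \<theta>"
  obtains \<eta>0 C1 where "0 < \<eta>0" "\<eta>0 \<le> 1" "0 \<le> C1"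
    "\<And>l b \<eta> i. \<lbrakk>0 \<le> b; b < 2 ^ l * L; X l (b + 1) \<noteq> X l b; 0 \<le> \<eta>; \<eta> \<le> \<eta>0; flat (X l) b (\<eta> * norm (step l b));
       2 * b \<le> i; i \<le> 2 * b + 2 * int m + 1\<rbrakk>
      \<Longrightarrow> norm (R l i) \<le> C1 * \<eta> powr (1 + \<nu>) * norm (step l b)"
    "\<And>l b \<eta> b'. \<lbrakk>0 \<le> b; b < 2 ^ l * L; X l (b + 1) \<noteq> X l b; 0 \<le> \<eta>; \<eta> \<le> \<eta>0; flat (X l) b (\<eta> * norm (step l b));
       b' div 2 = b\<rbrakk>
      \<Longrightarrow> X (Suc l) (b' + 1) \<noteq> X (Suc l) b' \<and> norm (step (Suc l) b') \<le> \<theta> * norm (step l b) \<and>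
         flat (X (Suc l)) b' (\<theta> * \<eta> * norm (step (Suc l) b'))"
proof -
  obtain C4 where C4: "0 \<le> C4" "\<And>(f :: int \<Rightarrow> 'a) b M.
    (\<And>j. 0 \<le> j \<Longrightarrow> j \<le> 2 * int m - 2 \<Longrightarrow> norm (diff2 f (b + j)) \<le> M) \<Longrightarrow> flat f b (C4 * M)"
    using flat_if_diff2 by blast
  define W where "W = (\<Sum>j\<le>m. \<bar>c 0 j\<bar> + \<bar>c 1 j\<bar>)"
  \<comment> \<open>\<open>q\<close> turns second differences into deviations over a window and
    \<open>W\<close> bounds \<open>S\<close>. \<open>C1\<close> belongs to the remainder, and
    \<open>C2\<close> to the change of a step, which involves two values of \<open>S r\<close> and
    two of \<open>R l\<close>.\<close>
  define q where "q = (real (2 * m))\<^sup>2"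
  define C1 where "C1 = C * (q * q powr \<nu>)"
  define C2 where "C2 = 2 * W * q + 2 * C1"
  have q: "0 < q" using m_pos by (simp add: q_def)
  have W: "0 \<le> W" unfolding W_def by (rule sum_nonneg) simp
  have C1: "0 \<le> C1" using C_nonneg q by (simp add: C1_def)
  have C2: "0 \<le> C2" using C1 W q by (simp add: C2_def)
  \<comment> \<open>The requirements on \<open>\<eta>0\<close> are strict inequalities that hold in
    the limit \<eta> \<rightarrow> 0. There the first two read 1/4 < \<theta>/2 and 1/2 <
    \<theta>.\<close>
  have "((\<lambda>\<eta>. \<theta> * (1/2 - C2 * \<eta>) - 1/4 - 4 * C4 * C1 * \<eta> powr \<nu>)
      \<longlongrightarrow> \<theta> * (1/2 - C2 * 0) - 1/4 - 4 * C4 * C1 * 0 powr \<nu>) (at_right 0)"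
    using nu_pos by (intro tendsto_intros) (auto simp: eventually_at_filter)
  then have "\<forall>\<^sub>F \<eta> in at_right 0. 0 < \<theta> * (1/2 - C2 * \<eta>) - 1/4 - 4 * C4 * C1 * \<eta> powr \<nu>"
    by (rule order_tendstoD) (use \<theta> in auto)
  moreover have "((\<lambda>\<eta>. \<theta> - (1/2 + C2 * \<eta>)) \<longlongrightarrow> \<theta> - (1/2 + C2 * 0)) (at_right 0)"
    by (intro tendsto_intros)
  then have "\<forall>\<^sub>F \<eta> in at_right 0. 0 < \<theta> - (1/2 + C2 * \<eta>)"
    by (rule order_tendstoD) (use \<theta> in auto)
  moreover have "((\<lambda>\<eta>. \<delta> - q * \<eta>) \<longlongrightarrow> \<delta> - q * 0) (at_right 0)"
    by (intro tendsto_intros)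
  then have "\<forall>\<^sub>F \<eta> in at_right 0. 0 < \<delta> - q * \<eta>"
    by (rule order_tendstoD) (use delta_pos in auto)
  moreover have "\<forall>\<^sub>F \<eta> in at_right (0::real). \<eta> < 1"
    by (rule eventually_at_right_real[THEN eventually_mono]) auto
  moreover have "\<forall>\<^sub>F \<eta> in at_right (0::real). 0 < \<eta>"
    by (simp add: eventually_at_filter)
  ultimately have "\<forall>\<^sub>F \<eta> in at_right 0. 0 < \<theta> * (1/2 - C2 * \<eta>) - 1/4 - 4 * C4 * C1 * \<eta> powr \<nu> \<and>
      0 < \<theta> - (1/2 + C2 * \<eta>) \<and> 0 < \<delta> - q * \<eta> \<and> \<eta> < 1 \<and> 0 < \<eta>"
    by eventually_elim auto
  then obtain \<eta>0 where e0: "1/4 + 4 * C4 * C1 * \<eta>0 powr \<nu> < \<theta> * (1/2 - C2 * \<eta>0)"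
      "1/2 + C2 * \<eta>0 < \<theta>" "q * \<eta>0 < \<delta>" "\<eta>0 < 1" "0 < \<eta>0"
    using eventually_happens[of _ "at_right (0::real)"] by (auto simp: algebra_simps)
  have e0': "1/2 - C2 * \<eta>0 > 0"
  proof (rule ccontr)
    assume "\<not> ?thesis"
    then have "\<theta> * (1/2 - C2 * \<eta>0) \<le> 0" using \<theta> by (intro mult_nonneg_nonpos) auto
    moreover have "0 \<le> 4 * C4 * C1 * \<eta>0 powr \<nu>" using C4(1) C1 by simp
    ultimately show False using e0(1) by linarith
  qed
  have core: "(\<forall>i. 2 * b \<le> i \<and> i \<le> 2 * b + 2 * int m + 1 \<longrightarrow> norm (R l i) \<le> C1 * \<eta> powr (1 + \<nu>) * norm (step l b)) \<and>
      (\<forall>b'. b' div 2 = b \<longrightarrow> X (Suc l) (b' + 1) \<noteq> X (Suc l) b' \<and> norm (step (Suc l) b') \<le> \<theta> * norm (step l b) \<and>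
         flat (X (Suc l)) b' (\<theta> * \<eta> * norm (step (Suc l) b')))"
    if b: "0 \<le> b" "b < 2 ^ l * L" "X l (b + 1) \<noteq> X l b" and \<eta>: "0 \<le> \<eta>" "\<eta> \<le> \<eta>0"
      and fl: "flat (X l) b (\<eta> * norm (step l b))" for l b \<eta>
  proof -
    define v where "v = step l b"
    define \<rho> where "\<rho> = q * (\<eta> * norm v)"
    have v: "0 < norm v" using b(3) by (simp add: v_def)
    have \<eta>\<nu>: "\<eta> powr \<nu> \<le> \<eta>0 powr \<nu>" "\<eta> powr \<nu> \<le> 1"
      using \<eta> nu_pos e0(4) by (auto intro!: powr_mono2 powr_le1)
    have dev: "norm (X l (b + int j) - X l b - real j *\<^sub>R v) \<le> \<rho>" if "j \<le> 2 * m" for j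
    proof -
      have "norm (X l (b + int j) - X l b - real j *\<^sub>R v) \<le> (real j)\<^sup>2 * (\<eta> * norm v)"
        unfolding v_def
        by (rule norm_sub_line_le[of "2 * m"]) (use flatD[OF fl] \<eta> that in auto)
      also have "\<dots> \<le> \<rho>"
        unfolding \<rho>_def q_def using that \<eta> by (intro mult_right_mono power_mono) auto
      finally show ?thesis .
    qed
    have "q * \<eta> \<le> \<delta>"
      using mult_left_mono[OF \<eta>(2), of q] e0(3) q by linarith
    then have "\<rho> \<le> \<delta> * norm v"
      using mult_right_mono[of "q * \<eta>" \<delta> "norm v"] by (simp add: \<rho>_def mult.assoc)
    then have "norm (R l i) \<le> C * \<rho> * (\<rho> / norm v) powr \<nu>" if "2 * b \<le> i" "i \<le> 2 * b + 2 * int m + 1" for i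
      unfolding R_def v_def using dev that b by (intro close) (auto simp: v_def)
    also have "C * \<rho> * (\<rho> / norm v) powr \<nu> = C1 * (\<eta> * \<eta> powr \<nu>) * norm v"
      using v q \<eta> by (simp add: \<rho>_def C1_def powr_mult)
    finally have Rle: "norm (R l i) \<le> C1 * (\<eta> * \<eta> powr \<nu>) * norm v"
      if "2 * b \<le> i" "i \<le> 2 * b + 2 * int m + 1" for i
      using that by blast
    have Rle': "norm (R l i) \<le> C1 * \<eta> * norm v" if "2 * b \<le> i" "i \<le> 2 * b + 2 * int m + 1" for i
    proof -
      have "C1 * (\<eta> * \<eta> powr \<nu>) * norm v \<le> C1 * (\<eta> * 1) * norm v"
        using C1 \<eta> \<eta>\<nu> by (intro mult_right_mono mult_left_mono) auto
      then show ?thesis using Rle[OF that] by simp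
    qed
    have part2: "X (Suc l) (b' + 1) \<noteq> X (Suc l) b' \<and> norm (step (Suc l) b') \<le> \<theta> * norm v \<and>
         flat (X (Suc l)) b' (\<theta> * \<eta> * norm (step (Suc l) b'))" if b': "b' div 2 = b" for b'
    proof -
      have bb: "2 * b \<le> b'" "b' \<le> 2 * b + 1" using b' by auto
      \<comment> \<open>The line through the first two points is split off. \<open>S\<close> maps it
        to a line with half the step, and what remains is at most \<open>\<rho>\<close> on the
        window.\<close>
      define x where "x = X l b - of_int b *\<^sub>R v"
      define r where "r i = X l i - (x + of_int i *\<^sub>R v)" for i
      have Xl: "X l = (\<lambda>i. r i + (x + of_int i *\<^sub>R v))" by (simp add: r_def fun_eq_iff)
      have Sr: "norm (S r i) \<le> W * \<rho>" if i: "2 * b \<le> i" "i \<le> 2 * b + 2" for i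
        unfolding W_def
      proof (rule norm_subdiv_le)
        fix j assume "j \<le> m"
        define j' where "j' = nat (i div 2 - b) + j"
        have "i div 2 + int j = b + int j'" "j' \<le> 2 * m"
          using i \<open>j \<le> m\<close> m_pos by (auto simp: j'_def)
        then show "norm (r (i div 2 + int j)) \<le> \<rho>"
          using dev[of j'] by (simp add: r_def x_def algebra_simps)
      qed
      have "S (X l) i = S r i + S (\<lambda>i. x + of_int i *\<^sub>R v) i" for i
        unfolding Xl using subdiv_pow_add[of 1 m c r] by simp
      then have "X (Suc l) i = S r i + ((x + (\<tau> / 2) *\<^sub>R v) + of_int i *\<^sub>R ((1/2) *\<^sub>R v)) + R l i" for i
        unfolding R_def subdiv_line by simp
      then have "step (Suc l) b' - (1/2) *\<^sub>R v = (S r (b' + 1) - S r b') + (R l (b' + 1) - R l b')"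
        by (simp add: algebra_simps add_divide_distrib)
      also have "norm \<dots> \<le> (W * \<rho> + W * \<rho>) + (C1 * \<eta> * norm v + C1 * \<eta> * norm v)"
        using bb m_pos norm_triangle_mono[OF
            order_trans[OF norm_triangle_ineq4 add_mono[OF Sr[of "b' + 1"] Sr[of b']]]
            order_trans[OF norm_triangle_ineq4 add_mono[OF Rle'[of "b' + 1"] Rle'[of b']]]]
        by linarith
      also have "\<dots> = C2 * \<eta> * norm v"
        by (simp add: C2_def \<rho>_def algebra_simps)
      also have "\<dots> \<le> C2 * \<eta>0 * norm v"
        using C2 \<eta> by (intro mult_right_mono mult_left_mono) auto
      finally have d: "norm (step (Suc l) b' - (1/2) *\<^sub>R v) \<le> C2 * \<eta>0 * norm v" .
      have lo: "(1/2 - C2 * \<eta>0) * norm v \<le> norm (step (Suc l) b')"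
        using d norm_triangle_sub[of "(1/2) *\<^sub>R v" "step (Suc l) b'"]
        by (simp add: norm_minus_commute algebra_simps)
      have "norm (step (Suc l) b') \<le> (1/2 + C2 * \<eta>0) * norm v"
        using d norm_triangle_sub[of "step (Suc l) b'" "(1/2) *\<^sub>R v"] by (simp add: algebra_simps)
      also have "\<dots> \<le> \<theta> * norm v" using e0(2) by (intro mult_right_mono) auto
      finally have hi: "norm (step (Suc l) b') \<le> \<theta> * norm v" .
      have "0 < (1/2 - C2 * \<eta>0) * norm v" using e0' v by simp
      then have ne: "X (Suc l) (b' + 1) \<noteq> X (Suc l) b'" using lo by auto
      have "flat (S (X l)) b' (\<eta> * norm v / 4)"
        using flat_subdiv[OF fl b'] by (simp add: v_def)
      \<comment> \<open>Nothing but the size of the remainder is known. Its second differences are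
        at most 4 times as large, and \<open>flat_if_diff2\<close> takes them into the
        seminorm.\<close>
      moreover have "flat (R l) b' (C4 * (4 * (C1 * (\<eta> * \<eta> powr \<nu>) * norm v)))"
      proof (rule C4(2), rule norm_diff2_le)
        fix j assume "0 \<le> j" "j \<le> 2 * int m"
        then show "norm (R l (b' + j)) \<le> C1 * (\<eta> * \<eta> powr \<nu>) * norm v"
          using bb by (intro Rle) auto
      qed auto
      ultimately have "flat (\<lambda>i. S (X l) i + R l i) b' (\<eta> * norm v / 4 + C4 * (4 * (C1 * (\<eta> * \<eta> powr \<nu>) * norm v)))"
        by (rule flat_add)
      moreover have "(\<lambda>i. S (X l) i + R l i) = X (Suc l)" by (simp add: R_def fun_eq_iff)
      moreover have "\<eta> * norm v / 4 + C4 * (4 * (C1 * (\<eta> * \<eta> powr \<nu>) * norm v)) =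
          (1/4 + 4 * C4 * C1 * \<eta> powr \<nu>) * (\<eta> * norm v)"
        by (simp add: algebra_simps)
      ultimately have fl': "flat (X (Suc l)) b' ((1/4 + 4 * C4 * C1 * \<eta> powr \<nu>) * (\<eta> * norm v))" by simp
      \<comment> \<open>The new seminorm has to be measured against the new step, for which
        \<open>lo\<close> is the lower bound.\<close>
      have "(1/4 + 4 * C4 * C1 * \<eta> powr \<nu>) * (\<eta> * norm v) \<le> \<theta> * (1/2 - C2 * \<eta>0) * (\<eta> * norm v)"
      proof (rule mult_right_mono)
        have "4 * C4 * C1 * \<eta> powr \<nu> \<le> 4 * C4 * C1 * \<eta>0 powr \<nu>"
          using C4(1) C1 \<eta>\<nu> by (intro mult_left_mono) auto
        then show "1/4 + 4 * C4 * C1 * \<eta> powr \<nu> \<le> \<theta> * (1/2 - C2 * \<eta>0)" using e0(1) by linarith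
      qed (use \<eta> in auto)
      also have "\<dots> = \<theta> * \<eta> * ((1/2 - C2 * \<eta>0) * norm v)" by simp
      also have "\<dots> \<le> \<theta> * \<eta> * norm (step (Suc l) b')"
        using lo \<theta> \<eta> by (intro mult_left_mono) auto
      finally show ?thesis using flat_mono[OF fl'] ne hi by blast
    qed
    show ?thesis
      using Rle part2 powr_mult_base[OF \<eta>(1), of \<nu>] by (auto simp: v_def)
  qed
  show thesis
    by (rule that[OF e0(5) less_imp_le[OF e0(4)] C1]) (use core in blast)+
qed

text \<open>From the level \<open>l0\<close> on, \<open>one_step\<close> can be repeated: relative
  seminorm and step both decay like \<open>\<theta> ^ p\<close>, and the remainder like the power
  \<open>1 + \<nu>\<close> of the first times the second. The range of \<open>i\<close> comprises
  all points of the chain at the next level.\<close>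

lemma decay:
  assumes \<theta>: "1/2 < \<theta>" "\<theta> < 1"
  obtains l0 D where "0 \<le> D"
    "\<And>p i. 0 \<le> i \<Longrightarrow> i < 2 ^ Suc (l0 + p) * L + 2 * int m \<Longrightarrow>
      norm (R (l0 + p) i) \<le> D * (\<theta> powr (2 + \<nu>)) ^ p"
    "\<And>p b j. 0 \<le> b \<Longrightarrow> b < 2 ^ (l0 + p) * L \<Longrightarrow> j \<le> 2 * m \<Longrightarrow>
      norm (X (l0 + p) (b + int j) - X (l0 + p) b) \<le> D * \<theta> ^ p"
proof -
  obtain C4 where C4: "0 \<le> C4" "\<And>(f :: int \<Rightarrow> 'a) b M.
    (\<And>j. 0 \<le> j \<Longrightarrow> j \<le> 2 * int m - 2 \<Longrightarrow> norm (diff2 f (b + j)) \<le> M) \<Longrightarrow> flat f b (C4 * M)"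
    using flat_if_diff2 by blast
  obtain \<eta>0 C1 where os: "0 < \<eta>0" "\<eta>0 \<le> 1" "0 \<le> C1"
    "\<And>l b \<eta> i. \<lbrakk>0 \<le> b; b < 2 ^ l * L; X l (b + 1) \<noteq> X l b; 0 \<le> \<eta>; \<eta> \<le> \<eta>0; flat (X l) b (\<eta> * norm (step l b));
       2 * b \<le> i; i \<le> 2 * b + 2 * int m + 1\<rbrakk>
      \<Longrightarrow> norm (R l i) \<le> C1 * \<eta> powr (1 + \<nu>) * norm (step l b)"
    "\<And>l b \<eta> b'. \<lbrakk>0 \<le> b; b < 2 ^ l * L; X l (b + 1) \<noteq> X l b; 0 \<le> \<eta>; \<eta> \<le> \<eta>0; flat (X l) b (\<eta> * norm (step l b));
       b' div 2 = b\<rbrakk>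
      \<Longrightarrow> X (Suc l) (b' + 1) \<noteq> X (Suc l) b' \<and> norm (step (Suc l) b') \<le> \<theta> * norm (step l b) \<and>
         flat (X (Suc l)) b' (\<theta> * \<eta> * norm (step (Suc l) b'))"
    using one_step[OF \<theta>(1)] by blast
  \<comment> \<open>The passage from second differences of \<open>X\<close> to the seminorm costs
    the factor \<open>C4\<close>, but only at the start level.\<close>
  have "0 < \<eta>0 / (C4 + 1)" using os(1) C4(1) by simp
  from straight[OF this] obtain l0 where l0: "\<And>b. 0 \<le> b \<Longrightarrow> b < 2 ^ l0 * L \<Longrightarrow> X l0 (b + 1) \<noteq> X l0 b"
    "\<And>b j. 0 \<le> b \<Longrightarrow> b < 2 ^ l0 * L \<Longrightarrow> 0 \<le> j \<Longrightarrow> j \<le> 2 * int m - 2 \<Longrightarrow>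
      norm (diff2 (X l0) (b + j)) \<le> \<eta>0 / (C4 + 1) * norm (step l0 b)"
    by blast
  \<comment> \<open>The sum dominates each of the finitely many steps at level
    \<open>l0\<close>.\<close>
  define \<sigma> where "\<sigma> = (\<Sum>b\<in>{0..<2 ^ l0 * L}. norm (step l0 b))"
  have \<sigma>: "0 \<le> \<sigma>" unfolding \<sigma>_def by (rule sum_nonneg) simp
  have inv: "X (l0 + p) (b + 1) \<noteq> X (l0 + p) b \<and> norm (step (l0 + p) b) \<le> \<sigma> * \<theta> ^ p \<and>
      flat (X (l0 + p)) b (\<eta>0 * \<theta> ^ p * norm (step (l0 + p) b))"
    if "0 \<le> b" "b < 2 ^ (l0 + p) * L" for p b
    using that
  proof (induction p arbitrary: b)
    case 0
    then have b: "0 \<le> b" "b < 2 ^ l0 * L" by auto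
    have "norm (step l0 b) \<le> \<sigma>"
      unfolding \<sigma>_def using b by (intro member_le_sum) auto
    moreover have "flat (X l0) b (C4 * (\<eta>0 / (C4 + 1) * norm (step l0 b)))"
      using l0(2)[OF b] by (rule C4(2))
    moreover have "C4 * (\<eta>0 / (C4 + 1) * norm (step l0 b)) \<le> \<eta>0 * norm (step l0 b)"
    proof -
      have "C4 * \<eta>0 / (C4 + 1) \<le> \<eta>0" using C4(1) os(1) by (simp add: field_simps)
      from mult_right_mono[OF this norm_ge_zero] show ?thesis by (simp add: mult.assoc)
    qed
    ultimately show ?case using l0(1)[OF b] flat_mono by auto
  next
    case (Suc p)
    define a where "a = b div 2"
    have a: "0 \<le> a" "a < 2 ^ (l0 + p) * L" "b div 2 = a"
      using Suc.prems unfolding a_def by (auto simp: div_less_iff_less_mult algebra_simps)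
    note IH = Suc.IH[OF a(1,2)]
    have \<eta>: "0 \<le> \<eta>0 * \<theta> ^ p" "\<eta>0 * \<theta> ^ p \<le> \<eta>0"
      using os(1) \<theta> by (auto simp: power_le_one)
    have n: "X (Suc (l0 + p)) (b + 1) \<noteq> X (Suc (l0 + p)) b \<and>
        norm (step (Suc (l0 + p)) b) \<le> \<theta> * norm (step (l0 + p) a) \<and>
        flat (X (Suc (l0 + p))) b (\<theta> * (\<eta>0 * \<theta> ^ p) * norm (step (Suc (l0 + p)) b))"
      using os(5)[OF a(1,2) _ \<eta> _ a(3)] IH by blast
    have "\<theta> * norm (step (l0 + p) a) \<le> \<theta> * (\<sigma> * \<theta> ^ p)"
      using IH \<theta> by (intro mult_left_mono) auto
    then have "norm (step (Suc (l0 + p)) b) \<le> \<sigma> * \<theta> ^ Suc p"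
      using n by (simp add: algebra_simps)
    moreover have "\<theta> * (\<eta>0 * \<theta> ^ p) = \<eta>0 * \<theta> ^ Suc p" by simp
    ultimately show ?case using n by (simp only: add_Suc_right simp_thms)
  qed
  have \<eta>: "0 \<le> \<eta>0 * \<theta> ^ p" "\<eta>0 * \<theta> ^ p \<le> \<eta>0" for p
    using os(1) \<theta> by (auto simp: power_le_one)
  define D1 where "D1 = C1 * \<eta>0 powr (1 + \<nu>) * \<sigma>"
  define D2 where "D2 = (real (2 * m) + (real (2 * m))\<^sup>2) * \<sigma>"
  have D: "0 \<le> D1" "0 \<le> D2" using os(3) \<sigma> by (auto simp: D1_def D2_def)
  have 1: "norm (R (l0 + p) i) \<le> D1 * (\<theta> powr (2 + \<nu>)) ^ p"
    if i: "0 \<le> i" "i < 2 ^ Suc (l0 + p) * L + 2 * int m" for p i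
  proof -
    \<comment> \<open>The last window starts at \<open>2 ^ (l0 + p) * L - 1\<close>. It is also
      responsible for the final \<open>2 * m\<close> points, whose index halves to a value beyond
      all windows.\<close>
    define b where "b = min (i div 2) (2 ^ (l0 + p) * L - 1)"
    have "1 \<le> 2 ^ (l0 + p) * L"
      using L_pos mult_mono[of 1 "2 ^ (l0 + p)" 1 L] by simp
    then have b: "0 \<le> b" "b < 2 ^ (l0 + p) * L" using i by (auto simp: b_def)
    have "2 * b \<le> i" "i \<le> 2 * b + 2 * int m + 1" using i by (auto simp: b_def min_def)
    then have "norm (R (l0 + p) i) \<le> C1 * (\<eta>0 * \<theta> ^ p) powr (1 + \<nu>) * norm (step (l0 + p) b)"
      using inv[OF b] \<eta> by (intro os(4) b) auto
    also have "\<dots> \<le> C1 * (\<eta>0 * \<theta> ^ p) powr (1 + \<nu>) * (\<sigma> * \<theta> ^ p)"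
      using inv[OF b] os(3) by (intro mult_left_mono) auto
    also have "\<dots> = D1 * (\<theta> ^ p * (\<theta> ^ p) powr (1 + \<nu>))"
      using os(1) \<theta> by (simp add: D1_def powr_mult)
    also have "\<theta> ^ p * (\<theta> ^ p) powr (1 + \<nu>) = (\<theta> ^ p) powr (2 + \<nu>)"
      using powr_mult_base[of "\<theta> ^ p" "1 + \<nu>"] \<theta> by simp
    also have "\<dots> = (\<theta> powr (2 + \<nu>)) ^ p"
      using \<theta> by (simp add: powr_powr mult.commute flip: powr_realpow)
    finally show ?thesis .
  qed
  have 2: "norm (X (l0 + p) (b + int j) - X (l0 + p) b) \<le> D2 * \<theta> ^ p"
    if b: "0 \<le> b" "b < 2 ^ (l0 + p) * L" and j: "j \<le> 2 * m" for p b j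
  proof -
    let ?M = "\<eta>0 * \<theta> ^ p * norm (step (l0 + p) b)"
    have M: "?M \<le> norm (step (l0 + p) b)" "0 \<le> ?M"
      using \<eta>[of p] os(2) by (auto intro!: mult_left_le_one_le)
    have s: "norm (step (l0 + p) b) \<le> \<sigma> * \<theta> ^ p" using inv[OF b] by blast
    have "norm (X (l0 + p) (b + int j) - X (l0 + p) b - real j *\<^sub>R step (l0 + p) b) \<le> (real j)\<^sup>2 * ?M"
      using norm_sub_line_le[of "2 * m" "X (l0 + p)" b ?M j] flatD[of "X (l0 + p)" b ?M] inv[OF b] j M(2)
      by simp
    also have "\<dots> \<le> (real (2 * m))\<^sup>2 * (\<sigma> * \<theta> ^ p)"
      using j order_trans[OF M(1) s] M(2) by (intro mult_mono[of "(real j)\<^sup>2"] power_mono) auto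
    finally have "norm (X (l0 + p) (b + int j) - X (l0 + p) b - real j *\<^sub>R step (l0 + p) b) \<le>
        (real (2 * m))\<^sup>2 * (\<sigma> * \<theta> ^ p)" .
    moreover have "norm (real j *\<^sub>R step (l0 + p) b) \<le> real (2 * m) * (\<sigma> * \<theta> ^ p)"
      unfolding norm_scaleR using j s by (intro mult_mono) auto
    ultimately have "norm ((X (l0 + p) (b + int j) - X (l0 + p) b - real j *\<^sub>R step (l0 + p) b)
        + real j *\<^sub>R step (l0 + p) b) \<le> (real (2 * m))\<^sup>2 * (\<sigma> * \<theta> ^ p) + real (2 * m) * (\<sigma> * \<theta> ^ p)"
      by (rule norm_triangle_mono)
    then show ?thesis by (simp add: D2_def algebra_simps)
  qed
  show thesis
  proof (rule that[of "max D1 D2" l0])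
    show "norm (R (l0 + p) i) \<le> max D1 D2 * (\<theta> powr (2 + \<nu>)) ^ p"
      if "0 \<le> i" "i < 2 ^ Suc (l0 + p) * L + 2 * int m" for p i
      using 1[OF that] by (rule order_trans) (auto intro!: mult_right_mono)
    show "norm (X (l0 + p) (b + int j) - X (l0 + p) b) \<le> max D1 D2 * \<theta> ^ p"
      if "0 \<le> b" "b < 2 ^ (l0 + p) * L" "j \<le> 2 * m" for p b j
      using 2[OF that] by (rule order_trans) (use \<theta> in \<open>auto intro!: mult_right_mono\<close>)
  qed (use D in auto)
qed

end

section \<open>The limit curve as a telescoping series\<close>

lemma has_vector_derivative_series:
  fixes f :: "nat \<Rightarrow> real \<Rightarrow> 'a::banach"
  assumes "\<And>n t. (f n has_vector_derivative f' n t) (at t)"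
    and "\<And>n t. norm (f n t) \<le> A n" "\<And>n t. norm (f' n t) \<le> A' n" "summable A" "summable A'"
  shows "((\<lambda>t. \<Sum>n. f n t) has_vector_derivative (\<Sum>n. f' n t)) (at t)"
proof -
  have sm: "summable (\<lambda>n. f n t)" for t
    by (rule summable_comparison_test'[OF assms(4) assms(2)])
  have ul: "uniform_limit UNIV (\<lambda>n t. \<Sum>i<n. f' i t) (\<lambda>t. \<Sum>i. f' i t) sequentially"
    by (rule Weierstrass_m_test) (use assms(3,5) in auto)
  have "\<exists>g. \<forall>x\<in>UNIV. (\<lambda>n. f n x) sums g x \<and> (g has_derivative (\<lambda>h. h *\<^sub>R (\<Sum>n. f' n x))) (at x within UNIV)"
  proof (rule has_derivative_series[where f' = "\<lambda>n x h. h *\<^sub>R f' n x" and x = t and l = "\<Sum>n. f n t"])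
    show "(f n has_derivative (\<lambda>h. h *\<^sub>R f' n x)) (at x within UNIV)" for n x
      using assms(1)[of n x] by (simp add: has_vector_derivative_def)
    show "\<forall>\<^sub>F n in sequentially. \<forall>x\<in>UNIV. \<forall>h. norm ((\<Sum>i<n. h *\<^sub>R f' i x) - h *\<^sub>R (\<Sum>n. f' n x)) \<le> e * norm h"
      if "0 < e" for e
      using uniform_limitD[OF ul that]
    proof eventually_elim
      case (elim n)
      show ?case
      proof (intro ballI allI)
        fix x h :: real
        have "norm ((\<Sum>i<n. h *\<^sub>R f' i x) - h *\<^sub>R (\<Sum>n. f' n x)) = \<bar>h\<bar> * norm ((\<Sum>i<n. f' i x) - (\<Sum>n. f' n x))"
          by (simp flip: scaleR_sum_right scaleR_diff_right)
        also have "\<dots> \<le> \<bar>h\<bar> * e"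
          using elim by (intro mult_left_mono) (auto simp: dist_norm intro: less_imp_le)
        finally show "norm ((\<Sum>i<n. h *\<^sub>R f' i x) - h *\<^sub>R (\<Sum>n. f' n x)) \<le> e * norm h"
          by (simp add: mult.commute)
      qed
    qed
  qed (use summable_sums[OF sm] in auto)
  then obtain g where g: "\<And>x. (\<lambda>n. f n x) sums g x" "(g has_derivative (\<lambda>h. h *\<^sub>R (\<Sum>n. f' n t))) (at t)"
    by auto
  then have "g = (\<lambda>x. \<Sum>n. f n x)" by (auto simp: sums_iff)
  with g(2) show ?thesis by (simp add: has_vector_derivative_def)
qed

context refinable
begin

text \<open>Unlike in \<open>curve\<close>, the index set does not move with \<open>t\<close>, so
  differentiation is term by term, and \<open>\<psi>\<close> may be any derivative of
  \<open>\<phi>\<close>.\<close>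

definition bump_sum :: "(real \<Rightarrow> real) \<Rightarrow> int set \<Rightarrow> (int \<Rightarrow> 'a::real_normed_vector) \<Rightarrow> real \<Rightarrow> 'a" where
  "bump_sum \<psi> J f t = (\<Sum>j\<in>J. \<psi> (t - of_int j) *\<^sub>R f j)"

text \<open>A closed interval of length \<open>2 * m + 1\<close> contains at most
  \<open>2 * m + 2\<close> integers. This keeps the bound independent of the size of
  \<open>J\<close>, which grows with the level.\<close>

lemma bump_sum_le:
  fixes f :: "int \<Rightarrow> 'a::real_normed_vector"
  assumes "finite J" "\<And>j. j \<in> J \<Longrightarrow> norm (f j) \<le> \<rho>" "0 \<le> \<rho>"
    and "\<And>j. j \<in> J \<Longrightarrow> \<bar>w j\<bar> \<le> B" "\<And>j. w j \<noteq> 0 \<Longrightarrow> - 2 * real m \<le> t - of_int j \<and> t - of_int j \<le> 1" "0 \<le> B"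
  shows "norm (\<Sum>j\<in>J. w j *\<^sub>R f j) \<le> real (2 * m + 2) * B * \<rho>"
proof -
  let ?I = "{\<lfloor>t\<rfloor> - 1..\<lfloor>t\<rfloor> + 2 * int m}"
  have "(\<Sum>j\<in>J. w j *\<^sub>R f j) = (\<Sum>j\<in>J \<inter> ?I. w j *\<^sub>R f j)"
  proof (rule sum.mono_neutral_right)
    show "\<forall>i\<in>J - J \<inter> ?I. w i *\<^sub>R f i = 0"
    proof
      fix i assume i: "i \<in> J - J \<inter> ?I"
      have "w i = 0"
      proof (rule ccontr)
        assume "w i \<noteq> 0"
        from assms(5)[OF this] have "i \<in> ?I" by (simp add: le_floor_iff floor_le_iff) linarith
        then show False using i by blast
      qed
      then show "w i *\<^sub>R f i = 0" by simp
    qed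
  qed (use assms in auto)
  also have "norm \<dots> \<le> (\<Sum>j\<in>J \<inter> ?I. B * \<rho>)"
  proof (rule sum_norm_le)
    fix j assume "j \<in> J \<inter> ?I"
    then show "norm (w j *\<^sub>R f j) \<le> B * \<rho>"
      unfolding norm_scaleR using assms by (intro mult_mono) auto
  qed
  also have "\<dots> = real (card (J \<inter> ?I)) * (B * \<rho>)" by simp
  also have "\<dots> \<le> real (2 * m + 2) * (B * \<rho>)"
  proof (rule mult_right_mono)
    have "card (J \<inter> ?I) \<le> card ?I" by (rule card_mono) auto
    then show "real (card (J \<inter> ?I)) \<le> real (2 * m + 2)" by (simp add: nat_le_iff)
  qed (use assms in auto)
  finally show ?thesis by (simp add: mult.assoc)
qed

lemma bump_sum_deriv:
  fixes f :: "int \<Rightarrow> 'a::real_normed_vector"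
  assumes "\<And>t. (\<psi> has_field_derivative \<psi>' t) (at t)"
  shows "((\<lambda>t. bump_sum \<psi> J f (a * t)) has_vector_derivative a *\<^sub>R bump_sum \<psi>' J f (a * t)) (at t)"
proof -
  have "((\<lambda>t. \<psi> (a * t - of_int j)) has_field_derivative \<psi>' (a * t - of_int j) * a) (at t)" for j
    by (rule DERIV_chain2[OF assms]) (auto intro!: derivative_eq_intros)
  then have "((\<lambda>t. \<psi> (a * t - of_int j) *\<^sub>R f j) has_vector_derivative (\<psi>' (a * t - of_int j) * a) *\<^sub>R f j) (at t)" for j
    by (intro has_vector_derivative_scaleR[where g = "\<lambda>_. f j" and g' = 0, simplified])
  then have "((\<lambda>t. \<Sum>j\<in>J. \<psi> (a * t - of_int j) *\<^sub>R f j) has_vector_derivative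
      (\<Sum>j\<in>J. (\<psi>' (a * t - of_int j) * a) *\<^sub>R f j)) (at t)"
    by (intro has_vector_derivative_sum)
  then show ?thesis by (simp add: bump_sum_def scaleR_sum_right mult.commute)
qed

text \<open>A difference of two weights is nonzero only if one of them is. The indices split into
  those active at \<open>s\<close> and the remaining ones, active at \<open>t\<close>; each group
  has at most \<open>2 * m + 2\<close> members.\<close>

lemma bump_sum_hoelder:
  fixes f :: "int \<Rightarrow> 'a::real_normed_vector"
  assumes J: "finite J" "\<And>j. j \<in> J \<Longrightarrow> norm (f j) \<le> \<rho>" "0 \<le> \<rho>" and a: "0 \<le> a"
  shows "norm (bump_sum \<phi>'' J f (a * s) - bump_sum \<phi>'' J f (a * t)) \<le>
    real (4 * m + 4) * K * \<rho> * (a powr \<beta> * \<bar>s - t\<bar> powr \<beta>)"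
proof -
  define d where "d j = \<phi>'' (a * s - of_int j) - \<phi>'' (a * t - of_int j)" for j
  define B where "B = K * (a powr \<beta> * \<bar>s - t\<bar> powr \<beta>)"
  have B: "0 \<le> B" using K_nonneg by (simp add: B_def)
  have d: "\<bar>d j\<bar> \<le> B" for j
    using hoelder[of "a * s - of_int j" "a * t - of_int j"] a
    by (simp add: d_def B_def abs_mult powr_mult flip: right_diff_distrib)
  have d_ne: "\<phi>'' (a * t - of_int j) \<noteq> 0" if "d j \<noteq> 0" "\<phi>'' (a * s - of_int j) = 0" for j
    using that by (simp add: d_def)
  define w1 w2 where "w1 j = (if \<phi>'' (a * s - of_int j) = 0 then 0 else d j)"
    and "w2 j = (if \<phi>'' (a * s - of_int j) = 0 then d j else 0)" for j
  have "norm (\<Sum>j\<in>J. w1 j *\<^sub>R f j) \<le> real (2 * m + 2) * B * \<rho>"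
    by (rule bump_sum_le[OF J, where t = "a * s"])
      (use d B supp'' in \<open>auto simp: w1_def split: if_splits\<close>)
  moreover have "norm (\<Sum>j\<in>J. w2 j *\<^sub>R f j) \<le> real (2 * m + 2) * B * \<rho>"
    by (rule bump_sum_le[OF J, where t = "a * t"])
      (use d B d_ne supp''[of "a * t - of_int _"] in \<open>fastforce simp: w2_def split: if_splits\<close>)+
  ultimately have "norm ((\<Sum>j\<in>J. w1 j *\<^sub>R f j) + (\<Sum>j\<in>J. w2 j *\<^sub>R f j)) \<le>
      real (2 * m + 2) * B * \<rho> + real (2 * m + 2) * B * \<rho>"
    by (rule norm_triangle_mono)
  moreover have "bump_sum \<phi>'' J f (a * s) - bump_sum \<phi>'' J f (a * t) = (\<Sum>j\<in>J. w1 j *\<^sub>R f j) + (\<Sum>j\<in>J. w2 j *\<^sub>R f j)"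
    unfolding bump_sum_def sum_subtractf[symmetric] sum.distrib[symmetric]
    by (rule sum.cong) (auto simp: w1_def w2_def d_def scaleR_left_diff_distrib)
  ultimately show ?thesis by (simp add: B_def algebra_simps)
qed

end

context perturbed
begin

definition level_indices :: "nat \<Rightarrow> int set" where
  "level_indices l = {0..<2 ^ l * L + 2 * int m}"

text \<open>For a parameter inside \<open>{0<..<L}\<close> the support of \<open>\<phi>\<close>
  meets only positions that exist in the chain at level \<open>l\<close>, so the fixed index set
  already gives the whole \<open>curve\<close>.\<close>

lemma level_curve:
  assumes "0 < t" "t < of_int L"
  shows "bump_sum \<phi> (level_indices l) f (2 ^ l * t) = curve f (2 ^ l * t)"
  unfolding bump_sum_def
proof (rule sum_eq_curve)
  fix j assume j: "2 ^ l * t - 1 < of_int j" "of_int j < 2 ^ l * t + 2 * real m"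
  have "0 < 2 ^ l * t" "2 ^ l * t < 2 ^ l * of_int L" using assms by auto
  moreover have "real_of_int (2 ^ l * L + 2 * int m) = 2 ^ l * of_int L + 2 * real m" by simp
  ultimately have "real_of_int (- 1) < of_int j" "real_of_int j < of_int (2 ^ l * L + 2 * int m)"
    using j by linarith+
  then show "j \<in> level_indices l" unfolding of_int_less_iff by (simp add: level_indices_def)
qed (simp add: level_indices_def)

text \<open>The series starts at the level \<open>l0\<close> from which \<open>decay\<close> holds.
  Its terms and their first two derivatives are bounded geometrically with ratios
  \<open>\<mu>\<close>, \<open>2 * \<mu>\<close> and \<open>4 * \<mu>\<close>, the Hoelder quotients
  with ratio \<open>2 powr (2 + \<beta>) * \<mu>\<close>.\<close>

lemma ex_limit:
  assumes "\<beta> < \<nu>"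
  obtains \<Phi> \<Phi>' \<Phi>'' :: "real \<Rightarrow> 'a" and H where
    "\<And>t. (\<Phi> has_vector_derivative \<Phi>' t) (at t)"
    "\<And>t. (\<Phi>' has_vector_derivative \<Phi>'' t) (at t)"
    "\<And>s t. norm (\<Phi>'' s - \<Phi>'' t) \<le> H * \<bar>s - t\<bar> powr \<beta>"
    "\<And>\<epsilon>. 0 < \<epsilon> \<Longrightarrow> \<forall>\<^sub>F l in sequentially. \<forall>i. 0 < i \<and> i < 2 ^ l * L \<longrightarrow>
       norm (\<Phi> (of_int i / 2 ^ l) - X l i) \<le> \<epsilon>"
proof -
  \<comment> \<open>Chosen to make \<open>\<theta> powr (2 + \<nu>)\<close> equal to
    \<open>2 powr (- (2 + (\<beta> + \<nu>) / 2))\<close>, with an exponent halfway between the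
    required \<open>2 + \<beta>\<close> and the limiting \<open>2 + \<nu>\<close>. From
    \<open>\<beta> < \<nu>\<close> follows \<open>\<gamma> < 1\<close>, that is
    \<open>1/2 < \<theta>\<close>.\<close>
  define \<gamma> where "\<gamma> = (2 + (\<beta> + \<nu>) / 2) / (2 + \<nu>)"
  define \<theta> :: real where "\<theta> = 2 powr (- \<gamma>)"
  have \<gamma>: "0 < \<gamma>" "\<gamma> < 1" using assms nu_pos beta_pos by (auto simp: \<gamma>_def field_simps)
  have \<theta>: "1/2 < \<theta>" "\<theta> < 1"
  proof -
    have "(2::real) powr (- 1) < 2 powr (- \<gamma>)" using \<gamma> by (intro powr_less_mono) auto
    then show "1/2 < \<theta>" by (simp add: \<theta>_def powr_minus_divide)
    have "(2::real) powr (- \<gamma>) < 2 powr 0" using \<gamma> by (intro powr_less_mono) auto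
    then show "\<theta> < 1" by (simp add: \<theta>_def)
  qed
  obtain l0 D where D: "0 \<le> D"
    "\<And>p i. 0 \<le> i \<Longrightarrow> i < 2 ^ Suc (l0 + p) * L + 2 * int m \<Longrightarrow>
      norm (R (l0 + p) i) \<le> D * (\<theta> powr (2 + \<nu>)) ^ p"
    "\<And>p b j. 0 \<le> b \<Longrightarrow> b < 2 ^ (l0 + p) * L \<Longrightarrow> j \<le> 2 * m \<Longrightarrow>
      norm (X (l0 + p) (b + int j) - X (l0 + p) b) \<le> D * \<theta> ^ p"
    by (rule decay[OF \<theta>]) (rule that, blast+)
  define \<mu> where "\<mu> = \<theta> powr (2 + \<nu>)"
  have \<mu>: "\<mu> = 2 powr (- (2 + (\<beta> + \<nu>) / 2))"
    using nu_pos by (simp add: \<mu>_def \<theta>_def \<gamma>_def powr_powr)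
  have \<mu>0: "0 < \<mu>" by (simp add: \<mu>)
  have \<mu>\<beta>: "2 powr (2 + \<beta>) * \<mu> < 1"
  proof -
    have "2 powr (2 + \<beta>) * \<mu> = 2 powr ((\<beta> - \<nu>) / 2)"
      unfolding \<mu> powr_add[symmetric] by (simp add: field_simps)
    also have "\<dots> < 2 powr 0" using assms by (intro powr_less_mono) auto
    finally show ?thesis by simp
  qed
  have \<mu>4: "4 * \<mu> < 1"
  proof -
    have "(2::real) powr 2 \<le> 2 powr (2 + \<beta>)" using beta_pos by (intro powr_mono) auto
    then have "4 * \<mu> \<le> 2 powr (2 + \<beta>) * \<mu>" using \<mu>0 by (intro mult_right_mono) auto
    then show ?thesis using \<mu>\<beta> by linarith
  qed
  obtain B0 where B0: "0 < B0" "\<And>t. \<bar>\<phi> t\<bar> \<le> B0"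
    using ex_bound_if_supp[OF isCont_phi] supp less_imp_le by metis
  obtain B1 where B1: "0 < B1" "\<And>t. \<bar>\<phi>' t\<bar> \<le> B1"
    using ex_bound_if_supp[OF isCont_phi' supp'] by blast
  obtain B2 where B2: "0 < B2" "\<And>t. \<bar>\<phi>'' t\<bar> \<le> B2"
    using ex_bound_if_supp[OF isCont_phi'' supp''] by blast
  \<comment> \<open>The remainder \<open>R (l0 + p)\<close> consists of points of level
    \<open>l0 + p + 1\<close>, hence this dilation.\<close>
  define a :: "nat \<Rightarrow> real" where "a p = 2 ^ Suc (l0 + p)" for p
  define J where "J p = level_indices (Suc (l0 + p))" for p
  have J: "finite (J p)" "\<And>j. j \<in> J p \<Longrightarrow> norm (R (l0 + p) j) \<le> D * \<mu> ^ p" "0 \<le> D * \<mu> ^ p" for p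
    using D(1,2) \<mu>0 by (auto simp: J_def level_indices_def \<mu>_def)
  have a: "0 < a p" "a p = 2 ^ Suc l0 * 2 ^ p" for p by (auto simp: a_def power_add)
  define f f' f'' where "f p t = bump_sum \<phi> (J p) (R (l0 + p)) (a p * t)"
    and "f' p t = a p *\<^sub>R bump_sum \<phi>' (J p) (R (l0 + p)) (a p * t)"
    and "f'' p t = a p *\<^sub>R a p *\<^sub>R bump_sum \<phi>'' (J p) (R (l0 + p)) (a p * t)" for p t
  define M where "M = real (2 * m + 2) * D"
  have M: "0 \<le> M" using D(1) by (simp add: M_def)
  have fd: "(f p has_vector_derivative f' p t) (at t)" for p t
    unfolding f_def f'_def by (rule bump_sum_deriv[OF deriv])
  have fd': "(f' p has_vector_derivative f'' p t) (at t)" for p t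
    unfolding f'_def f''_def
    by (rule bounded_linear.has_vector_derivative[OF bounded_linear_scaleR_right bump_sum_deriv[OF deriv']])
  define b where "b p = M * B0 * \<mu> ^ p" for p
  define b' where "b' p = 2 ^ Suc l0 * (M * B1) * (2 * \<mu>) ^ p" for p
  define b'' where "b'' p = (2 ^ Suc l0)\<^sup>2 * (M * B2) * (4 * \<mu>) ^ p" for p
  have fb: "norm (f p t) \<le> b p" for p t
  proof -
    have "norm (f p t) \<le> real (2 * m + 2) * B0 * (D * \<mu> ^ p)"
      unfolding f_def bump_sum_def
      by (rule bump_sum_le[OF J(1), where t = "a p * t"])
        (use J B0 supp[of "a p * t - of_int _"] in \<open>auto intro: less_imp_le\<close>)
    then show ?thesis by (simp add: b_def M_def mult_ac)
  qed
  have fb': "norm (f' p t) \<le> b' p" for p t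
  proof -
    have "norm (bump_sum \<phi>' (J p) (R (l0 + p)) (a p * t)) \<le> M * B1 * \<mu> ^ p"
    proof -
      have "norm (bump_sum \<phi>' (J p) (R (l0 + p)) (a p * t)) \<le> real (2 * m + 2) * B1 * (D * \<mu> ^ p)"
        unfolding bump_sum_def
        by (rule bump_sum_le[OF J(1), where t = "a p * t"])
          (use J B1 supp'[of "a p * t - of_int _"] in auto)
      then show ?thesis by (simp add: M_def mult_ac)
    qed
    from mult_left_mono[OF this less_imp_le[OF a(1)[of p]]] show ?thesis
      using a(1)[of p] by (simp add: f'_def b'_def a(2) power_mult_distrib mult_ac)
  qed
  have fb'': "norm (f'' p t) \<le> b'' p" for p t
  proof -
    have "norm (bump_sum \<phi>'' (J p) (R (l0 + p)) (a p * t)) \<le> M * B2 * \<mu> ^ p"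
    proof -
      have "norm (bump_sum \<phi>'' (J p) (R (l0 + p)) (a p * t)) \<le> real (2 * m + 2) * B2 * (D * \<mu> ^ p)"
        unfolding bump_sum_def
        by (rule bump_sum_le[OF J(1), where t = "a p * t"])
          (use J B2 supp''[of "a p * t - of_int _"] in auto)
      then show ?thesis by (simp add: M_def mult_ac)
    qed
    then have "(a p)\<^sup>2 * norm (bump_sum \<phi>'' (J p) (R (l0 + p)) (a p * t)) \<le> (a p)\<^sup>2 * (M * B2 * \<mu> ^ p)"
      by (rule mult_left_mono) simp
    moreover have "(2 ^ p)\<^sup>2 = (4::real) ^ p"
      by (simp add: power2_eq_square flip: power_mult_distrib)
    ultimately show ?thesis
      using a(1)[of p] by (simp add: f''_def b''_def a(2) power_mult_distrib power2_eq_square mult_ac)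
  qed
  have sb: "summable b" "summable b'" "summable b''"
    unfolding b_def b'_def b''_def using \<mu>0 \<mu>4 by (intro summable_mult summable_geometric; simp)+
  define \<Phi> \<Phi>' \<Phi>'' where "\<Phi> t = bump_sum \<phi> (level_indices l0) (X l0) (2 ^ l0 * t) + (\<Sum>p. f p t)"
    and "\<Phi>' t = 2 ^ l0 *\<^sub>R bump_sum \<phi>' (level_indices l0) (X l0) (2 ^ l0 * t) + (\<Sum>p. f' p t)"
    and "\<Phi>'' t = 2 ^ l0 *\<^sub>R 2 ^ l0 *\<^sub>R bump_sum \<phi>'' (level_indices l0) (X l0) (2 ^ l0 * t) + (\<Sum>p. f'' p t)"
    for t
  have d1: "(\<Phi> has_vector_derivative \<Phi>' t) (at t)" for t
    unfolding \<Phi>_def \<Phi>'_def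
    by (intro has_vector_derivative_add bump_sum_deriv[OF deriv]
        has_vector_derivative_series[of f f' b b'] fd fb fb' sb)
  have d2: "(\<Phi>' has_vector_derivative \<Phi>'' t) (at t)" for t
    unfolding \<Phi>'_def \<Phi>''_def
    by (intro has_vector_derivative_add
        bounded_linear.has_vector_derivative[OF bounded_linear_scaleR_right bump_sum_deriv[OF deriv']]
        has_vector_derivative_series[of f' f'' b' b''] fd' fb' fb'' sb)
  have hoelder_f: "norm (f'' p s - f'' p t) \<le>
      ((2 ^ Suc l0) powr (2 + \<beta>) * (real (4 * m + 4) * K * D) * \<bar>s - t\<bar> powr \<beta>) * (2 powr (2 + \<beta>) * \<mu>) ^ p" for p s t
  proof -
    have "norm (f'' p s - f'' p t) = (a p)\<^sup>2 *
        norm (bump_sum \<phi>'' (J p) (R (l0 + p)) (a p * s) - bump_sum \<phi>'' (J p) (R (l0 + p)) (a p * t))"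
      using a(1)[of p] by (simp add: f''_def power2_eq_square flip: scaleR_diff_right)
    also have "\<dots> \<le> (a p)\<^sup>2 * (real (4 * m + 4) * K * (D * \<mu> ^ p) * ((a p) powr \<beta> * \<bar>s - t\<bar> powr \<beta>))"
      by (intro mult_left_mono bump_sum_hoelder J less_imp_le[OF a(1)]) auto
    also have "\<dots> = (a p)\<^sup>2 * (a p) powr \<beta> * (real (4 * m + 4) * K * D * \<bar>s - t\<bar> powr \<beta>) * \<mu> ^ p"
      by (simp add: mult_ac)
    also have "(a p)\<^sup>2 * (a p) powr \<beta> = (2 ^ Suc l0) powr (2 + \<beta>) * (2 powr (2 + \<beta>)) ^ p"
    proof -
      have "(a p)\<^sup>2 * (a p) powr \<beta> = (a p) powr (2 + \<beta>)"
        using a(1)[of p] by (simp add: powr_add flip: powr_numeral)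
      also have "\<dots> = (2 ^ Suc l0) powr (2 + \<beta>) * (2 ^ p) powr (2 + \<beta>)"
        unfolding a(2) by (rule powr_mult)
      also have "(2 ^ p) powr (2 + \<beta>) = ((2::real) powr (2 + \<beta>)) ^ p"
        by (simp add: powr_powr mult.commute flip: powr_realpow)
      finally show ?thesis .
    qed
    finally show ?thesis by (simp add: power_mult_distrib mult_ac)
  qed
  have geo: "summable (\<lambda>p. (2 powr (2 + \<beta>) * \<mu>) ^ p)"
    using \<mu>\<beta> \<mu>0 by (intro summable_geometric) auto
  have sf: "summable (\<lambda>p. f p t)" "summable (\<lambda>p. f'' p t)" for t
    by (rule summable_comparison_test'[OF sb(1) fb], rule summable_comparison_test'[OF sb(3) fb''])
  obtain \<rho> where \<rho>: "\<And>j. j \<in> level_indices l0 \<Longrightarrow> norm (X l0 j) \<le> \<rho>" "0 \<le> \<rho>"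
    by (rule that[of "\<Sum>j\<in>level_indices l0. norm (X l0 j)"])
      (auto intro!: member_le_sum sum_nonneg simp: level_indices_def)
  define H where "H = (2 ^ l0)\<^sup>2 * (real (4 * m + 4) * K * \<rho> * (2 ^ l0) powr \<beta>) +
      (2 ^ Suc l0) powr (2 + \<beta>) * (real (4 * m + 4) * K * D) * (\<Sum>p. (2 powr (2 + \<beta>) * \<mu>) ^ p)"
  have H: "norm (\<Phi>'' s - \<Phi>'' t) \<le> H * \<bar>s - t\<bar> powr \<beta>" for s t
  proof -
    have "norm ((2::real) ^ l0 *\<^sub>R 2 ^ l0 *\<^sub>R bump_sum \<phi>'' (level_indices l0) (X l0) (2 ^ l0 * s) -
        (2::real) ^ l0 *\<^sub>R 2 ^ l0 *\<^sub>R bump_sum \<phi>'' (level_indices l0) (X l0) (2 ^ l0 * t)) =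
        (2 ^ l0)\<^sup>2 * norm (bump_sum \<phi>'' (level_indices l0) (X l0) (2 ^ l0 * s) -
           bump_sum \<phi>'' (level_indices l0) (X l0) (2 ^ l0 * t))"
      by (simp add: power2_eq_square flip: scaleR_diff_right)
    also have "\<dots> \<le> (2 ^ l0)\<^sup>2 * (real (4 * m + 4) * K * \<rho> * ((2 ^ l0) powr \<beta> * \<bar>s - t\<bar> powr \<beta>))"
      using \<rho> by (intro mult_left_mono bump_sum_hoelder) (auto simp: level_indices_def)
    finally have 1: "norm ((2::real) ^ l0 *\<^sub>R 2 ^ l0 *\<^sub>R bump_sum \<phi>'' (level_indices l0) (X l0) (2 ^ l0 * s) -
        (2::real) ^ l0 *\<^sub>R 2 ^ l0 *\<^sub>R bump_sum \<phi>'' (level_indices l0) (X l0) (2 ^ l0 * t)) \<le> \<dots>" .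
    have "norm (\<Sum>p. f'' p s - f'' p t) \<le>
      (\<Sum>p. ((2 ^ Suc l0) powr (2 + \<beta>) * (real (4 * m + 4) * K * D) * \<bar>s - t\<bar> powr \<beta>) * (2 powr (2 + \<beta>) * \<mu>) ^ p)"
      by (rule norm_suminf_le[OF hoelder_f summable_mult[OF geo]])
    then have 2: "norm ((\<Sum>p. f'' p s) - (\<Sum>p. f'' p t)) \<le>
      (2 ^ Suc l0) powr (2 + \<beta>) * (real (4 * m + 4) * K * D) * \<bar>s - t\<bar> powr \<beta> * (\<Sum>p. (2 powr (2 + \<beta>) * \<mu>) ^ p)"
      using suminf_mult[OF geo] by (simp add: suminf_diff[OF sf(2) sf(2)])
    have "\<Phi>'' s - \<Phi>'' t =
        ((2::real) ^ l0 *\<^sub>R 2 ^ l0 *\<^sub>R bump_sum \<phi>'' (level_indices l0) (X l0) (2 ^ l0 * s) -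
        (2::real) ^ l0 *\<^sub>R 2 ^ l0 *\<^sub>R bump_sum \<phi>'' (level_indices l0) (X l0) (2 ^ l0 * t)) +
        ((\<Sum>p. f'' p s) - (\<Sum>p. f'' p t))"
      by (simp add: \<Phi>''_def algebra_simps)
    then have "norm (\<Phi>'' s - \<Phi>'' t) \<le>
        (2 ^ l0)\<^sup>2 * (real (4 * m + 4) * K * \<rho> * ((2 ^ l0) powr \<beta> * \<bar>s - t\<bar> powr \<beta>)) +
        (2 ^ Suc l0) powr (2 + \<beta>) * (real (4 * m + 4) * K * D) * \<bar>s - t\<bar> powr \<beta> * (\<Sum>p. (2 powr (2 + \<beta>) * \<mu>) ^ p)"
      using norm_triangle_mono[OF 1 2] by (simp only:)
    also have "\<dots> = H * \<bar>s - t\<bar> powr \<beta>"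
      unfolding H_def distrib_right by (simp only: mult_ac)
    finally show ?thesis .
  qed
  \<comment> \<open>Adding \<open>f p\<close> exchanges the curve of \<open>S (X ?l)\<close> for
    that of \<open>X (Suc ?l)\<close>; by \<open>curve_subdiv\<close> the former is the curve of
    \<open>X ?l\<close> at half the argument.\<close>
  have tele: "bump_sum \<phi> (level_indices l0) (X l0) (2 ^ l0 * t) + (\<Sum>q<p. f q t) = curve (X (l0 + p)) (2 ^ (l0 + p) * t)"
    if t: "0 < t" "t < of_int L" for t p
  proof (induction p)
    case (Suc p)
    let ?l = "l0 + p"
    have "f p t = curve (R ?l) (2 ^ Suc ?l * t)"
      unfolding f_def J_def a_def by (rule level_curve[OF t])
    also have "\<dots> = curve (X (Suc ?l)) (2 ^ Suc ?l * t) - curve (S (X ?l)) (2 ^ Suc ?l * t)"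
      by (simp add: curve_def R_def sum_subtractf scaleR_diff_right)
    also have "curve (S (X ?l)) (2 ^ Suc ?l * t) = curve (X ?l) (2 ^ ?l * t)"
      using curve_subdiv[of "X ?l" "2 ^ ?l * t"] by (simp add: mult.assoc)
    finally show ?case using Suc by (simp add: algebra_simps)
  qed (simp add: level_curve[OF t])
  define E where "E p = real (2 * m + 2) * B0 * (D * \<theta> ^ p) + (\<Sum>q. b (q + p))" for p
  have conv: "norm (\<Phi> (of_int i / 2 ^ (l0 + p)) - X (l0 + p) i) \<le> E p" if i: "0 < i" "i < 2 ^ (l0 + p) * L" for i p
  proof -
    let ?l = "l0 + p" and ?t = "of_int i / 2 ^ (l0 + p) :: real"
    have "real_of_int i < of_int (2 ^ ?l * L)" using i(2) by (simp only: of_int_less_iff)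
    then have t: "0 < ?t" "?t < of_int L" using i(1) by (auto simp: field_simps)
    have "\<Phi> ?t = curve (X ?l) (2 ^ ?l * ?t) + (\<Sum>q. f (q + p) ?t)"
      unfolding \<Phi>_def suminf_split_initial_segment[OF sf(1), of ?t p] using tele[OF t, of p] by (simp add: algebra_simps)
    \<comment> \<open>Constants are reproduced, so the distance from the level curve to a data point
      is a combination of differences within one window, which \<open>decay\<close> makes
      small.\<close>
    moreover have "curve (X ?l) (2 ^ ?l * ?t) - X ?l i = (\<Sum>j\<in>{i..i + 2 * int m}. \<phi> (of_int i - of_int j) *\<^sub>R (X ?l j - X ?l i))"
    proof -
      have "X ?l i = curve (\<lambda>_. X ?l i) (of_int i)"
        using curve_line[of "X ?l i" 0 "of_int i"] by simp
      then have "curve (X ?l) (2 ^ ?l * ?t) - X ?l i = curve (X ?l) (of_int i) - curve (\<lambda>_. X ?l i) (of_int i)"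
        by simp
      then show ?thesis by (simp add: curve_def sum_subtractf scaleR_diff_right)
    qed
    ultimately have e: "\<Phi> ?t - X ?l i =
        (\<Sum>j\<in>{i..i + 2 * int m}. \<phi> (of_int i - of_int j) *\<^sub>R (X ?l j - X ?l i)) + (\<Sum>q. f (q + p) ?t)"
      by (simp add: algebra_simps)
    have "norm (\<Sum>j\<in>{i..i + 2 * int m}. \<phi> (of_int i - of_int j) *\<^sub>R (X ?l j - X ?l i)) \<le>
        real (2 * m + 2) * B0 * (D * \<theta> ^ p)"
    proof (rule bump_sum_le[where t = "of_int i"])
      fix j assume "j \<in> {i..i + 2 * int m}"
      then show "norm (X ?l j - X ?l i) \<le> D * \<theta> ^ p"
        using D(3)[of i p "nat (j - i)"] i by auto
    next
      fix j assume "\<phi> (of_int i - of_int j) \<noteq> 0"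
      then show "- 2 * real m \<le> real_of_int i - of_int j \<and> real_of_int i - of_int j \<le> 1"
        using supp by (meson less_imp_le)
    qed (use B0 D(1) \<theta> in auto)
    moreover have "norm (\<Sum>q. f (q + p) ?t) \<le> (\<Sum>q. b (q + p))"
      by (rule norm_suminf_le[OF fb]) (use sb(1) in simp)
    ultimately show ?thesis unfolding e E_def by (rule norm_triangle_mono)
  qed
  have "E \<longlonglongrightarrow> real (2 * m + 2) * B0 * (D * 0) + 0"
    unfolding E_def using \<theta> sb(1)
    by (intro tendsto_intros LIMSEQ_power_zero suminf_exist_split2) auto
  then have E: "E \<longlonglongrightarrow> 0" by simp
  show thesis
  proof (rule that[OF d1 d2 H])
    fix \<epsilon> :: real assume "0 < \<epsilon>"
    then have "\<forall>\<^sub>F p in sequentially. E p < \<epsilon>" using E order_tendstoD(2) by blast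
    then obtain p0 where p0: "\<And>p. p \<ge> p0 \<Longrightarrow> E p < \<epsilon>" unfolding eventually_sequentially by blast
    show "\<forall>\<^sub>F l in sequentially. \<forall>i. 0 < i \<and> i < 2 ^ l * L \<longrightarrow> norm (\<Phi> (of_int i / 2 ^ l) - X l i) \<le> \<epsilon>"
      unfolding eventually_sequentially
    proof (intro exI allI impI)
      fix l i assume "l0 + p0 \<le> l" "0 < i \<and> i < 2 ^ l * L"
      moreover from this have "E (l - l0) < \<epsilon>" by (intro p0) linarith
      ultimately show "norm (\<Phi> (of_int i / 2 ^ l) - X l i) \<le> \<epsilon>"
        using conv[of i "l - l0"] by simp
    qed
  qed
qed

end

section \<open>GLUE-schemes\<close>

definition at_pos :: "nat \<Rightarrow> 'k::{finite,linorder}" where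
  "at_pos = inv pos"

definition tup :: "(nat \<Rightarrow> 'a) \<Rightarrow> 'a ^ ('k::{finite,linorder})" where
  "tup y = (\<chi> i. y (pos i))"

lemma pos_strict_mono: "i < j \<Longrightarrow> pos i < pos (j :: 'k::{finite,linorder})"
  unfolding pos_def by (rule psubset_card_mono) auto

lemma inj_pos: "inj (pos :: 'k::{finite,linorder} \<Rightarrow> nat)"
  by (rule injI) (metis linorder_neqE pos_strict_mono nat_neq_iff)

lemma pos_less: "pos (i :: 'k::{finite,linorder}) < CARD('k)"
  unfolding pos_def by (rule psubset_card_mono) auto

lemma range_pos: "range (pos :: 'k::{finite,linorder} \<Rightarrow> nat) = {..<CARD('k)}"
  by (rule card_subset_eq) (auto simp: pos_less card_image inj_pos)

lemma at_pos_pos [simp]: "at_pos (pos i) = i"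
  by (simp add: at_pos_def inj_pos)

lemma pos_at_pos [simp]: "j < CARD('k::{finite,linorder}) \<Longrightarrow> pos (at_pos j :: 'k) = j"
  unfolding at_pos_def by (rule f_inv_into_f) (simp add: range_pos)

lemma sum_pos: "(\<Sum>i\<in>(UNIV :: 'k::{finite,linorder} set). F (pos i)) = (\<Sum>j<CARD('k). F j)"
  using sum.reindex[OF inj_pos[where 'k = 'k], of F] by (simp add: range_pos)

lemma tup_nth [simp]: "tup y $ i = y (pos i)"
  by (simp add: tup_def)

lemma tup_at_pos [simp]: "tup (\<lambda>j. x $ at_pos j) = x"
  by (simp add: vec_eq_iff)

lemma tup_cong: "(\<And>j. j < CARD('k::{finite,linorder}) \<Longrightarrow> y j = z j) \<Longrightarrow> tup y = (tup z :: ('a, 'k) vec)"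
  by (simp add: vec_eq_iff pos_less)

lemma length_list_of [simp]: "length (list_of (v :: ('a, 'k::{finite,linorder}) vec)) = CARD('k)"
  by (simp add: list_of_def)

text \<open>In a strictly sorted enumeration of all indices, the entries before \<open>i\<close> are
  exactly the smaller ones, and \<open>pos i\<close> counts these.\<close>

lemma list_of_nth [simp]: "list_of v ! pos i = v $ (i :: 'k::{finite,linorder})"
proof -
  define xs where "xs = sorted_list_of_set (UNIV :: 'k set)"
  have xs: "set xs = UNIV" "sorted_wrt (<) xs" "length xs = CARD('k)" by (auto simp: xs_def)
  then obtain k where k: "k < length xs" "xs ! k = i" by (metis UNIV_I in_set_conv_nth)
  have "{j. j < i} = (!) xs ` {..<k}"
  proof (intro equalityI subsetI)
    fix j assume "j \<in> {j. j < i}"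
    moreover obtain k' where "k' < length xs" "xs ! k' = j" using xs(1) by (metis UNIV_I in_set_conv_nth)
    ultimately show "j \<in> (!) xs ` {..<k}"
      using k sorted_wrt_nth_less[OF xs(2), of k k'] by (cases k k' rule: linorder_cases) auto
  qed (use k sorted_wrt_nth_less[OF xs(2)] in auto)
  moreover have "inj_on ((!) xs) {..<k}"
    using k(1) by (intro inj_on_nth) (auto simp: xs_def)
  ultimately have "pos i = k" by (simp add: pos_def card_image)
  then show ?thesis using k by (simp add: list_of_def xs_def)
qed

lemma length_subchain: "i + n \<le> length P \<Longrightarrow> length (subchain n i P) = n"
  by (simp add: subchain_def)

lemma subchain_nth: "j < n \<Longrightarrow> i + n \<le> length P \<Longrightarrow> subchain n i P ! j = P ! (i + j)"
  by (simp add: subchain_def)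

lemma tup_of_subchain:
  "i + CARD('k) \<le> length P \<Longrightarrow>
    tup_of (subchain CARD('k) i P) = (tup (\<lambda>j. P ! (i + j)) :: ('a, 'k::{finite,linorder}) vec)"
  by (simp add: tup_of_def vec_eq_iff subchain_nth pos_less)

lemma tup_of_std_chain:
  "tup_of (std_chain CARD('k)) = (tup (\<lambda>j. real (j + 1) *\<^sub>R e1) :: ('d::{finite,linorder}, 'k::{finite,linorder}) tuple)"
  by (simp add: tup_of_def vec_eq_iff std_chain_def pos_less nth_append del: upt_Suc)

lemma norm_tup_le:
  assumes "\<And>j. j < CARD('k) \<Longrightarrow> norm (y j) \<le> r"
  shows "norm (tup y :: ('a::real_normed_vector, 'k::{finite,linorder}) vec) \<le> real CARD('k) * r"
proof -
  have "norm (tup y :: ('a, 'k) vec) \<le> (\<Sum>i\<in>UNIV. norm ((tup y :: ('a, 'k) vec) $ i))"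
    unfolding norm_vec_def by (rule L2_set_le_sum) simp
  also have "\<dots> \<le> (\<Sum>i\<in>(UNIV :: 'k set). r)"
    using assms pos_less by (intro sum_mono) auto
  finally show ?thesis by simp
qed

text \<open>Points are row vectors, and \<open>similarity\<close> multiplies by a matrix on the
  right, whence the transpose.\<close>

lemma similarity_orthogonal_transformation:
  fixes f :: "'d::finite point \<Rightarrow> 'd point"
  assumes "orthogonal_transformation f" "0 < \<rho>"
  shows "similarity (\<lambda>p. \<rho> *\<^sub>R f p + s)"
proof -
  have "orthogonal_matrix (transpose (matrix f))"
    using assms(1) by (simp add: orthogonal_transformation_matrix orthogonal_matrix_transpose)
  moreover have "p v* transpose (matrix f) = f p" for p
    using assms(1) by (simp add: matrix_works orthogonal_transformation_linear)
  ultimately show ?thesis unfolding similarity_def using assms(2) by metis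
qed

locale glue =
  fixes m :: nat and G :: "('d::{finite,linorder}) chain \<Rightarrow> 'd chain"
    and g :: "nat \<Rightarrow> ('d, 'k::{finite,linorder}) tuple \<Rightarrow> 'd point" and \<tau> \<nu> :: real
  assumes m_ge_1: "1 \<le> m" and card_k: "CARD('k) = m + 1" and glue: "glue_scheme m G g \<tau> \<nu>"
begin

lemma nu_pos: "0 < \<nu>"
  using glue by (simp add: glue_scheme_def)

lemma length_G: "2 * m + 1 \<le> length P \<Longrightarrow> length (G P) = 2 * length P - 2 * m"
  using glue by (simp add: glue_scheme_def)

lemma G_map: "similarity T \<Longrightarrow> 2 * m + 1 \<le> length P \<Longrightarrow> G (map T P) = map T (G P)"
  using glue by (simp add: glue_scheme_def)

lemma G_nth:
  assumes "2 * m + 1 \<le> length P" "r < length (G P)"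
  shows "G P ! r = g (r mod 2) (tup (\<lambda>j. P ! (r div 2 + j)))"
proof -
  have r: "r div 2 < length P - m" using assms by (simp add: length_G)
  have "\<forall>i < length P - m. \<forall>l\<in>{0, 1}. G P ! (2 * i + l) = g l (tup_of (subchain (m + 1) i P))"
    using glue assms(1) unfolding glue_scheme_def by blast
  from this[rule_format, OF r, of "r mod 2"]
  have "G P ! (2 * (r div 2) + r mod 2) = g (r mod 2) (tup_of (subchain (m + 1) (r div 2) P))"
    by (cases "r mod 2 = 0") simp_all
  moreover have "r div 2 + CARD('k) \<le> length P" using r card_k by simp
  ultimately show ?thesis using tup_of_subchain[where 'k = 'k] card_k by fastforce
qed

lemma length_pow:
  assumes "2 * m + 1 \<le> length P"
  shows "length ((G ^^ l) P) = 2 ^ l * (length P - 2 * m) + 2 * m"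
proof (induction l)
  case (Suc l)
  have "1 \<le> 2 ^ l * (length P - 2 * m)" using assms by simp
  then show ?case using Suc by (simp add: length_G)
qed (use assms in simp)

lemma length_pow_ge: "2 * m + 1 \<le> length P \<Longrightarrow> 2 * m + 1 \<le> length ((G ^^ l) P)"
  by (simp add: length_pow)

text \<open>Equivariance passes from \<open>G\<close> to its rules: the chain \<open>P\<close> of
  \<open>2 * m + 1\<close> points that continues the arguments of the rule has
  \<open>g l (tup y)\<close> as point number \<open>l\<close> of its image.\<close>

lemma g_similarity:
  assumes "similarity T" "l < 2"
  shows "g l (tup (\<lambda>j. T (y j))) = T (g l (tup y))"
proof -
  define P where "P = map y [0..<2 * m + 1]"
  have P: "length P = 2 * m + 1" "length (G P) = 2 * m + 2" by (simp_all add: P_def length_G)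
  have l: "l mod 2 = l" "l div 2 = 0" using assms(2) by auto
  have "G (map T P) ! l = g l (tup (\<lambda>j. map T P ! j))"
    using G_nth[of "map T P" l] P assms(2) by (simp add: length_G l)
  also have "tup (\<lambda>j. map T P ! j) = (tup (\<lambda>j. T (y j)) :: ('d, 'k) tuple)"
    by (rule tup_cong) (simp add: P_def card_k del: upt_Suc)
  finally have "g l (tup (\<lambda>j. T (y j))) = map T (G P) ! l"
    using G_map[OF assms(1), of P] P by simp
  also have "\<dots> = T (g l (tup (\<lambda>j. P ! j)))"
    using G_nth[of P l] P assms(2) by (simp add: l)
  also have "tup (\<lambda>j. P ! j) = (tup y :: ('d, 'k) tuple)"
    by (rule tup_cong) (simp add: P_def card_k del: upt_Suc)
  finally show ?thesis .
qed

lemma g_homogeneous: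
  assumes "0 < \<rho>" "l < 2"
  shows "g l (\<rho> *\<^sub>R x) = \<rho> *\<^sub>R g l x"
proof -
  have "similarity (\<lambda>p. \<rho> *\<^sub>R p + 0 :: 'd point)"
    using similarity_orthogonal_transformation[OF orthogonal_transformation_id assms(1), of 0] by simp
  from g_similarity[OF this assms(2), of "\<lambda>j. x $ at_pos j"]
  have "g l (tup (\<lambda>j. \<rho> *\<^sub>R x $ at_pos j)) = \<rho> *\<^sub>R g l x" by simp
  moreover have "tup (\<lambda>j. \<rho> *\<^sub>R x $ at_pos j) = \<rho> *\<^sub>R x" by (simp add: vec_eq_iff)
  ultimately show ?thesis by simp
qed

end

lemma inner_e1_e1 [simp]: "e1 \<bullet> e1 = 1" and norm_e1 [simp]: "norm e1 = 1"
  by (simp_all add: e1_def inner_axis_axis)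

lemma e1_neq_0 [simp]: "e1 \<noteq> 0"
  using norm_e1 norm_zero by (metis zero_neq_one)

lemma length_std_chain [simp]: "length (std_chain N) = N"
  by (simp add: std_chain_def)

text \<open>The first two components of the self-map with index 0 are the two rules, so the
  derivatives of both rules can be read off from this single map.\<close>

lemma (in glue) self_map_nth:
  assumes "CARD('n::{finite,linorder}) = 2 * m + 1" "l < 2"
  shows "self_map G 0 (v :: ('d, 'n) tuple) $ at_pos l = g l (tup (\<lambda>j. v $ at_pos j))"
proof -
  have l: "l mod 2 = l" "l div 2 = 0" using assms(2) by auto
  have len: "length (G (list_of v)) = 2 * m + 2" using assms(1) by (simp add: length_G)
  have "self_map G 0 v $ at_pos l = G (list_of v) ! l"
    unfolding self_map_def using assms m_ge_1 len by (subst tup_of_subchain) auto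
  also have "\<dots> = g l (tup (\<lambda>j. list_of v ! j))"
    using G_nth[of "list_of v" l] assms len by (simp add: l)
  also have "tup (\<lambda>j. list_of v ! j) = (tup (\<lambda>j. v $ at_pos j) :: ('d, 'k) tuple)"
  proof (rule tup_cong)
    fix j assume "j < CARD('k)"
    then have "pos (at_pos j :: 'n) = j" using assms(1) card_k by simp
    then show "list_of v ! j = v $ at_pos j" using list_of_nth[of v "at_pos j"] by simp
  qed
  finally show ?thesis .
qed

section \<open>The linear companion as a subdivision operator\<close>

locale linear_glue = glue m A a \<tau> \<nu>
  for m and A :: "('d::{finite,linorder}) chain \<Rightarrow> 'd chain"
    and a :: "nat \<Rightarrow> ('d, 'k::{finite,linorder}) tuple \<Rightarrow> 'd point" and \<tau> \<nu> :: real +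
  fixes w :: "nat \<Rightarrow> (real, 'k) vec"
  assumes linear: "linear_glue_scheme m A a w \<tau> \<nu>"
begin

definition c :: "nat \<Rightarrow> nat \<Rightarrow> real" where
  "c l j = w l $ at_pos j"

lemma sum_UNIV_eq: "(\<Sum>i\<in>(UNIV :: 'k set). F (pos i)) = (\<Sum>j\<le>m. F j)"
  unfolding sum_pos card_k by (simp add: lessThan_Suc_atMost)

lemma a_eq: "l < 2 \<Longrightarrow> a l x = (\<Sum>j\<in>UNIV. (w l $ j) *\<^sub>R (x $ j))"
  using linear by (auto simp: linear_glue_scheme_def less_2_cases_iff)

lemma a_tup: "l < 2 \<Longrightarrow> a l (tup y) = (\<Sum>j\<le>m. c l j *\<^sub>R y j)"
  using sum_UNIV_eq[of "\<lambda>j. c l j *\<^sub>R y j"] by (simp add: a_eq c_def)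

lemma sum_c: "l < 2 \<Longrightarrow> (\<Sum>j\<le>m. c l j) = 1"
  using sum_UNIV_eq[of "c l"] linear by (auto simp: c_def linear_glue_scheme_def less_2_cases_iff)

lemma linear_a: "l < 2 \<Longrightarrow> linear (a l)"
  by (rule linearI) (simp_all add: a_eq scaleR_add_right sum.distrib scaleR_sum_right mult.commute)

text \<open>Condition (E) at point number \<open>l\<close>. As \<open>std_chain\<close> starts at
  \<open>e1\<close> and not at 0, this point is \<open>(l + 1 + m + \<tau>) / 2\<close> times
  \<open>e1\<close>; subtracting 1 leaves the offset \<open>m + \<tau> - 1\<close>, which takes the
  place of \<open>\<tau>\<close> in \<open>refinable_function\<close>.\<close>

lemma sum_c_id:
  assumes "l < 2"
  shows "(\<Sum>j\<le>m. c l j * real j) = (real l + (real m + \<tau> - 1)) / 2"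
proof -
  have l: "l mod 2 = l" "l div 2 = 0" using assms by auto
  have std: "std_chain N ! j = real (j + 1) *\<^sub>R (e1 :: 'd point)" if "j < N" for j N
    using that by (simp add: std_chain_def del: upt_Suc)
  have "A (std_chain (2 * m + 1)) ! l = a l (tup (\<lambda>j. std_chain (2 * m + 1) ! j))"
    using G_nth[of "std_chain (2 * m + 1)" l] assms by (simp add: l length_G)
  also have "\<dots> = (\<Sum>j\<le>m. c l j *\<^sub>R std_chain (2 * m + 1) ! j)"
    by (rule a_tup[OF assms])
  also have "\<dots> = (\<Sum>j\<le>m. c l j *\<^sub>R real (j + 1) *\<^sub>R e1)"
    by (rule sum.cong) (simp_all add: std)
  also have "\<dots> = ((\<Sum>j\<le>m. c l j * real j) + (\<Sum>j\<le>m. c l j)) *\<^sub>R e1"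
    by (simp add: scaleR_sum_left sum.distrib algebra_simps)
  also have "A (std_chain (2 * m + 1)) ! l = ((1/2) * (real (l + 1) + (real m + \<tau>))) *\<^sub>R e1"
  proof -
    have "A (std_chain (2 * m + 1)) =
        map (\<lambda>p. (1/2) *\<^sub>R (p + (real m + \<tau>) *\<^sub>R e1)) (std_chain (2 * m + 2))"
      using glue by (simp add: glue_scheme_def)
    moreover have "l < length (std_chain (2 * m + 2) :: 'd chain)" using assms by simp
    ultimately show ?thesis
      using assms std[of l "2 * m + 2"] by (simp add: scaleR_left_distrib add_divide_distrib algebra_simps)
  qed
  finally have "(1/2) * (real (l + 1) + (real m + \<tau>)) = (\<Sum>j\<le>m. c l j * real j) + (\<Sum>j\<le>m. c l j)"
    by (simp only: scaleR_cancel_right e1_neq_0 simp_thms)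
  then show ?thesis using sum_c[OF assms] by (simp add: field_simps)
qed

text \<open>Any extension \<open>f\<close> of the chain to a bi-infinite sequence will do, because
  the points that exist at level \<open>l\<close> depend on points of \<open>P\<close> only.\<close>

lemma A_pow_nth:
  assumes P: "2 * m + 1 \<le> length P" and f: "\<And>j. j < length P \<Longrightarrow> f (int j) = P ! j"
  shows "r < length ((A ^^ l) P) \<Longrightarrow> (A ^^ l) P ! r = (subdiv m c ^^ l) f (int r)"
proof (induction l arbitrary: r)
  case (Suc l)
  define Q where "Q = (A ^^ l) P"
  have Q: "2 * m + 1 \<le> length Q" unfolding Q_def by (rule length_pow_ge[OF P])
  have r: "r < length (A Q)" using Suc.prems by (simp add: Q_def)
  have "(A ^^ Suc l) P ! r = a (r mod 2) (tup (\<lambda>j. Q ! (r div 2 + j)))"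
    using G_nth[OF Q r] by (simp add: Q_def)
  also have "\<dots> = (\<Sum>j\<le>m. c (r mod 2) j *\<^sub>R Q ! (r div 2 + j))"
    by (rule a_tup) simp
  also have "\<dots> = (\<Sum>j\<le>m. c (r mod 2) j *\<^sub>R (subdiv m c ^^ l) f (int (r div 2 + j)))"
  proof (rule sum.cong[OF refl])
    fix j assume "j \<in> {..m}"
    moreover have "r < 2 * length Q - 2 * m" using r Q by (simp add: length_G)
    ultimately have "r div 2 + j < length Q" by auto
    then show "c (r mod 2) j *\<^sub>R Q ! (r div 2 + j) = c (r mod 2) j *\<^sub>R (subdiv m c ^^ l) f (int (r div 2 + j))"
      using Suc.IH by (simp add: Q_def)
  qed
  also have "\<dots> = (subdiv m c ^^ Suc l) f (int r)"
    by (simp add: subdiv_def zdiv_int nat_mod_as_int)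
  finally show ?case .
qed (use f in simp)

end

section \<open>Comparison of the rules with their linearization\<close>

lemma C1_holder_linearization:
  fixes f :: "'a::real_normed_vector \<Rightarrow> 'b::real_normed_vector"
  assumes "C1_holder_near \<nu> f x" "(f has_derivative f') (at x)" "0 < \<nu>"
  obtains r C where "0 < r" "0 \<le> C"
    "\<And>u. norm u \<le> r \<Longrightarrow> norm (f (x + u) - f x - f' u) \<le> C * norm u powr \<nu> * norm u"
proof -
  obtain U and D :: "'a \<Rightarrow> 'a \<Rightarrow>\<^sub>L 'b" and C where U: "open U" "x \<in> U"
    and D: "\<And>y. y \<in> U \<Longrightarrow> (f has_derivative blinfun_apply (D y)) (at y)"
    and C: "\<And>y z. y \<in> U \<Longrightarrow> z \<in> U \<Longrightarrow> norm (D y - D z) \<le> C * dist y z powr \<nu>"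
    using assms(1) unfolding C1_holder_near_def by blast
  have f': "f' = blinfun_apply (D x)" using D[OF U(2)] assms(2) by (rule has_derivative_unique[symmetric])
  obtain r where r: "0 < r" "cball x r \<subseteq> U" using U open_contains_cball by blast
  have "norm (f (x + u) - f x - f' u) \<le> max C 0 * norm u powr \<nu> * norm u" if u: "norm u \<le> r" for u
  proof -
    have sub: "cball x (norm u) \<subseteq> U" using u r(2) by auto
    \<comment> \<open>The mean value inequality for \<open>f - D x\<close> on the ball of radius
      \<open>norm u\<close>, where the derivative \<open>D y - D x\<close> is at most a constant
      times \<open>norm u powr \<nu>\<close>.\<close>
    have "norm ((\<lambda>y. f y - D x y) (x + u) - (\<lambda>y. f y - D x y) x) \<le> (max C 0 * norm u powr \<nu>) * norm (x + u - x)"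
    proof (rule differentiable_bound[where S = "cball x (norm u)" and f' = "\<lambda>y. blinfun_apply (D y - D x)"])
      fix y assume y: "y \<in> cball x (norm u)"
      then have yU: "y \<in> U" using sub by blast
      have "((\<lambda>y. f y - D x y) has_derivative (\<lambda>h. D y h - D x h)) (at y)"
        by (intro has_derivative_diff D[OF yU] bounded_linear_imp_has_derivative blinfun.bounded_linear_right)
      then show "((\<lambda>y. f y - D x y) has_derivative blinfun_apply (D y - D x)) (at y within cball x (norm u))"
        by (auto simp: blinfun.diff_left[abs_def] intro: has_derivative_at_withinI)
      have "onorm (blinfun_apply (D y - D x)) = norm (D y - D x)" by (simp add: norm_blinfun.rep_eq)
      also have "\<dots> \<le> C * dist y x powr \<nu>" by (rule C[OF yU U(2)])
      also have "\<dots> \<le> max C 0 * dist y x powr \<nu>" by (rule mult_right_mono) auto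
      also have "\<dots> \<le> max C 0 * norm u powr \<nu>"
        using y assms(3) by (intro mult_left_mono powr_mono2) (auto simp: dist_commute)
      finally show "onorm (blinfun_apply (D y - D x)) \<le> max C 0 * norm u powr \<nu>" .
    qed (auto simp: dist_norm)
    then show ?thesis by (simp add: f' blinfun.add_right algebra_simps)
  qed
  then show thesis using that[of r "max C 0"] r(1) by auto
qed

locale linearized_glue = G: glue m G g \<tau>0 \<nu> + linear_glue m A a \<tau> \<nu>' w
  for m and G :: "('d::{finite,linorder}) chain \<Rightarrow> 'd chain"
    and g :: "nat \<Rightarrow> ('d, 'k::{finite,linorder}) tuple \<Rightarrow> 'd point" and \<tau>0 \<nu> :: real
    and A :: "'d chain \<Rightarrow> 'd chain" and a :: "nat \<Rightarrow> ('d, 'k) tuple \<Rightarrow> 'd point" and \<tau> \<nu>' :: real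
    and w :: "nat \<Rightarrow> (real, 'k) vec" +
  fixes B :: "nat \<Rightarrow> ('n::{finite,linorder}) sq_matrix"
  assumes card_n: "CARD('n) = 2 * m + 1"
    and locally_linear: "locally_linear_with G B" and corresponds: "corresponds_to A B"
begin

abbreviation E :: "('d, 'k) tuple" where
  "E \<equiv> tup (\<lambda>j. real (j + 1) *\<^sub>R e1)"

text \<open>Rules take \<open>m + 1\<close> points, self-maps \<open>2 * m + 1\<close>. Padding with
  the remaining points of the standard chain is an affine embedding with linear part
  \<open>ext'\<close>; the chain rule then reduces the derivative of a rule to a component of the
  derivative of \<open>self_map G 0\<close>.\<close>

lemma deriv_rule:
  assumes "l < 2"
  shows "(g l has_derivative a l) (at E)"
proof -
  define ext' :: "('d, 'k) tuple \<Rightarrow> ('d, 'n) tuple"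
    where "ext' x = tup (\<lambda>j. if j \<le> m then x $ at_pos j else 0)" for x
  define e :: "('d, 'n) tuple" where "e = tup (\<lambda>j. if j \<le> m then 0 else real (j + 1) *\<^sub>R e1)"
  have at: "ext' x $ at_pos j = x $ at_pos j" "e $ at_pos j = 0" if "j \<le> m" for j x
    using that card_n by (auto simp: ext'_def e_def)
  have pm: "pos i \<le> m" for i :: 'k
    using pos_less[of i] card_k by simp
  have ext_tup: "tup (\<lambda>j. (ext' x + e) $ at_pos j) = x" "tup (\<lambda>j. ext' x $ at_pos j) = x" for x
    by (simp_all add: vec_eq_iff at pm)
  have "linear ext'"
    by (rule linearI) (auto simp: ext'_def vec_eq_iff)
  then have ext': "((\<lambda>x. ext' x + e) has_derivative ext') (at x)" for x
    by (auto intro!: derivative_eq_intros bounded_linear_imp_has_derivative simp: linear_conv_bounded_linear)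
  have "ext' E + e = tup_of (std_chain CARD('n))"
    unfolding tup_of_std_chain using card_n card_k by (auto simp: vec_eq_iff ext'_def e_def less_Suc_eq_le)
  then have "((self_map G 0 :: ('d, 'n) tuple \<Rightarrow> _) has_derivative mat_chain_mult (B 0)) (at (ext' E + e))"
    using locally_linear by (simp add: locally_linear_with_def)
  from has_derivative_compose[OF ext' this]
  have "((\<lambda>x. self_map G 0 (ext' x + e) $ at_pos l) has_derivative
      (\<lambda>x. mat_chain_mult (B 0) (ext' x) $ at_pos l)) (at E)"
    by (rule bounded_linear.has_derivative[OF bounded_linear_vec_nth])
  moreover have "self_map G 0 (ext' x + e) $ at_pos l = g l x" for x
    unfolding G.self_map_nth[OF card_n assms] ext_tup ..
  moreover have "mat_chain_mult (B 0) (ext' x) $ at_pos l = a l x" for x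
  proof -
    have "mat_chain_mult (B 0) (ext' x) = self_map A 0 (ext' x)"
      using corresponds by (simp add: corresponds_to_def)
    then show ?thesis
      by (simp only: self_map_nth[OF card_n assms] ext_tup(2))
  qed
  ultimately show ?thesis by simp
qed

text \<open>Euler's identity: \<open>g l\<close> is homogeneous of degree 1, so its value at
  \<open>E\<close> is its derivative at \<open>E\<close> applied to \<open>E\<close>, and that
  derivative is \<open>a l\<close>.\<close>

lemma rule_E_eq:
  assumes "l < 2"
  shows "g l E = a l E"
proof -
  have "((\<lambda>\<rho>. \<rho> *\<^sub>R E) has_derivative (\<lambda>h. h *\<^sub>R E)) (at 1)"
    by (auto intro!: derivative_eq_intros)
  moreover have "(g l has_derivative a l) (at (1 *\<^sub>R E))" using deriv_rule[OF assms] by simp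
  ultimately have "((\<lambda>\<rho>. g l (\<rho> *\<^sub>R E)) has_derivative (\<lambda>h. a l (h *\<^sub>R E))) (at 1)"
    by (rule has_derivative_compose)
  moreover have "((\<lambda>\<rho>. \<rho> *\<^sub>R g l E) has_derivative (\<lambda>h. h *\<^sub>R g l E)) (at 1)"
    by (auto intro!: derivative_eq_intros)
  then have "((\<lambda>\<rho>. g l (\<rho> *\<^sub>R E)) has_derivative (\<lambda>h. h *\<^sub>R g l E)) (at 1)"
    by (rule has_derivative_transform_within_open[where s = "{0<..}"]) (auto simp: G.g_homogeneous assms)
  ultimately have "(\<lambda>h. a l (h *\<^sub>R E)) = (\<lambda>h. h *\<^sub>R g l E)"
    by (rule has_derivative_unique)
  from fun_cong[OF this, of 1] show ?thesis by simp
qed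

lemma rule_near_E:
  obtains r C where "0 < r" "0 \<le> C"
    "\<And>l u. l < 2 \<Longrightarrow> norm u \<le> r \<Longrightarrow> norm (g l (E + u) - a l (E + u)) \<le> C * norm u powr \<nu> * norm u"
proof -
  have *: "\<exists>r C. 0 < r \<and> 0 \<le> C \<and> (\<forall>u. norm u \<le> r \<longrightarrow> norm (g l (E + u) - a l (E + u)) \<le> C * norm u powr \<nu> * norm u)"
    if l: "l < 2" for l
  proof -
    have "tup_of (std_chain (m + 1)) = E" using tup_of_std_chain[where 'k = 'k and 'd = 'd] card_k by simp
    moreover have "l \<in> {0, 1}" using l by auto
    ultimately have "C1_holder_near \<nu> (g l) E"
      using G.glue unfolding glue_scheme_def by metis
    from C1_holder_linearization[OF this deriv_rule[OF l] G.nu_pos] obtain r C where rC: "0 < r" "0 \<le> C"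
      "\<And>u. norm u \<le> r \<Longrightarrow> norm (g l (E + u) - g l E - a l u) \<le> C * norm u powr \<nu> * norm u"
      by blast
    have "g l E + a l u = a l (E + u)" for u
      by (simp only: rule_E_eq[OF l] linear_add[OF linear_a[OF l]])
    then have "g l (E + u) - g l E - a l u = g l (E + u) - a l (E + u)" for u
      by (simp only: diff_diff_add)
    then show ?thesis using rC by metis
  qed
  obtain r0 C0 where 0: "0 < r0" "0 \<le> C0"
    "\<And>u. norm u \<le> r0 \<Longrightarrow> norm (g 0 (E + u) - a 0 (E + u)) \<le> C0 * norm u powr \<nu> * norm u"
    using *[of 0] by auto
  obtain r1 C1 where 1: "0 < r1" "0 \<le> C1"
    "\<And>u. norm u \<le> r1 \<Longrightarrow> norm (g 1 (E + u) - a 1 (E + u)) \<le> C1 * norm u powr \<nu> * norm u"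
    using *[of 1] by auto
  show thesis
  proof (rule that[of "min r0 r1" "max C0 C1"])
    fix l :: nat and u :: "('d, 'k) tuple" assume lu: "l < 2" "norm u \<le> min r0 r1"
    have "C0 * norm u powr \<nu> * norm u \<le> max C0 C1 * norm u powr \<nu> * norm u"
      "C1 * norm u powr \<nu> * norm u \<le> max C0 C1 * norm u powr \<nu> * norm u"
      by (intro mult_right_mono; simp)+
    then show "norm (g l (E + u) - a l (E + u)) \<le> max C0 C1 * norm u powr \<nu> * norm u"
      using 0(3)[of u] 1(3)[of u] lu by (auto simp: less_2_cases_iff)
  qed (use 0 1 in auto)
qed

text \<open>A similarity carries \<open>E\<close> to the points \<open>x + j v\<close>. In its
  coordinates deviations are divided by \<open>norm v\<close>, and \<open>rule_near_E\<close>
  applies. Scaling back gives \<open>norm v\<close> times the power \<open>1 + \<nu>\<close> of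
  \<open>\<rho> / norm v\<close>, which is the form of the bound.\<close>

lemma rule_near_line:
  obtains \<delta> C where "0 < \<delta>" "0 \<le> C"
    "\<And>l y v x \<rho>. \<lbrakk>l < 2; v \<noteq> 0; \<And>j. j \<le> m \<Longrightarrow> norm (y j - x - real j *\<^sub>R v) \<le> \<rho>; \<rho> \<le> \<delta> * norm v\<rbrakk>
      \<Longrightarrow> norm (g l (tup y) - (\<Sum>j\<le>m. c l j *\<^sub>R y j)) \<le> C * \<rho> * (\<rho> / norm v) powr \<nu>"
proof -
  obtain r C where r: "0 < r" and C: "0 \<le> C"
    and near: "\<And>l u. l < 2 \<Longrightarrow> norm u \<le> r \<Longrightarrow> norm (g l (E + u) - a l (E + u)) \<le> C * norm u powr \<nu> * norm u"
    using rule_near_E by blast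
  define N where "N = real (m + 1)"
  have N: "0 < N" by (simp add: N_def)
  have main: "norm (g l (tup y) - (\<Sum>j\<le>m. c l j *\<^sub>R y j)) \<le> C * N * N powr \<nu> * \<rho> * (\<rho> / norm v) powr \<nu>"
    if l: "l < 2" and v: "v \<noteq> 0" and y: "\<And>j. j \<le> m \<Longrightarrow> norm (y j - x - real j *\<^sub>R v) \<le> \<rho>"
      and \<rho>: "\<rho> \<le> (r / N) * norm v" for l y v x \<rho>
  proof -
    have \<rho>0: "0 \<le> \<rho>" using y[of 0] norm_ge_zero order_trans by blast
    have "norm (e1 :: 'd point) = norm (v /\<^sub>R norm v)" using v by simp
    then obtain f :: "'d point \<Rightarrow> 'd point"
      where f: "orthogonal_transformation f" "f e1 = v /\<^sub>R norm v"
      by (rule orthogonal_transformation_exists)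
    have lin: "linear f" using f(1) by (rule orthogonal_transformation_linear)
    \<comment> \<open>\<open>f\<close> turns \<open>e1\<close> into the direction of
      \<open>v\<close>. As \<open>E\<close> starts with \<open>e1\<close>, the translation that
      sends its first point to \<open>x\<close> is by \<open>x - v\<close>.\<close>
    define T where "T p = norm v *\<^sub>R f p + (x - v)" for p
    have sim: "similarity T"
      unfolding T_def using similarity_orthogonal_transformation[OF f(1)] v by simp
    obtain h where h: "\<And>p. f (h p) = p"
      using orthogonal_transformation_surj[OF f(1)] by (metis surjD)
    have norm_f: "norm (f p) = norm p" for p using f(1) by (simp add: orthogonal_transformation_norm)
    have norm_h: "norm (h p) = norm p" for p using norm_f[of "h p"] h by simp
    define u where "u j = h ((1 / norm v) *\<^sub>R (y j - x - real j *\<^sub>R v))" for j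
    have yT: "y j = T (real (j + 1) *\<^sub>R e1 + u j)" for j
    proof -
      have "f (real (j + 1) *\<^sub>R e1 + u j) = real (j + 1) *\<^sub>R (v /\<^sub>R norm v) + (1 / norm v) *\<^sub>R (y j - x - real j *\<^sub>R v)"
        by (simp add: linear_add[OF lin] linear_scale[OF lin] f(2) u_def h)
      then have "T (real (j + 1) *\<^sub>R e1 + u j) = norm v *\<^sub>R (real (j + 1) *\<^sub>R (v /\<^sub>R norm v) +
          (1 / norm v) *\<^sub>R (y j - x - real j *\<^sub>R v)) + (x - v)"
        by (simp only: T_def)
      also have "\<dots> = real (j + 1) *\<^sub>R v + (y j - x - real j *\<^sub>R v) + (x - v)"
        using v by (simp add: scaleR_right_distrib mult.commute)
      finally show ?thesis by (simp add: algebra_simps)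
    qed
    have "norm (u j) \<le> \<rho> / norm v" if "j \<le> m" for j
      using y[OF that] by (simp add: u_def norm_h divide_right_mono)
    then have nu: "norm (tup u :: ('d, 'k) tuple) \<le> N * (\<rho> / norm v)"
      using norm_tup_le[where 'k = 'k, of u "\<rho> / norm v"] card_k by (simp add: N_def)
    also have "\<dots> \<le> r" using \<rho> v N by (simp add: field_simps)
    finally have nr: "norm (tup u :: ('d, 'k) tuple) \<le> r" .
    define z where "z j = real (j + 1) *\<^sub>R e1 + u j" for j
    have z: "tup z = E + tup u" by (simp add: vec_eq_iff z_def)
    have yz: "y = (\<lambda>j. T (z j))" unfolding z_def by (rule ext) (rule yT)
    have "g l (tup y) = T (g l (tup z))"
      unfolding yz by (rule G.g_similarity[OF sim l])
    moreover have "(\<Sum>j\<le>m. c l j *\<^sub>R y j) = T (a l (tup z))"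
    proof -
      have "(\<Sum>j\<le>m. c l j *\<^sub>R y j) = norm v *\<^sub>R f (\<Sum>j\<le>m. c l j *\<^sub>R z j) + (\<Sum>j\<le>m. c l j) *\<^sub>R (x - v)"
        unfolding yz T_def
        by (simp add: linear_sum[OF lin] linear_scale[OF lin] scaleR_sum_right scaleR_sum_left sum.distrib
            scaleR_add_right mult.commute)
      then show ?thesis by (simp add: T_def a_tup[OF l] sum_c[OF l])
    qed
    moreover have "T p - T q = norm v *\<^sub>R f (p - q)" for p q
      by (simp add: T_def linear_diff[OF lin] algebra_simps)
    ultimately have "norm (g l (tup y) - (\<Sum>j\<le>m. c l j *\<^sub>R y j)) = norm v * norm (g l (E + tup u) - a l (E + tup u))"
      by (simp add: norm_f z)
    also have "\<dots> \<le> norm v * (C * norm (tup u :: ('d, 'k) tuple) powr \<nu> * norm (tup u :: ('d, 'k) tuple))"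
      by (intro mult_left_mono near l nr) simp
    also have "\<dots> \<le> norm v * (C * (N * (\<rho> / norm v)) powr \<nu> * (N * (\<rho> / norm v)))"
      using nu C G.nu_pos N \<rho>0 by (intro mult_left_mono mult_mono powr_mono2) auto
    also have "\<dots> = C * N * N powr \<nu> * \<rho> * (\<rho> / norm v) powr \<nu>"
      unfolding powr_mult using v by simp
    finally show ?thesis .
  qed
  show thesis
  proof (rule that[of "r / N" "C * N * N powr \<nu>"])
    show "norm (g l (tup y) - (\<Sum>j\<le>m. c l j *\<^sub>R y j)) \<le> C * N * N powr \<nu> * \<rho> * (\<rho> / norm v) powr \<nu>"
      if "l < 2" "v \<noteq> 0" "\<And>j. j \<le> m \<Longrightarrow> norm (y j - x - real j *\<^sub>R v) \<le> \<rho>" "\<rho> \<le> r / N * norm v" for l y v x \<rho>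
      using that by (rule main)
  qed (use r N C in auto)
qed

end

section \<open>The basic limit function\<close>

definition cut :: "real \<Rightarrow> real \<Rightarrow> (real \<Rightarrow> real) \<Rightarrow> real \<Rightarrow> real" where
  "cut a b F t = (if a < t \<and> t < b then F t else 0)"

text \<open>Limit curves are known to be smooth on an open parameter interval only. A function
  vanishing near both ends of \<open>(a, b)\<close> stays differentiable when continued by 0, and by
  the first claim the same lemma applies to its derivative.\<close>

lemma cut_deriv:
  assumes ab: "a < a'" "b' < b"
    and F: "\<And>t. a < t \<Longrightarrow> t < b \<Longrightarrow> (F has_field_derivative F' t) (at t)"
    and z: "\<And>t. a < t \<Longrightarrow> t < b \<Longrightarrow> t < a' \<or> b' < t \<Longrightarrow> F t = 0"
  shows "\<And>t. a < t \<Longrightarrow> t < b \<Longrightarrow> t < a' \<or> b' < t \<Longrightarrow> F' t = 0"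
    and "(cut a b F has_field_derivative cut a b F' t) (at t)"
proof -
  show F'z: "F' t = 0" if t: "a < t" "t < b" "t < a' \<or> b' < t" for t
  proof (rule DERIV_unique[OF F[OF t(1,2)]])
    show "(F has_field_derivative 0) (at t)"
      by (rule DERIV_cong_ev[OF refl _ refl, THEN iffD2, of _ "\<lambda>_. 0"], rule eventually_nhds_in_open
          [of "{a<..<b} \<inter> ({..<a'} \<union> {b'<..})", THEN eventually_mono]) (use t z in \<open>auto intro!: derivative_eq_intros open_Int open_Un\<close>)
  qed
  show "(cut a b F has_field_derivative cut a b F' t) (at t)"
  proof (cases "a < t \<and> t < b")
    case True
    have ev: "\<forall>\<^sub>F x in nhds t. cut a b F x = F x"
      by (rule eventually_nhds_in_open[of "{a<..<b}", THEN eventually_mono]) (use True in \<open>auto simp: cut_def\<close>)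
    have "cut a b F' t = F' t" using True by (simp add: cut_def)
    with F True show ?thesis using DERIV_cong_ev[OF refl ev refl] by auto
  next
    case False
    have ev: "\<forall>\<^sub>F x in nhds t. cut a b F x = 0"
      by (rule eventually_nhds_in_open[of "{..<a'} \<union> {b'<..}", THEN eventually_mono])
        (use False ab z in \<open>auto simp: cut_def\<close>)
    have "cut a b F' t = 0" using False by (auto simp: cut_def)
    then show ?thesis using DERIV_cong_ev[OF refl ev refl] by auto
  qed
qed

lemma Ck_holder_curve_D:
  assumes "Ck_holder_curve 2 \<beta> L \<Phi>"
  obtains D1 D2 where
    "\<And>t. 0 < t \<Longrightarrow> t < L \<Longrightarrow> (\<Phi> has_vector_derivative D1 t) (at t)"
    "\<And>t. 0 < t \<Longrightarrow> t < L \<Longrightarrow> (D1 has_vector_derivative D2 t) (at t)"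
    "continuous_on {0<..<L} D2"
    "\<And>z. 0 < z \<Longrightarrow> \<exists>h0 K. 0 < h0 \<and> 0 \<le> K \<and>
      (\<forall>s t. z \<le> s \<and> s \<le> L - z \<and> z \<le> t \<and> t \<le> L - z \<and> \<bar>s - t\<bar> \<le> h0 \<longrightarrow> norm (D2 s - D2 t) \<le> K * \<bar>s - t\<bar> powr \<beta>)"
proof -
  obtain \<Psi> h0 where kd: "kth_derivative_on 2 {0<..<L} \<Phi> \<Psi>" and c: "continuous_on {0<..<L} \<Psi>" and h0: "0 < h0"
    and h: "\<And>z. 0 < z \<Longrightarrow> (SUP h\<in>{0<..h0}. ennreal (h powr (- \<beta>)) * modulus L z \<Psi> h) < \<infinity>"
    using assms unfolding Ck_holder_curve_def by blast
  obtain D where D: "D 0 = \<Phi>" "D 2 = \<Psi>"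
    "\<forall>j<2. \<forall>t\<in>{0<..<L}. (D j has_vector_derivative D (Suc j) t) (at t)"
    using kd unfolding kth_derivative_on_def by blast
  have "\<exists>h0 K. 0 < h0 \<and> 0 \<le> K \<and>
      (\<forall>s t. z \<le> s \<and> s \<le> L - z \<and> z \<le> t \<and> t \<le> L - z \<and> \<bar>s - t\<bar> \<le> h0 \<longrightarrow> norm (\<Psi> s - \<Psi> t) \<le> K * \<bar>s - t\<bar> powr \<beta>)"
    if z: "0 < z" for z
  proof -
    obtain K where K: "0 \<le> K" "(SUP h\<in>{0<..h0}. ennreal (h powr (- \<beta>)) * modulus L z \<Psi> h) = ennreal K"
      using h[OF z] by (metis ennreal_cases infinity_ennreal_def less_irrefl)
    have lt: "norm (\<Psi> t - \<Psi> s) \<le> K * (t - s) powr \<beta>"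
      if st: "z \<le> s" "s < t" "t \<le> L - z" "t - s \<le> h0" for s t
    proof -
      define d where "d = t - s"
      have d: "0 < d" "d \<le> h0" using st by (auto simp: d_def)
      \<comment> \<open>The modulus compares points placed symmetrically about a centre. This centre
        is within the range of the supremum because \<open>s\<close> and \<open>t\<close> have
        distance at least \<open>z\<close> from the ends.\<close>
      define x where "x = (s + t) / 2"
      have x: "x + d / 2 = t" "x - d / 2 = s" "x \<in> {z + d/2..L - (z + d/2)}"
        using st by (auto simp: x_def d_def field_simps)
      have "ennreal (norm (\<Psi> (x + d/2) - \<Psi> (x - d/2))) \<le> modulus L z \<Psi> d"
        unfolding modulus_def by (rule SUP_upper[OF x(3)])
      then have "ennreal (d powr (- \<beta>)) * ennreal (norm (\<Psi> t - \<Psi> s)) \<le> ennreal (d powr (- \<beta>)) * modulus L z \<Psi> d"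
        unfolding x by (rule mult_left_mono) simp
      also have "\<dots> \<le> ennreal K"
        unfolding K(2)[symmetric] by (rule SUP_upper) (use d in auto)
      finally have "d powr (- \<beta>) * norm (\<Psi> t - \<Psi> s) \<le> K"
        using K(1) by (simp add: ennreal_le_iff flip: ennreal_mult)
      then have "d powr \<beta> * (d powr (- \<beta>) * norm (\<Psi> t - \<Psi> s)) \<le> d powr \<beta> * K"
        by (rule mult_left_mono) simp
      moreover have "d powr \<beta> * (d powr (- \<beta>) * norm (\<Psi> t - \<Psi> s)) = norm (\<Psi> t - \<Psi> s)"
        using d(1) by (simp add: powr_minus)
      ultimately have "norm (\<Psi> t - \<Psi> s) \<le> d powr \<beta> * K" by (simp only:)
      then show ?thesis by (simp add: d_def mult.commute)
    qed
    have "norm (\<Psi> s - \<Psi> t) \<le> K * \<bar>s - t\<bar> powr \<beta>"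
      if "z \<le> s" "s \<le> L - z" "z \<le> t" "t \<le> L - z" "\<bar>s - t\<bar> \<le> h0" for s t
      using lt[of s t] lt[of t s] that
      by (cases s t rule: linorder_cases) (auto simp: norm_minus_commute abs_if)
    then show ?thesis using h0 K(1) by blast
  qed
  then show thesis
    using that[of "D 1" \<Psi>] D c by (simp add: numeral_2_eq_2 less_Suc_eq all_conj_distrib)
qed

lemma limit_curve_eventually:
  assumes "limit_curve n G P \<Phi>" "0 < z" "0 < \<epsilon>"
  shows "\<forall>\<^sub>F l in sequentially. \<forall>i::nat. 0 < i \<and> z \<le> real i / 2 ^ l \<and> real i / 2 ^ l \<le> param_length n P - z \<longrightarrow>
    norm (\<Phi> (real i / 2 ^ l) - (G ^^ l) P ! i) < \<epsilon>"
proof -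
  have "(\<lambda>l. SUP i \<in> {i::nat. 0 < i \<and> real i / 2 ^ l \<in> {z..param_length n P - z}}.
      ennreal (norm (\<Phi> (real i / 2 ^ l) - (G ^^ l) P ! i))) \<longlonglongrightarrow> 0"
    using assms(1,2) by (simp add: limit_curve_def)
  then have "\<forall>\<^sub>F l in sequentially. (SUP i \<in> {i::nat. 0 < i \<and> real i / 2 ^ l \<in> {z..param_length n P - z}}.
      ennreal (norm (\<Phi> (real i / 2 ^ l) - (G ^^ l) P ! i))) < ennreal \<epsilon>"
    by (rule order_tendstoD) (use assms(3) in simp)
  then show ?thesis
  proof eventually_elim
    case (elim l)
    show ?case
    proof (intro allI impI)
      fix i :: nat assume "0 < i \<and> z \<le> real i / 2 ^ l \<and> real i / 2 ^ l \<le> param_length n P - z"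
      then have "ennreal (norm (\<Phi> (real i / 2 ^ l) - (G ^^ l) P ! i)) < ennreal \<epsilon>"
        by (intro le_less_trans[OF SUP_upper elim]) auto
      then show "norm (\<Phi> (real i / 2 ^ l) - (G ^^ l) P ! i) < \<epsilon>"
        by (simp add: ennreal_less_iff)
    qed
  qed
qed

text \<open>An entry can be nonzero only if its window \<open>{b..b + 2 * m}\<close> contains the
  position 0 of the impulse.\<close>

lemma impulse_support:
  assumes "(subdiv m c ^^ l) unit_impulse i \<noteq> 0"
  shows "- 2 * real m \<le> of_int i / 2 ^ l \<and> of_int i / (2::real) ^ l < 1"
proof -
  define b where "b = i div 2 ^ l"
  have 0: "0 \<in> {b..b + 2 * int m}"
  proof (rule ccontr)
    assume "0 \<notin> {b..b + 2 * int m}"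
    then have "(subdiv m c ^^ l) unit_impulse i = (subdiv m c ^^ l) (\<lambda>_. 0) i"
      unfolding b_def by (intro subdiv_pow_cong) (auto simp: unit_impulse_def)
    then show False using assms by (simp add: subdiv_pow_zero)
  qed
  have "\<lfloor>of_int i / (2::real) ^ l\<rfloor> = b"
    unfolding b_def using floor_divide_of_int_eq[of i "2 ^ l"] by simp
  then have "of_int b \<le> of_int i / (2::real) ^ l" "of_int i / (2::real) ^ l < of_int b + 1"
    using floor_correct[of "of_int i / (2::real) ^ l"] by auto
  moreover have "real_of_int b \<le> 0" "0 \<le> real_of_int b + 2 * real m"
    using 0 by auto
  ultimately show ?thesis by linarith
qed

context linear_glue
begin

lemma linear_limit_at_dyadic:
  assumes P: "2 * m + 1 \<le> length P" and f: "\<And>j. j < length P \<Longrightarrow> f (int j) = P ! j"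
    and lim: "limit_curve (2 * m + 1) A P \<Phi>"
    and x: "0 < of_int i / (2::real) ^ k" "of_int i / (2::real) ^ k < real (length P) - 2 * real m"
  shows "(\<lambda>p. (subdiv m c ^^ (k + p)) f (i * 2 ^ p)) \<longlonglongrightarrow> \<Phi> (of_int i / 2 ^ k)"
proof (rule LIMSEQ_I)
  fix r :: real assume "0 < r"
  define y where "y = of_int i / (2::real) ^ k"
  define z where "z = min y (real (length P) - 2 * real m - y)"
  have z: "0 < z" using x by (simp add: z_def y_def)
  from limit_curve_eventually[OF lim z \<open>0 < r\<close>] obtain l0 where
    l0: "\<And>l i. l \<ge> l0 \<Longrightarrow> 0 < (i::nat) \<Longrightarrow> z \<le> real i / 2 ^ l \<Longrightarrow> real i / 2 ^ l \<le> param_length (2 * m + 1) P - z \<Longrightarrow>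
      norm (\<Phi> (real i / 2 ^ l) - (A ^^ l) P ! i) < r"
    unfolding eventually_sequentially by blast
  have "norm ((subdiv m c ^^ (k + p)) f (i * 2 ^ p) - \<Phi> y) < r" if "l0 \<le> p" for p
  proof -
    have i: "0 < i" using x(1) by (simp add: zero_less_divide_iff)
    define q where "q = nat (i * 2 ^ p)"
    have q: "int q = i * 2 ^ p" using i by (simp add: q_def)
    then have rq: "real q = of_int i * 2 ^ p" by (metis of_int_mult of_int_numeral of_int_of_nat_eq of_int_power)
    have qy: "real q / 2 ^ (k + p) = y" by (simp add: rq y_def power_add)
    have "real q < real (2 ^ (k + p) * (length P - 2 * m))"
      using x(2) P unfolding qy[symmetric, unfolded y_def] by (simp add: field_simps of_nat_diff)
    then have "q < length ((A ^^ (k + p)) P)"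
      unfolding length_pow[OF P] of_nat_less_iff by simp
    then have "(A ^^ (k + p)) P ! q = (subdiv m c ^^ (k + p)) f (i * 2 ^ p)"
      using A_pow_nth[OF P f] q by metis
    moreover have "norm (\<Phi> (real q / 2 ^ (k + p)) - (A ^^ (k + p)) P ! q) < r"
    proof (rule l0)
      show "0 < q" using i by (simp add: q_def)
      show "z \<le> real q / 2 ^ (k + p)" unfolding qy by (simp add: z_def)
      show "real q / 2 ^ (k + p) \<le> param_length (2 * m + 1) P - z"
        unfolding qy z_def param_length_def by simp
    qed (use that in simp)
    ultimately show ?thesis unfolding qy by (simp add: norm_minus_commute)
  qed
  then show "\<exists>no. \<forall>p\<ge>no. norm ((subdiv m c ^^ (k + p)) f (i * 2 ^ p) - \<Phi> (of_int i / 2 ^ k)) < r"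
    unfolding y_def by blast
qed

text \<open>\<open>\<phi>\<close> is the first coordinate of the limit curve of one concrete chain,
  an impulse \<open>e1\<close> far from both ends. The support then lies well inside the parameter
  interval, so that regularity there extends to the whole real line.\<close>

lemma ex_refinable_function:
  assumes reg: "\<And>P. 2 * m + 1 \<le> length P \<Longrightarrow> Ck_holder_at (2 * m + 1) 2 \<beta> A P" and \<beta>: "0 < \<beta>"
  obtains \<phi> \<phi>' \<phi>'' K where "refinable_function m c (real m + \<tau> - 1) \<phi> \<phi>' \<phi>'' \<beta> K"
proof -
  \<comment> \<open>The parameter interval of the chain is \<open>(0, 4 * m + 3)\<close>. An impulse
    at \<open>c0\<close> carries the support to \<open>{2..2 * m + 3}\<close>, at distance at least
    2 from both ends.\<close>
  define c0 where "c0 = 2 * m + 2"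
  define P :: "'d chain" where "P = map (\<lambda>j. if j = c0 then e1 else 0) [0..<6 * m + 3]"
  have P: "2 * m + 1 \<le> length P" "length P = 6 * m + 3" by (simp_all add: P_def)
  define f :: "int \<Rightarrow> 'd point" where "f i = unit_impulse (i + - int c0) *\<^sub>R e1" for i
  have f: "f (int j) = P ! j" if "j < length P" for j
    using that by (auto simp: f_def P_def unit_impulse_def simp del: upt_Suc)
  have Sf: "(subdiv m c ^^ l) f i = (subdiv m c ^^ l) unit_impulse (i - 2 ^ l * int c0) *\<^sub>R e1" for l i
    unfolding f_def subdiv_pow_scaleR subdiv_pow_shift by simp
  obtain \<Phi> where lim: "limit_curve (2 * m + 1) A P \<Phi>"
    and hc: "Ck_holder_curve 2 \<beta> (param_length (2 * m + 1) P) \<Phi>"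
    using reg[OF P(1)] unfolding Ck_holder_at_def by blast
  have L: "param_length (2 * m + 1) P = 4 * real m + 3" by (simp add: param_length_def P(2))
  have cont: "isCont \<Phi> t" for t
    using lim by (simp add: limit_curve_def continuous_on_eq_continuous_at)
  obtain D1 D2 where D:
    "\<And>t. 0 < t \<Longrightarrow> t < 4 * real m + 3 \<Longrightarrow> (\<Phi> has_vector_derivative D1 t) (at t)"
    "\<And>t. 0 < t \<Longrightarrow> t < 4 * real m + 3 \<Longrightarrow> (D1 has_vector_derivative D2 t) (at t)"
    "continuous_on {0<..<4 * real m + 3} D2"
    "\<And>z. 0 < z \<Longrightarrow> \<exists>h0 K. 0 < h0 \<and> 0 \<le> K \<and>
      (\<forall>s t. z \<le> s \<and> s \<le> 4 * real m + 3 - z \<and> z \<le> t \<and> t \<le> 4 * real m + 3 - z \<and> \<bar>s - t\<bar> \<le> h0 \<longrightarrow>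
        norm (D2 s - D2 t) \<le> K * \<bar>s - t\<bar> powr \<beta>)"
    using Ck_holder_curve_D[OF hc[unfolded L]] by blast
  define F F' F'' where "F t = \<Phi> (real c0 + t) \<bullet> e1" and "F' t = D1 (real c0 + t) \<bullet> e1"
    and "F'' t = D2 (real c0 + t) \<bullet> e1" for t
  \<comment> \<open>Moved by \<open>c0\<close> this is \<open>(1, 4 * m + 2)\<close>: one unit
    inside the parameter interval, and with at least one unit to spare around the support.\<close>
  define a b where "a = - 2 * real m - 1" and "b = 2 * real m"
  have m1: "1 \<le> real m" using m_ge_1 by simp
  have dF: "(F has_field_derivative F' t) (at t)" "(F' has_field_derivative F'' t) (at t)" if "a < t" "t < b" for t
  proof -
    have t: "0 < real c0 + t" "real c0 + t < 4 * real m + 3" using that by (auto simp: c0_def a_def b_def)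
    have s: "((\<lambda>t. real c0 + t) has_vector_derivative 1) (at t)"
      by (auto intro!: derivative_eq_intros)
    show "(F has_field_derivative F' t) (at t)"
      using bounded_linear.has_vector_derivative[OF bounded_linear_inner_left
          vector_diff_chain_at[OF s D(1)[OF t], unfolded o_def], of e1]
      unfolding F_def F'_def has_real_derivative_iff_has_vector_derivative by simp
    show "(F' has_field_derivative F'' t) (at t)"
      using bounded_linear.has_vector_derivative[OF bounded_linear_inner_left
          vector_diff_chain_at[OF s D(2)[OF t], unfolded o_def], of e1]
      unfolding F'_def F''_def has_real_derivative_iff_has_vector_derivative by simp
  qed
  have contF: "isCont F t" for t
    unfolding F_def by (intro continuous_intros isCont_o2[OF _ cont])
  have dyadic0: "F (of_int i / 2 ^ k) = 0"
    if x: "a - 1 < of_int i / 2 ^ k" "of_int i / 2 ^ k < b + 1" "of_int i / 2 ^ k < - 2 * real m \<or> 1 \<le> of_int i / (2::real) ^ k" for i k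
  proof -
    define i' where "i' = i + 2 ^ k * int c0"
    have i': "of_int i' / (2::real) ^ k = real c0 + of_int i / 2 ^ k"
      by (simp add: i'_def add_divide_distrib)
    have "0 < of_int i' / (2::real) ^ k" "of_int i' / (2::real) ^ k < real (length P) - 2 * real m"
      using x(1,2) unfolding i' by (simp_all add: P(2) a_def b_def c0_def)
    with f have "(\<lambda>p. (subdiv m c ^^ (k + p)) f (i' * 2 ^ p)) \<longlonglongrightarrow> \<Phi> (real c0 + of_int i / 2 ^ k)"
      unfolding i'[symmetric] by (intro linear_limit_at_dyadic[OF P(1) _ lim])
    moreover have "(subdiv m c ^^ (k + p)) f (i' * 2 ^ p) = 0" for p
    proof -
      have "i' * 2 ^ p - 2 ^ (k + p) * int c0 = i * 2 ^ p"
        by (simp add: i'_def power_add algebra_simps)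
      moreover have "of_int (i * 2 ^ p) / 2 ^ (k + p) = of_int i / (2::real) ^ k" by (simp add: power_add)
      then have "(subdiv m c ^^ (k + p)) unit_impulse (i * 2 ^ p) = 0"
        using impulse_support[of "k + p" m c "i * 2 ^ p"] x(3) by force
      ultimately show ?thesis by (simp add: Sf)
    qed
    ultimately have "\<Phi> (real c0 + of_int i / 2 ^ k) = 0" using LIMSEQ_unique[OF _ tendsto_const] by simp
    then show ?thesis by (simp add: F_def)
  qed
  have F0: "F t = 0" if t: "a < t" "t < b" "t < - 2 * real m \<or> 1 < t" for t
    by (rule eq_if_eq_on_dyadics[where f = F and g = "\<lambda>_. 0" and t = t and U = "{a<..<b} \<inter> ({..< - 2 * real m} \<union> {1<..})"])
      (use t contF dyadic0 in \<open>auto intro!: open_Int open_Un\<close>)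
  have F1: "F 1 = 0" using dyadic0[of 1 0] m1 by (simp add: a_def b_def)
  \<comment> \<open>\<open>impulse_support\<close> does not exclude a nonzero entry at
    \<open>- 2 * m\<close> itself. The value there is obtained by continuity from dyadic points to
    the left.\<close>
  have Fm: "F (- 2 * real m) = 0"
  proof -
    define s where "s k = of_int (- 2 * int m * 2 ^ k - 1) / (2::real) ^ k" for k :: nat
    have s: "s k = - 2 * real m - (1/2) ^ k" for k by (simp add: s_def field_simps power_divide)
    have "(\<lambda>k. - 2 * real m - (1/2) ^ k) \<longlonglongrightarrow> - 2 * real m - 0"
      by (intro tendsto_intros LIMSEQ_power_zero) auto
    then have "s \<longlonglongrightarrow> - 2 * real m" by (simp add: s[abs_def])
    then have "(\<lambda>k. F (s k)) \<longlonglongrightarrow> F (- 2 * real m)" by (rule isCont_tendsto_compose[OF contF])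
    moreover have "F (s k) = 0" for k
      unfolding s_def
    proof (rule dyadic0)
      have p: "(0::real) < (1/2) ^ k" "(1/2) ^ k \<le> (1::real)" by (auto simp: power_le_one)
      show "a - 1 < of_int (- 2 * int m * 2 ^ k - 1) / (2::real) ^ k"
        "of_int (- 2 * int m * 2 ^ k - 1) / (2::real) ^ k < b + 1"
        "of_int (- 2 * int m * 2 ^ k - 1) / (2::real) ^ k < - 2 * real m \<or> 1 \<le> of_int (- 2 * int m * 2 ^ k - 1) / (2::real) ^ k"
        using p unfolding s_def[symmetric] s a_def b_def by linarith+
    qed
    ultimately show ?thesis using LIMSEQ_unique[OF _ tendsto_const] by simp
  qed
  have ab: "a < - 2 * real m" "1 < b" using m1 by (auto simp: a_def b_def)
  note cd1 = cut_deriv[OF ab dF(1) F0]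
  note cd2 = cut_deriv[OF ab dF(2) cd1(1)]
  define \<phi> \<phi>' \<phi>'' where "\<phi> = cut a b F" and "\<phi>' = cut a b F'" and "\<phi>'' = cut a b F''"
  have supp: "- 2 * real m < t \<and> t < 1" if "\<phi> t \<noteq> 0" for t
    using that F0[of t] F1 Fm by (auto simp: \<phi>_def cut_def split: if_splits) (metis less_eq_real_def linorder_not_le)+
  have supp': "- 2 * real m \<le> t \<and> t \<le> 1" if "\<phi>' t \<noteq> 0" for t
  proof -
    have "a < t" "t < b" "F' t \<noteq> 0" using that by (auto simp: \<phi>'_def cut_def split: if_splits)
    then show ?thesis using cd1(1)[of t] not_le by blast
  qed
  have supp'': "- 2 * real m \<le> t \<and> t \<le> 1" if "\<phi>'' t \<noteq> 0" for t
  proof -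
    have "a < t" "t < b" "F'' t \<noteq> 0" using that by (auto simp: \<phi>''_def cut_def split: if_splits)
    then show ?thesis using cd2(1)[of t] not_le by blast
  qed
  obtain h0 K0 where h0: "0 < h0" "0 \<le> K0"
    "\<And>s t. 1/2 \<le> s \<Longrightarrow> s \<le> 4 * real m + 3 - 1/2 \<Longrightarrow> 1/2 \<le> t \<Longrightarrow> t \<le> 4 * real m + 3 - 1/2 \<Longrightarrow> \<bar>s - t\<bar> \<le> h0 \<Longrightarrow>
        norm (D2 s - D2 t) \<le> K0 * \<bar>s - t\<bar> powr \<beta>"
    using D(4)[of "1/2"] by auto
  have F''h: "\<bar>F'' s - F'' t\<bar> \<le> K0 * \<bar>s - t\<bar> powr \<beta>" if "a < s" "s < b" "a < t" "t < b" "\<bar>s - t\<bar> \<le> h0" for s t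
  proof -
    have "\<bar>F'' s - F'' t\<bar> \<le> norm (D2 (real c0 + s) - D2 (real c0 + t)) * norm (e1 :: 'd point)"
      unfolding F''_def inner_diff_left[symmetric] by (rule Cauchy_Schwarz_ineq2)
    also have "\<dots> \<le> K0 * \<bar>(real c0 + s) - (real c0 + t)\<bar> powr \<beta>"
      using h0(3)[of "real c0 + s" "real c0 + t"] that by (simp add: a_def b_def c0_def)
    finally show ?thesis by simp
  qed
  define h1 where "h1 = min h0 (1/2)"
  have h1: "0 < h1" "h1 \<le> h0" "h1 < 1" using h0 by (auto simp: h1_def)
  \<comment> \<open>Two points closer than 1 either both lie in \<open>(a, b)\<close> or are both
    outside the support of \<open>\<phi>''\<close>.\<close>
  have near: "\<bar>\<phi>'' s - \<phi>'' t\<bar> \<le> K0 * \<bar>s - t\<bar> powr \<beta>" if st: "\<bar>s - t\<bar> \<le> h1" for s t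
  proof (cases "(a < s \<and> s < b) \<and> (a < t \<and> t < b)")
    case True
    then show ?thesis using F''h[of s t] st h1 by (simp add: \<phi>''_def cut_def)
  next
    case False
    have "2 * real m - 1 \<ge> 1" using m1 by simp
    then have "\<phi>'' s = 0 \<and> \<phi>'' t = 0"
      using False supp''[of s] supp''[of t] st h1 m1 unfolding \<phi>''_def cut_def a_def b_def by (smt (verit))
    then show ?thesis using h0(2) by simp
  qed
  have "compact (F'' ` {- 2 * real m..1})"
  proof (rule compact_continuous_image)
    show "continuous_on {- 2 * real m..1} F''"
      unfolding F''_def
      by (intro continuous_intros continuous_on_compose2[OF D(3)]) (use m1 in \<open>auto simp: c0_def\<close>)
  qed simp
  then obtain B where B: "\<And>t. - 2 * real m \<le> t \<Longrightarrow> t \<le> 1 \<Longrightarrow> \<bar>F'' t\<bar> \<le> B"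
    using compact_imp_bounded bounded_iff by (metis atLeastAtMost_iff image_eqI real_norm_def)
  have B0: "0 \<le> B" using B[of 0] by (simp add: order_trans[OF abs_ge_zero])
  have bound: "\<bar>\<phi>'' t\<bar> \<le> B" for t
    using supp''[of t] B[of t] B0 by (cases "\<phi>'' t = 0") (auto simp: \<phi>''_def cut_def split: if_splits)
  \<comment> \<open>For points farther apart than \<open>h1\<close> the bound \<open>2 * B\<close>
    of the difference is compared with \<open>h1 powr \<beta>\<close>.\<close>
  define K where "K = max K0 (2 * B / h1 powr \<beta>)"
  have hoelder: "\<bar>\<phi>'' s - \<phi>'' t\<bar> \<le> K * \<bar>s - t\<bar> powr \<beta>" for s t
  proof (cases "\<bar>s - t\<bar> \<le> h1")
    case True
    have "K0 * \<bar>s - t\<bar> powr \<beta> \<le> K * \<bar>s - t\<bar> powr \<beta>" by (intro mult_right_mono) (auto simp: K_def)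
    then show ?thesis using near[OF True] by linarith
  next
    case False
    have "\<bar>\<phi>'' s - \<phi>'' t\<bar> \<le> 2 * B" using bound[of s] bound[of t] by linarith
    also have "\<dots> = 2 * B / h1 powr \<beta> * h1 powr \<beta>" using h1 by simp
    also have "\<dots> \<le> K * \<bar>s - t\<bar> powr \<beta>"
      using False h1 \<beta> B0 by (intro mult_mono powr_mono2) (auto simp: K_def le_max_iff_disj)
    finally show ?thesis .
  qed
  \<comment> \<open>Indices over the support belong to points of the iterated chain, where the
    convergence is uniform; at all other indices both terms vanish. So the estimate holds for all
    integers at once.\<close>
  have cascade: "\<forall>\<^sub>F k in sequentially. \<forall>i. \<bar>\<phi> (of_int i / 2 ^ k) - (subdiv m c ^^ k) unit_impulse i\<bar> < \<epsilon>"
    if \<epsilon>: "0 < \<epsilon>" for \<epsilon>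
    using limit_curve_eventually[OF lim zero_less_one \<epsilon>]
  proof eventually_elim
    case (elim k)
    show ?case
    proof
      fix i
      define x where "x = of_int i / (2::real) ^ k"
      show "\<bar>\<phi> (of_int i / 2 ^ k) - (subdiv m c ^^ k) unit_impulse i\<bar> < \<epsilon>"
      proof (cases "- 2 * real m \<le> x \<and> x < 1")
        case True
        define q where "q = nat (i + 2 ^ k * int c0)"
        have "0 < real c0 + x" using True by (simp add: c0_def)
        then have "real_of_int 0 < of_int (i + 2 ^ k * int c0)"
          by (simp add: x_def field_simps)
        then have q0: "0 < i + 2 ^ k * int c0" unfolding of_int_less_iff .
        then have q: "int q = i + 2 ^ k * int c0" by (simp add: q_def)
        then have rq: "real q = of_int i + 2 ^ k * real c0"
          by (metis of_int_add of_int_mult of_int_numeral of_int_of_nat_eq of_int_power)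
        have qx: "real q / 2 ^ k = real c0 + x" by (simp add: rq x_def add_divide_distrib)
        have "real q < real (2 ^ k * (length P - 2 * m))"
        proof -
          have "real q = 2 ^ k * (real c0 + x)" using qx by (simp add: field_simps)
          also have "\<dots> < 2 ^ k * (4 * real m + 3)" using True m1 by (intro mult_strict_left_mono) (auto simp: c0_def)
          finally show ?thesis by (simp add: P(2))
        qed
        then have ql: "q < length ((A ^^ k) P)"
          unfolding length_pow[OF P(1)] of_nat_less_iff by simp
        have "(A ^^ k) P ! q = (subdiv m c ^^ k) f (int q)"
          by (rule A_pow_nth[OF P(1) f ql])
        then have Aq: "(A ^^ k) P ! q = (subdiv m c ^^ k) unit_impulse i *\<^sub>R e1"
          by (simp add: Sf q)
        have "norm (\<Phi> (real q / 2 ^ k) - (A ^^ k) P ! q) < \<epsilon>"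
        proof (rule elim[rule_format], intro conjI)
          show "0 < q" using q0 by (simp add: q_def)
          show "1 \<le> real q / 2 ^ k" "real q / 2 ^ k \<le> param_length (2 * m + 1) P - 1"
            using True m1 unfolding L qx by (auto simp: c0_def)
        qed
        then have "norm (\<Phi> (real c0 + x) - (subdiv m c ^^ k) unit_impulse i *\<^sub>R e1) < \<epsilon>"
          unfolding qx Aq .
        moreover have "\<phi> x - (subdiv m c ^^ k) unit_impulse i =
            (\<Phi> (real c0 + x) - (subdiv m c ^^ k) unit_impulse i *\<^sub>R e1) \<bullet> e1"
          using True ab by (simp add: \<phi>_def cut_def F_def inner_diff_left)
        moreover have "\<bar>p \<bullet> e1\<bar> \<le> norm p" for p :: "'d point"
          using Cauchy_Schwarz_ineq2[of p e1] by simp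
        ultimately show ?thesis unfolding x_def[symmetric] by (simp only:) (blast intro: order_le_less_trans)
      next
        case False
        then have "\<phi> x = 0" using supp[of x] by force
        moreover have "(subdiv m c ^^ k) unit_impulse i = 0"
          using False impulse_support[of k m c i] unfolding x_def by blast
        ultimately show ?thesis using \<epsilon> by (simp add: x_def)
      qed
    qed
  qed
  have "refinable_function m c (real m + \<tau> - 1) \<phi> \<phi>' \<phi>'' \<beta> K"
  proof
    show "(\<phi> has_field_derivative \<phi>' t) (at t)" "(\<phi>' has_field_derivative \<phi>'' t) (at t)" for t
      unfolding \<phi>_def \<phi>'_def \<phi>''_def using cd1(2) cd2(2) by blast+
  qed (use m_ge_1 sum_c sum_c_id supp supp' supp'' \<beta> hoelder cascade in auto)
  then show thesis by (rule that)
qed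

end

section \<open>Relative distortion\<close>

lemma length_fdiff [simp]: "length (fdiff P) = length P - 1"
  by (simp add: fdiff_def less_diff_conv)

lemma fdiff_nth: "j + 1 < length P \<Longrightarrow> fdiff P ! j = P ! (j + 1) - P ! j"
  by (simp add: fdiff_def less_diff_conv)

lemma fdiff2_nth:
  "j + 2 < length P \<Longrightarrow> fdiff (fdiff P) ! j = P ! (j + 2) - 2 *\<^sub>R P ! (j + 1) + P ! j"
  by (simp add: fdiff_nth scaleR_2)

lemma null_chain_iff: "null_chain P \<longleftrightarrow> (\<forall>j<length P. P ! j = 0)"
  by (metis in_set_conv_nth)

lemma norm_nth_le_Max: "j < length P \<Longrightarrow> norm (P ! j) \<le> Max (norm ` set P)"
  by (intro Max_ge) auto

lemma linear_chains_iff: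
  "q \<in> linear_chains N \<longleftrightarrow> (\<exists>x v. q = map (\<lambda>j. x + real j *\<^sub>R v) [0..<N])"
proof
  assume q: "q \<in> linear_chains N"
  then have len: "length q = N" and null: "\<And>j. j + 2 < N \<Longrightarrow> fdiff (fdiff q) ! j = 0"
    unfolding linear_chains_def null_chain_iff by auto
  define f where "f i = q ! nat i" for i
  have "f (0 + int j) - f 0 - real j *\<^sub>R (f (0 + 1) - f 0) = 0" if "j < N" for j
  proof -
    have "norm (f (0 + int j) - f 0 - real j *\<^sub>R (f (0 + 1) - f 0)) \<le> (real j)\<^sup>2 * 0"
    proof (rule norm_sub_line_le)
      fix i :: int assume i: "0 \<le> i" "i \<le> int (N - 1) - 2"
      have e: "nat (i + 2) = nat i + 2" "nat (i + 1) = nat i + 1" using i by auto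
      have "nat i + 2 < N" using i that by linarith
      then have "diff2 f (0 + i) = 0"
        using null[of "nat i"] fdiff2_nth[of "nat i" q] len by (simp only: diff2_def f_def e add_0)
      then show "norm (diff2 f (0 + i)) \<le> 0" by simp
    qed (use that in auto)
    then show ?thesis by simp
  qed
  then have qj: "q ! j = q ! 0 + real j *\<^sub>R (q ! 1 - q ! 0)" if "j < N" for j
    using that by (simp add: f_def algebra_simps)
  have "q = map (\<lambda>j. q ! 0 + real j *\<^sub>R (q ! 1 - q ! 0)) [0..<N]"
  proof (rule nth_equalityI)
    fix j assume "j < length q"
    then show "q ! j = map (\<lambda>j. q ! 0 + real j *\<^sub>R (q ! 1 - q ! 0)) [0..<N] ! j"
      using qj[of j] len by (simp only: nth_map_upt diff_zero add_0)
  qed (simp add: len)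
  then show "\<exists>x v. q = map (\<lambda>j. x + real j *\<^sub>R v) [0..<N]" by blast
next
  assume "\<exists>x v. q = map (\<lambda>j. x + real j *\<^sub>R v) [0..<N]"
  then show "q \<in> linear_chains N"
    unfolding linear_chains_def null_chain_iff
    by (auto simp: fdiff_nth vec_eq_iff algebra_simps)
qed

lemma chain_inner_diff:
  "length q = length p \<Longrightarrow> chain_inner (map2 (-) p q) r = (\<Sum>i<length p. (p ! i - q ! i) \<bullet> (r ! i))"
  by (simp add: chain_inner_def)

definition centre :: "nat \<Rightarrow> real" where
  "centre N = (real N - 1) / 2"

text \<open>The slope of the least squares line through the points \<open>p ! j\<close> at the
  parameters \<open>j\<close>; measuring these from their mean decouples it from the
  intercept.\<close>

definition slope :: "('d::finite) chain \<Rightarrow> 'd point" where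
  "slope p = (1 / (\<Sum>j<length p. (real j - centre (length p))\<^sup>2)) *\<^sub>R
     (\<Sum>j<length p. (real j - centre (length p)) *\<^sub>R p ! j)"

lemma sum_centre: "(\<Sum>j<N. real j - centre N) = 0"
proof -
  have "(\<Sum>j<N. real j) = real N * (real N - 1) / 2"
    by (induction N) (auto simp: field_simps)
  then show ?thesis by (simp add: sum_subtractf centre_def)
qed

lemma sum_centre_square_pos:
  assumes "2 \<le> N"
  shows "0 < (\<Sum>j<N. (real j - centre N)\<^sup>2)"
proof (rule sum_pos2[of _ 0])
  show "0 < (real 0 - centre N)\<^sup>2" using assms by (simp add: centre_def)
qed (use assms in auto)

text \<open>The orthogonal projection onto the linear chains is linear regression, with
  \<open>z1\<close> and \<open>z2\<close> as normal equations. Uniqueness, required by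
  \<open>THE\<close>, holds because the difference of two candidates is a linear chain orthogonal to
  itself.\<close>

lemma line_proj_eq:
  fixes p :: "('d::finite) chain"
  assumes N: "2 \<le> length p"
  obtains x where "line_proj p = map (\<lambda>j. x + real j *\<^sub>R slope p) [0..<length p]"
proof -
  define N where "N = length p"
  define v where "v = slope p"
  define s where "s = (\<Sum>j<N. (real j - centre N)\<^sup>2)"
  define x where "x = (1 / real N) *\<^sub>R (\<Sum>j<N. p ! j) - centre N *\<^sub>R v"
  define q where "q = map (\<lambda>j. x + real j *\<^sub>R v) [0..<N]"
  have N0: "0 < real N" using assms by (auto simp: N_def)
  have s: "0 < s" unfolding s_def by (rule sum_centre_square_pos) (use assms in \<open>simp add: N_def\<close>)
  have sv: "(\<Sum>j<N. (real j - centre N) *\<^sub>R p ! j) = s *\<^sub>R v"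
    using s unfolding v_def slope_def N_def[symmetric] s_def[symmetric] by simp
  have z1: "(\<Sum>j<N. p ! j - (x + real j *\<^sub>R v)) = 0"
  proof -
    have "(\<Sum>j<N. p ! j - (x + real j *\<^sub>R v)) = (\<Sum>j<N. p ! j) - real N *\<^sub>R (x + centre N *\<^sub>R v) - (\<Sum>j<N. real j - centre N) *\<^sub>R v"
      by (simp add: sum_subtractf sum.distrib scaleR_sum_left sum_constant_scaleR algebra_simps del: sum_constant)
    also have "real N *\<^sub>R (x + centre N *\<^sub>R v) = (\<Sum>j<N. p ! j)" using N0 by (simp add: x_def)
    finally show ?thesis by (simp add: sum_centre)
  qed
  have z2: "(\<Sum>j<N. (real j - centre N) *\<^sub>R (p ! j - (x + real j *\<^sub>R v))) = 0"
  proof -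
    have "(\<Sum>j<N. (real j - centre N) *\<^sub>R (p ! j - (x + real j *\<^sub>R v))) =
        (\<Sum>j<N. (real j - centre N) *\<^sub>R p ! j) - (\<Sum>j<N. real j - centre N) *\<^sub>R (x + centre N *\<^sub>R v) - s *\<^sub>R v"
      unfolding s_def scaleR_sum_left sum_subtractf[symmetric]
      by (rule sum.cong) (simp_all add: vec_eq_iff algebra_simps power2_eq_square)
    then show ?thesis by (simp add: sum_centre sv)
  qed
  have orth: "chain_inner (map2 (-) p q) r = 0" if hr: "r \<in> linear_chains N" for r
  proof -
    obtain y z where r: "r = map (\<lambda>j. y + real j *\<^sub>R z) [0..<N]"
      using hr[unfolded linear_chains_iff] by blast
    have "chain_inner (map2 (-) p q) r = (\<Sum>j<N. (p ! j - (x + real j *\<^sub>R v)) \<bullet> (y + real j *\<^sub>R z))"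
      by (subst chain_inner_diff) (simp_all add: q_def r N_def)
    also have "\<dots> = (\<Sum>j<N. (p ! j - (x + real j *\<^sub>R v))) \<bullet> (y + centre N *\<^sub>R z) +
        (\<Sum>j<N. (real j - centre N) *\<^sub>R (p ! j - (x + real j *\<^sub>R v))) \<bullet> z"
      unfolding inner_sum_left sum.distrib[symmetric]
      by (rule sum.cong) (simp_all add: inner_add_right algebra_simps)
    finally show ?thesis by (simp add: z1 z2)
  qed
  have "line_proj p = q"
    unfolding line_proj_def N_def[symmetric]
  proof (rule the_equality)
    show "q \<in> linear_chains N \<and> (\<forall>r\<in>linear_chains N. chain_inner (map2 (-) p q) r = 0)"
    proof -
      have "q \<in> linear_chains N" unfolding linear_chains_iff q_def by blast
      then show ?thesis using orth by blast
    qed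
    fix q' assume q': "q' \<in> linear_chains N \<and> (\<forall>r\<in>linear_chains N. chain_inner (map2 (-) p q') r = 0)"
    then obtain y z where q'e: "q' = map (\<lambda>j. y + real j *\<^sub>R z) [0..<N]" unfolding linear_chains_iff by blast
    define r where "r = map (\<lambda>j. (y - x) + real j *\<^sub>R (z - v)) [0..<N]"
    have r: "r \<in> linear_chains N" unfolding linear_chains_iff r_def by blast
    have "0 = chain_inner (map2 (-) p q) r - chain_inner (map2 (-) p q') r"
      using orth[OF r] q' r by simp
    also have "\<dots> = (\<Sum>j<N. (q' ! j - q ! j) \<bullet> r ! j)"
    proof -
      have "length q = length p" "length q' = length p" by (simp_all add: q_def q'e N_def)
      then show ?thesis
        by (simp only: chain_inner_diff N_def[symmetric] sum_subtractf[symmetric] inner_diff_left[symmetric])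
          (rule sum.cong, simp_all)
    qed
    also have "\<dots> = (\<Sum>j<N. (norm (q' ! j - q ! j))\<^sup>2)"
      by (rule sum.cong) (simp_all add: r_def q_def q'e power2_norm_eq_inner algebra_simps)
    finally have "\<forall>j\<in>{..<N}. (norm (q' ! j - q ! j))\<^sup>2 = 0"
      by (subst (asm) eq_commute, subst (asm) sum_nonneg_eq_0_iff) auto
    then show "q' = q" by (intro nth_equalityI) (auto simp: q_def q'e)
  qed
  then show thesis using that unfolding q_def v_def N_def by blast
qed

text \<open>All first differences of the projected chain equal \<open>slope p\<close>, so this is
  the denominator of the distortion. Being below a real number excludes the degenerate case, where
  the distortion is infinite.\<close>

lemma rel_distortion_lessD:
  fixes p :: "('d::finite) chain"
  assumes N: "3 \<le> length p" and lt: "rel_distortion p < ereal \<epsilon>"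
  shows "slope p \<noteq> 0"
    and "j + 2 < length p \<Longrightarrow> norm (p ! (j + 2) - 2 *\<^sub>R p ! (j + 1) + p ! j) \<le> \<epsilon> * norm (slope p)"
proof -
  obtain x where lp: "line_proj p = map (\<lambda>j. x + real j *\<^sub>R slope p) [0..<length p]"
    using line_proj_eq[of p] N by auto
  have fd: "fdiff (line_proj p) = replicate (length p - 1) (slope p)"
    by (rule nth_equalityI) (auto simp: fdiff_nth lp scaleR_left_distrib)
  have nn: "\<not> null_chain (fdiff (line_proj p))" using lt by (auto simp: rel_distortion_def split: if_splits)
  then show sl: "slope p \<noteq> 0" by (auto simp: fd)
  have "set (fdiff (line_proj p)) = {slope p}" using N by (simp add: fd set_replicate_conv_if)
  then have s1: "seminorm 1 (line_proj p) = norm (slope p)" by (simp add: seminorm_def)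
  have "seminorm 2 p / norm (slope p) < \<epsilon>"
    using lt nn unfolding rel_distortion_def s1 by simp
  then have "seminorm 2 p \<le> \<epsilon> * norm (slope p)" using sl by (simp add: field_simps)
  moreover assume "j + 2 < length p"
  then have "norm (p ! (j + 2) - 2 *\<^sub>R p ! (j + 1) + p ! j) \<le> seminorm 2 p"
    using norm_nth_le_Max[of j "fdiff (fdiff p)"] fdiff2_nth[of j p]
    by (simp add: seminorm_def numeral_2_eq_2)
  ultimately show "norm (p ! (j + 2) - 2 *\<^sub>R p ! (j + 1) + p ! j) \<le> \<epsilon> * norm (slope p)" by linarith
qed

text \<open>Regression reproduces the slope of straight data. The difference to the first step is
  therefore a weighted mean of the deviations \<open>r j\<close> from the line through the first two
  points.\<close>

lemma norm_slope_diff_le: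
  fixes p :: "('d::finite) chain"
  assumes N: "2 \<le> length p" and M: "0 \<le> M"
    and d2: "\<And>j. j + 2 < length p \<Longrightarrow> norm (p ! (j + 2) - 2 *\<^sub>R p ! (j + 1) + p ! j) \<le> M"
  shows "norm (slope p - (p ! 1 - p ! 0)) \<le>
    (\<Sum>j<length p. \<bar>real j - centre (length p)\<bar> * (real j)\<^sup>2) / (\<Sum>j<length p. (real j - centre (length p))\<^sup>2) * M"
proof -
  define N where "N = length p"
  define s where "s = (\<Sum>j<N. (real j - centre N)\<^sup>2)"
  define d where "d = p ! 1 - p ! 0"
  define r where "r j = p ! j - p ! 0 - real j *\<^sub>R d" for j
  have s: "0 < s" unfolding s_def by (rule sum_centre_square_pos) (use assms in \<open>simp add: N_def\<close>)
  have r: "norm (r j) \<le> (real j)\<^sup>2 * M" if "j < N" for j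
  proof -
    define f where "f i = p ! nat i" for i
    have "norm (f (0 + int j) - f 0 - real j *\<^sub>R (f (0 + 1) - f 0)) \<le> (real j)\<^sup>2 * M"
    proof (rule norm_sub_line_le[OF _ _ M])
      fix i :: int assume i: "0 \<le> i" "i \<le> int (N - 1) - 2"
      have e: "nat (i + 2) = nat i + 2" "nat (i + 1) = nat i + 1" using i by auto
      have "nat i + 2 < length p" using i that unfolding N_def by linarith
      from d2[OF this] show "norm (diff2 f (0 + i)) \<le> M" by (simp only: diff2_def f_def e add_0)
    qed (use that in auto)
    then show ?thesis by (simp add: f_def r_def d_def)
  qed
  have "(\<Sum>j<N. (real j - centre N) *\<^sub>R p ! j) =
      (\<Sum>j<N. (real j - centre N)) *\<^sub>R (p ! 0 + centre N *\<^sub>R d) + s *\<^sub>R d + (\<Sum>j<N. (real j - centre N) *\<^sub>R r j)"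
    unfolding s_def scaleR_sum_left sum.distrib[symmetric]
    by (rule sum.cong) (simp_all add: r_def vec_eq_iff algebra_simps power2_eq_square)
  then have "slope p = (1 / s) *\<^sub>R (s *\<^sub>R d + (\<Sum>j<N. (real j - centre N) *\<^sub>R r j))"
    by (simp add: slope_def N_def[symmetric] s_def[symmetric] sum_centre)
  then have "slope p - d = (1 / s) *\<^sub>R (\<Sum>j<N. (real j - centre N) *\<^sub>R r j)"
    using s by (simp add: scaleR_right_distrib)
  then have "norm (slope p - d) = norm (\<Sum>j<N. (real j - centre N) *\<^sub>R r j) / s" using s by simp
  also have "\<dots> \<le> (\<Sum>j<N. \<bar>real j - centre N\<bar> * ((real j)\<^sup>2 * M)) / s"
    using s r by (intro divide_right_mono sum_norm_le) (auto intro!: mult_left_mono)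
  also have "\<dots> = (\<Sum>j<N. \<bar>real j - centre N\<bar> * (real j)\<^sup>2) / s * M"
    by (simp add: sum_distrib_right mult.assoc)
  finally show ?thesis by (simp add: N_def s_def d_def)
qed

text \<open>The distortion refers to the regression slope, the perturbation argument to the first
  step of a window. The two are comparable as soon as the distortion is small.\<close>

lemma straightened_diff2:
  fixes P :: "('d::finite) chain" and G :: "'d chain \<Rightarrow> 'd chain"
  assumes st: "straightened n G P" and n: "3 \<le> n" and \<eta>: "0 < \<eta>"
  shows "\<exists>l. \<forall>b. b + n \<le> length ((G ^^ l) P) \<longrightarrow>
    (G ^^ l) P ! (b + 1) \<noteq> (G ^^ l) P ! b \<and>
    (\<forall>j. j + 2 < n \<longrightarrow> norm ((G ^^ l) P ! (b + j + 2) - 2 *\<^sub>R (G ^^ l) P ! (b + j + 1) + (G ^^ l) P ! (b + j))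
       \<le> \<eta> * norm ((G ^^ l) P ! (b + 1) - (G ^^ l) P ! b))"
proof -
  define K where "K = (\<Sum>j<n. \<bar>real j - centre n\<bar> * (real j)\<^sup>2) / (\<Sum>j<n. (real j - centre n)\<^sup>2)"
  have K: "0 \<le> K" unfolding K_def by (intro divide_nonneg_nonneg sum_nonneg) auto
  \<comment> \<open>With \<open>K * \<epsilon> \<le> 1/2\<close> the slope is at most twice the
    first step; \<open>\<epsilon> \<le> \<eta> / 2\<close> makes up for this factor 2.\<close>
  define \<epsilon> where "\<epsilon> = min (\<eta> / 2) (1 / (2 * K + 2))"
  have \<epsilon>: "0 < \<epsilon>" "\<epsilon> \<le> \<eta> / 2" "K * \<epsilon> \<le> 1/2"
  proof -
    show "0 < \<epsilon>" "\<epsilon> \<le> \<eta> / 2" using \<eta> K by (auto simp: \<epsilon>_def)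
    have "K * \<epsilon> \<le> K * (1 / (2 * K + 2))" using K by (intro mult_left_mono) (auto simp: \<epsilon>_def)
    also have "\<dots> \<le> 1/2" using K by (simp add: field_simps)
    finally show "K * \<epsilon> \<le> 1/2" .
  qed
  have "\<forall>\<^sub>F l in sequentially. chain_distortion n ((G ^^ l) P) < ereal \<epsilon>"
    using st \<epsilon>(1) unfolding straightened_def by (intro order_tendstoD) auto
  then obtain l where l: "chain_distortion n ((G ^^ l) P) < ereal \<epsilon>"
    using eventually_happens' sequentially_bot by blast
  define Q where "Q = (G ^^ l) P"
  have "Q ! (b + 1) \<noteq> Q ! b \<and> (\<forall>j. j + 2 < n \<longrightarrow>
      norm (Q ! (b + j + 2) - 2 *\<^sub>R Q ! (b + j + 1) + Q ! (b + j)) \<le> \<eta> * norm (Q ! (b + 1) - Q ! b))"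
    if b: "b + n \<le> length Q" for b
  proof -
    define p where "p = subchain n b Q"
    have len: "length p = n" and nth: "\<And>j. j < n \<Longrightarrow> p ! j = Q ! (b + j)"
      using b by (simp_all add: p_def length_subchain subchain_nth)
    have "subchains n Q = (\<lambda>i. subchain n i Q) ` {i. i + n \<le> length Q}" by (auto simp: subchains_def)
    moreover have "finite {i. i + n \<le> length Q}" by (rule finite_subset[of _ "{..length Q}"]) auto
    ultimately have "finite (subchains n Q)" by simp
    moreover have "p \<in> subchains n Q" using b by (auto simp: subchains_def p_def)
    ultimately have "rel_distortion p \<le> chain_distortion n Q"
      unfolding chain_distortion_def by (intro Max_ge) auto
    then have lt: "rel_distortion p < ereal \<epsilon>" using l by (simp add: Q_def)
    note rd = rel_distortion_lessD[OF _ lt]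
    have sl: "slope p \<noteq> 0" and d2: "\<And>j. j + 2 < length p \<Longrightarrow> norm (p ! (j + 2) - 2 *\<^sub>R p ! (j + 1) + p ! j) \<le> \<epsilon> * norm (slope p)"
      using rd n len by auto
    have "norm (slope p - (p ! 1 - p ! 0)) \<le> K * (\<epsilon> * norm (slope p))"
      using norm_slope_diff_le[of p "\<epsilon> * norm (slope p)"] d2 \<epsilon>(1) n by (simp add: len K_def)
    also have "\<dots> \<le> (1/2) * norm (slope p)"
      using mult_right_mono[OF \<epsilon>(3), of "norm (slope p)"] by simp
    finally have half: "norm (slope p) \<le> 2 * norm (p ! 1 - p ! 0)"
      using norm_triangle_sub[of "slope p" "p ! 1 - p ! 0"] by simp
    have p01: "p ! 1 - p ! 0 = Q ! (b + 1) - Q ! b" using nth[of 0] nth[of 1] n by simp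
    have "norm (Q ! (b + j + 2) - 2 *\<^sub>R Q ! (b + j + 1) + Q ! (b + j)) \<le> \<eta> * norm (Q ! (b + 1) - Q ! b)"
      if j: "j + 2 < n" for j
    proof -
      have "norm (Q ! (b + j + 2) - 2 *\<^sub>R Q ! (b + j + 1) + Q ! (b + j)) \<le> \<epsilon> * norm (slope p)"
        using d2[of j] j nth[of j] nth[of "j + 1"] nth[of "j + 2"] by (simp add: len add.assoc)
      also have "\<dots> \<le> (\<eta> / 2) * (2 * norm (p ! 1 - p ! 0))"
        using \<epsilon> half \<eta> by (intro mult_mono) auto
      finally show ?thesis unfolding p01 by simp
    qed
    moreover have "Q ! (b + 1) \<noteq> Q ! b" using half sl p01 by auto
    ultimately show ?thesis by blast
  qed
  then show ?thesis unfolding Q_def by blast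
qed

section \<open>Coercivity of the basic limit function\<close>

lemma inner_tup:
  "inner (tup y :: (real, 'n::{finite,linorder}) vec) (tup z) = (\<Sum>j<CARD('n). y j * z j)"
  using sum_pos[where 'k = 'n, of "\<lambda>j. y j * z j"] by (simp add: inner_vec_def)

text \<open>Evaluation functionals separate the coefficients, hence finitely many of them form a basis
  of the dual space; expressing the coordinates in this basis gives the bound.\<close>

lemma coercive_if_injective:
  fixes \<psi> :: "nat \<Rightarrow> 'b \<Rightarrow> real"
  assumes N: "CARD('n::{finite,linorder}) = N"
    and inj: "\<And>h. (\<And>t. t \<in> T \<Longrightarrow> (\<Sum>j<N. h j * \<psi> j t) = 0) \<Longrightarrow> (\<forall>j<N. h j = 0)"
  obtains C where "\<And>h \<epsilon> j. (\<And>t. t \<in> T \<Longrightarrow> \<bar>\<Sum>j<N. h j * \<psi> j t\<bar> \<le> \<epsilon>) \<Longrightarrow> j < N \<Longrightarrow> \<bar>h j\<bar> \<le> C * \<epsilon>"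
proof -
  define ev :: "'b \<Rightarrow> (real, 'n) vec" where "ev t = tup (\<lambda>j. \<psi> j t)" for t
  have inner_ev: "inner (tup h) (ev t) = (\<Sum>j<N. h j * \<psi> j t)" for h t
    by (simp add: ev_def inner_tup N)
  have span: "span (ev ` T) = UNIV"
  proof (rule ccontr)
    assume "span (ev ` T) \<noteq> UNIV"
    then obtain x where x: "x \<noteq> 0" "\<forall>y\<in>span (ev ` T). x \<bullet> y = 0"
      using span_not_UNIV_orthogonal by blast
    have "(\<Sum>j<N. (x $ at_pos j) * \<psi> j t) = 0" if "t \<in> T" for t
      using x(2) that inner_ev[of "\<lambda>j. x $ at_pos j" t] by (simp add: span_base)
    then have "\<forall>j<N. x $ at_pos j = 0" by (rule inj)
    then have "x $ i = 0" for i using pos_less[of i] N by (metis at_pos_pos)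
    then show False using x(1) by (simp add: vec_eq_iff)
  qed
  have "\<exists>C\<ge>0. \<forall>h \<epsilon>. (\<forall>t\<in>T. \<bar>\<Sum>j<N. h j * \<psi> j t\<bar> \<le> \<epsilon>) \<longrightarrow> \<bar>h j\<bar> \<le> C * \<epsilon>" if j: "j < N" for j
  proof -
    have "axis (at_pos j :: 'n) 1 \<in> span (ev ` T)" using span by simp
    then obtain V r where V: "finite V" "V \<subseteq> ev ` T" "axis (at_pos j :: 'n) 1 = (\<Sum>v\<in>V. r v *\<^sub>R v)"
      unfolding span_explicit by blast
    have "\<bar>h j\<bar> \<le> (\<Sum>v\<in>V. \<bar>r v\<bar>) * \<epsilon>" if h: "\<forall>t\<in>T. \<bar>\<Sum>j<N. h j * \<psi> j t\<bar> \<le> \<epsilon>" for h \<epsilon>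
    proof -
      have "h j = tup h \<bullet> axis (at_pos j :: 'n) 1" using j N by (simp add: inner_axis)
      also have "\<dots> = (\<Sum>v\<in>V. r v * (tup h \<bullet> v))" by (simp add: V(3) inner_sum_right)
      finally have "\<bar>h j\<bar> \<le> (\<Sum>v\<in>V. \<bar>r v * (tup h \<bullet> v)\<bar>)" by (simp only: sum_abs)
      also have "\<dots> \<le> (\<Sum>v\<in>V. \<bar>r v\<bar> * \<epsilon>)"
      proof (rule sum_mono)
        fix v assume "v \<in> V"
        then obtain t where "t \<in> T" "v = ev t" using V(2) by blast
        then show "\<bar>r v * (tup h \<bullet> v)\<bar> \<le> \<bar>r v\<bar> * \<epsilon>"
          using h inner_ev[of h t] by (simp add: abs_mult mult_left_mono)
      qed
      finally show ?thesis by (simp add: sum_distrib_right)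
    qed
    moreover have "0 \<le> (\<Sum>v\<in>V. \<bar>r v\<bar>)" by (rule sum_nonneg) simp
    ultimately show ?thesis by blast
  qed
  then obtain C where C: "\<And>j. j < N \<Longrightarrow> 0 \<le> C j"
    "\<And>j h \<epsilon>. j < N \<Longrightarrow> (\<And>t. t \<in> T \<Longrightarrow> \<bar>\<Sum>j<N. h j * \<psi> j t\<bar> \<le> \<epsilon>) \<Longrightarrow> \<bar>h j\<bar> \<le> C j * \<epsilon>"
    by metis
  show thesis
  proof (rule that[of "\<Sum>j<N. C j"])
    fix h \<epsilon> j assume h: "\<And>t. t \<in> T \<Longrightarrow> \<bar>\<Sum>j<N. h j * \<psi> j t\<bar> \<le> \<epsilon>" and j: "j < N"
    have hj: "\<bar>h j\<bar> \<le> C j * \<epsilon>" by (rule C(2)[OF j h])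
    show "\<bar>h j\<bar> \<le> (\<Sum>j<N. C j) * \<epsilon>"
    proof (cases "0 \<le> \<epsilon>")
      case True
      have "C j \<le> (\<Sum>j<N. C j)" using j C(1) by (intro member_le_sum) auto
      then show ?thesis using hj True mult_right_mono[of "C j" "\<Sum>j<N. C j" \<epsilon>] by linarith
    next
      \<comment> \<open>A negative bound forces \<open>T\<close> to be empty; injectivity would then
        force the constant coefficients 1 to vanish, a contradiction.\<close>
      case False
      then have "T = {}" using h abs_ge_zero order_trans by blast
      then have "h j = 0 \<and> (\<lambda>_. 1 :: real) j = 0"
        using inj[of h] inj[of "\<lambda>_. 1"] j by blast
      then show ?thesis by simp
    qed
  qed
qed

context linear_glue
begin

text \<open>Non-degeneracy gives injectivity. Coefficients \<open>h\<close> whose combination of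
  translates vanishes on \<open>{0..1}\<close> form a chain of \<open>2 * m + 1\<close> points with
  parameter interval \<open>(0, 1)\<close> and limit 0 there. So all \<open>h j\<close> agree, and
  since constants are reproduced, their common value is 0.\<close>

lemma ex_refinable:
  assumes n: "CARD('n::{finite,linorder}) = 2 * m + 1"
    and reg: "\<And>P. 2 * m + 1 \<le> length P \<Longrightarrow> Ck_holder_at (2 * m + 1) 2 \<beta> A P" and \<beta>: "0 < \<beta>"
    and nondeg: "\<And>P \<Phi>. 2 * m + 1 \<le> length P \<Longrightarrow> limit_curve (2 * m + 1) A P \<Phi> \<Longrightarrow>
      \<Phi> constant_on {0<..<param_length (2 * m + 1) P} \<Longrightarrow> \<exists>c. \<forall>p\<in>set P. p = c"
  obtains \<phi> \<phi>' \<phi>'' K C0 where "refinable m c (real m + \<tau> - 1) \<phi> \<phi>' \<phi>'' \<beta> K C0"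
proof -
  obtain \<phi> \<phi>' \<phi>'' K where rf: "refinable_function m c (real m + \<tau> - 1) \<phi> \<phi>' \<phi>'' \<beta> K"
    using ex_refinable_function[OF reg \<beta>] by blast
  interpret refinable_function m c "real m + \<tau> - 1" \<phi> \<phi>' \<phi>'' \<beta> K by fact
  have inj: "\<forall>j<2 * m + 1. h j = 0" if h: "\<And>t. t \<in> {0..1} \<Longrightarrow> (\<Sum>j<2 * m + 1. h j * \<phi> (t - real j)) = 0" for h
  proof -
    define P :: "'d chain" where "P = map (\<lambda>j. h j *\<^sub>R e1) [0..<2 * m + 1]"
    have P: "length P = 2 * m + 1" "2 * m + 1 \<le> length P" by (simp_all add: P_def)
    define f :: "int \<Rightarrow> 'd point" where "f i = h (nat i) *\<^sub>R e1" for i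
    have f: "f (int j) = P ! j" if "j < length P" for j
      using that by (simp add: f_def P_def del: upt_Suc)
    have curve0: "curve f t = 0" if "t \<in> {0..1}" for t
    proof -
      have "curve f t = (\<Sum>j\<le>2 * m. \<phi> (t - real j) *\<^sub>R f (int j))"
        using curve_window[of t f 0] that by simp
      also have "\<dots> = (\<Sum>j<2 * m + 1. h j * \<phi> (t - real j)) *\<^sub>R e1"
        by (simp add: f_def scaleR_sum_left lessThan_Suc_atMost mult.commute del: sum.lessThan_Suc sum.atMost_Suc)
      finally show ?thesis using h[OF that] by simp
    qed
    obtain \<Phi> where lim: "limit_curve (2 * m + 1) A P \<Phi>"
      using reg[OF P(2)] unfolding Ck_holder_at_def by blast
    have cont: "isCont \<Phi> t" for t
      using lim by (simp add: limit_curve_def continuous_on_eq_continuous_at)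
    have "\<Phi> t = 0" if t: "t \<in> {0<..<1}" for t
    proof (rule eq_if_eq_on_dyadics[where f = \<Phi> and g = "\<lambda>_. 0" and U = "{0<..<1}"])
      fix k i assume x: "of_int i / 2 ^ k \<in> {0<..<1::real}"
      have "(\<lambda>p. (subdiv m c ^^ (k + p)) f (i * 2 ^ p)) \<longlonglongrightarrow> \<Phi> (of_int i / 2 ^ k)"
        by (rule linear_limit_at_dyadic[OF P(2) f lim]) (use x P(1) in auto)
      then have "\<Phi> (of_int i / 2 ^ k) = curve f (of_int i / 2 ^ k)"
        using subdiv_pow_tendsto_curve LIMSEQ_unique by blast
      also have "\<dots> = 0" by (rule curve0) (use x in auto)
      finally show "\<Phi> (of_int i / 2 ^ k) = 0" .
    qed (use t cont in auto)
    then have "\<Phi> constant_on {0<..<param_length (2 * m + 1) P}"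
      unfolding constant_on_def by (intro exI[of _ 0]) (simp add: param_length_def P(1))
    from nondeg[OF P(2) lim this] obtain q where q: "\<forall>p\<in>set P. p = q" by blast
    have hq: "h j = h 0" if "j < 2 * m + 1" for j
    proof -
      have "P ! j = q" "P ! 0 = q" using q that P(1) by (auto intro: nth_mem)
      then have "h j *\<^sub>R (e1 :: 'd point) = h 0 *\<^sub>R e1" using that by (simp add: P_def del: upt_Suc)
      then show ?thesis by (simp only: scaleR_cancel_right e1_neq_0 simp_thms)
    qed
    have "f (int j) = h 0 *\<^sub>R e1" if "j \<le> 2 * m" for j using hq[of j] that by (simp add: f_def)
    then have "curve f 0 = curve (\<lambda>j. h 0 *\<^sub>R (e1 :: 'd point) + of_int j *\<^sub>R 0) 0"
      using curve_window[of 0 f 0] curve_window[of 0 "\<lambda>j. h 0 *\<^sub>R (e1 :: 'd point) + of_int j *\<^sub>R 0" 0] by simp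
    then have "h 0 *\<^sub>R (e1 :: 'd point) = 0" using curve0[of 0] by (simp only: curve_line) simp
    then have "h 0 = 0" by simp
    then show ?thesis using hq by metis
  qed
  obtain C0 where C0: "\<And>h \<epsilon> j. (\<And>t. t \<in> {0..1} \<Longrightarrow> \<bar>\<Sum>j<2 * m + 1. h j * \<phi> (t - real j)\<bar> \<le> \<epsilon>) \<Longrightarrow>
      j < 2 * m + 1 \<Longrightarrow> \<bar>h j\<bar> \<le> C0 * \<epsilon>"
    using coercive_if_injective[OF n, of "{0..1}" "\<lambda>j t. \<phi> (t - real j)"] inj by blast
  have "refinable m c (real m + \<tau> - 1) \<phi> \<phi>' \<phi>'' \<beta> K C0"
  proof
    show "\<bar>h j\<bar> \<le> C0 * \<epsilon>"
      if "\<And>t. 0 \<le> t \<Longrightarrow> t \<le> 1 \<Longrightarrow> \<bar>\<Sum>j\<le>2 * m. h j * \<phi> (t - real j)\<bar> \<le> \<epsilon>" "j \<le> 2 * m" for h \<epsilon> j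
    proof (rule C0)
      show "\<bar>\<Sum>j<2 * m + 1. h j * \<phi> (t - real j)\<bar> \<le> \<epsilon>" if "t \<in> {0..1}" for t
        using \<open>\<And>t. 0 \<le> t \<Longrightarrow> t \<le> 1 \<Longrightarrow> \<bar>\<Sum>j\<le>2 * m. h j * \<phi> (t - real j)\<bar> \<le> \<epsilon>\<close>[of t] that
        by (simp add: lessThan_Suc_atMost del: sum.lessThan_Suc sum.atMost_Suc)
    qed (use that in simp)
  qed
  then show thesis by (rule that)
qed

end

section \<open>Regularity of the limit curve of the GLUE-scheme\<close>

lemma Ck_holder_curveI:
  fixes \<Phi> :: "real \<Rightarrow> 'b::real_normed_vector"
  assumes d: "\<And>t. (\<Phi> has_vector_derivative \<Phi>' t) (at t)" "\<And>t. (\<Phi>' has_vector_derivative \<Phi>'' t) (at t)"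
    and H: "\<And>s t. norm (\<Phi>'' s - \<Phi>'' t) \<le> H * \<bar>s - t\<bar> powr \<beta>" and \<beta>: "0 < \<beta>"
  shows "Ck_holder_curve 2 \<beta> L \<Phi>"
proof -
  have H0: "0 \<le> H" using H[of 0 1] by (simp add: order_trans[OF norm_ge_zero])
  define D where "D j = (if j = 0 then \<Phi> else if j = 1 then \<Phi>' else \<Phi>'')" for j :: nat
  have "kth_derivative_on 2 {0<..<L} \<Phi> \<Phi>''"
    unfolding kth_derivative_on_def
    by (rule exI[of _ D]) (auto simp: D_def less_2_cases_iff d)
  moreover have "isCont \<Phi>'' t" for t
  proof -
    have "((\<lambda>s. H * \<bar>s - t\<bar> powr \<beta>) \<longlongrightarrow> H * \<bar>t - t\<bar> powr \<beta>) (at t)"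
      using \<beta> by (intro tendsto_intros) auto
    then have "((\<lambda>s. H * \<bar>s - t\<bar> powr \<beta>) \<longlongrightarrow> 0) (at t)" by simp
    then have "((\<lambda>s. \<Phi>'' s - \<Phi>'' t) \<longlongrightarrow> 0) (at t)"
      by (rule Lim_null_comparison[rotated]) (simp add: H)
    then show ?thesis by (simp add: isCont_def LIM_zero_iff)
  qed
  then have "continuous_on {0<..<L} \<Phi>''" by (simp add: continuous_at_imp_continuous_on)
  moreover have "(SUP h\<in>{0<..1}. ennreal (h powr (- \<beta>)) * modulus L z \<Phi>'' h) < \<infinity>" for z
  proof -
    have "ennreal (h powr (- \<beta>)) * modulus L z \<Phi>'' h \<le> ennreal H" if h: "h \<in> {0<..1}" for h
    proof -
      have "modulus L z \<Phi>'' h \<le> ennreal (H * h powr \<beta>)"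
        unfolding modulus_def
      proof (rule SUP_least)
        fix t
        show "ennreal (norm (\<Phi>'' (t + h / 2) - \<Phi>'' (t - h / 2))) \<le> ennreal (H * h powr \<beta>)"
          using H[of "t + h/2" "t - h/2"] h by (intro ennreal_leI) auto
      qed
      then have "ennreal (h powr (- \<beta>)) * modulus L z \<Phi>'' h \<le> ennreal (h powr (- \<beta>)) * ennreal (H * h powr \<beta>)"
        by (rule mult_left_mono) simp
      also have "\<dots> = ennreal (h powr (- \<beta>) * (H * h powr \<beta>))"
        using H0 by (intro ennreal_mult[symmetric]) auto
      also have "h powr (- \<beta>) * (H * h powr \<beta>) = H" using h by (simp add: powr_minus)
      finally show ?thesis .
    qed
    then have "(SUP h\<in>{0<..1}. ennreal (h powr (- \<beta>)) * modulus L z \<Phi>'' h) \<le> ennreal H"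
      by (rule SUP_least)
    also have "\<dots> < \<infinity>" by simp
    finally show ?thesis .
  qed
  ultimately show ?thesis unfolding Ck_holder_curve_def by (intro exI[of _ \<Phi>''] conjI exI[of _ 1]) auto
qed

text \<open>Convergence that is uniform up to the ends of the parameter interval dominates the
  suprema over all its compact parts.\<close>

lemma limit_curveI:
  assumes cont: "continuous_on UNIV \<Phi>"
    and conv: "\<And>\<epsilon>. 0 < \<epsilon> \<Longrightarrow> \<forall>\<^sub>F l in sequentially. \<forall>i::nat. 0 < i \<and> real i < 2 ^ l * param_length n P \<longrightarrow>
       norm (\<Phi> (real i / 2 ^ l) - (G ^^ l) P ! i) \<le> \<epsilon>"
  shows "limit_curve n G P \<Phi>"
  unfolding limit_curve_def
proof (intro conjI cont allI impI)
  fix z :: real assume z: "0 < z"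
  show "(\<lambda>l. SUP i \<in> {i::nat. 0 < i \<and> real i / 2 ^ l \<in> {z..param_length n P - z}}.
      ennreal (norm (\<Phi> (real i / 2 ^ l) - (G ^^ l) P ! i))) \<longlonglongrightarrow> 0"
  proof (rule order_tendstoI)
    fix a :: ennreal assume "0 < a"
    then obtain b where b: "0 < b" "b < a" using dense by blast
    then obtain \<epsilon> where \<epsilon>: "b = ennreal \<epsilon>" "0 \<le> \<epsilon>"
      by (cases b) (auto simp: top_unique)
    then have "0 < \<epsilon>" using b(1) by (cases "\<epsilon> = 0") auto
    from conv[OF this] show "\<forall>\<^sub>F l in sequentially. (SUP i \<in> {i::nat. 0 < i \<and> real i / 2 ^ l \<in> {z..param_length n P - z}}.
      ennreal (norm (\<Phi> (real i / 2 ^ l) - (G ^^ l) P ! i))) < a"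
    proof eventually_elim
      case (elim l)
      have "(SUP i \<in> {i::nat. 0 < i \<and> real i / 2 ^ l \<in> {z..param_length n P - z}}.
          ennreal (norm (\<Phi> (real i / 2 ^ l) - (G ^^ l) P ! i))) \<le> ennreal \<epsilon>"
      proof (rule SUP_least)
        fix i :: nat assume i: "i \<in> {i. 0 < i \<and> real i / 2 ^ l \<in> {z..param_length n P - z}}"
        then have "real i / 2 ^ l < param_length n P" using z by auto
        then have "real i < 2 ^ l * param_length n P" by (simp add: field_simps)
        then show "ennreal (norm (\<Phi> (real i / 2 ^ l) - (G ^^ l) P ! i)) \<le> ennreal \<epsilon>"
          using elim i by (intro ennreal_leI) auto
      qed
      then show ?case using b(2) \<epsilon>(1) by (simp add: le_less_trans)
    qed
  qed simp
qed

theorem theorem6p5: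
  fixes m n :: nat
    and G A :: "('d::{finite,linorder}) chain \<Rightarrow> 'd chain"
    and g a :: "nat \<Rightarrow> ('d, 'k::{finite,linorder}) tuple \<Rightarrow> 'd point"
    and B :: "nat \<Rightarrow> ('n::{finite,linorder}) sq_matrix"
    and w :: "nat \<Rightarrow> real ^ ('k::{finite,linorder})"
    and \<tau> \<nu> \<tau>' \<nu>' \<alpha> :: real
    and P :: "'d chain"
  assumes "1 \<le> m" and "n = 2 * m + 1" and "CARD('k) = m + 1" and "CARD('n) = n"
    and "glue_scheme m G g \<tau> \<nu>"
    and "locally_linear_with G B"
    and "linear_glue_scheme m A a w \<tau>' \<nu>'" and "corresponds_to A B"
    and "0 < \<alpha>" and "\<alpha> \<le> 1"
    and "n \<le> length P"
    and "straightened n G P"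
    and "linear_almost_Ck_holder n 2 \<alpha> A"
  shows "almost_Ck_holder_at n 2 (min \<alpha> \<nu>) G P"
  unfolding almost_Ck_holder_at_def
proof (intro allI impI)
  fix \<beta> assume "0 < \<beta> \<and> \<beta> < min \<alpha> \<nu>"
  then have \<beta>: "0 < \<beta>" "\<beta> < \<alpha>" "\<beta> < \<nu>" by auto
  note n = assms(2)
  have P: "2 * m + 1 \<le> length P" using assms by simp
  interpret linearized_glue m G g \<tau> \<nu> A a \<tau>' \<nu>' w B
    using assms by unfold_locales (auto simp: linear_glue_scheme_def)
  \<comment> \<open>As \<open>\<beta> < \<alpha>\<close>, the companion is C^{2,\<beta>} at every
    chain, which supplies the Hoelder exponent of \<open>\<phi>''\<close>. The other inequality
    \<open>\<beta> < \<nu>\<close> enters through \<open>ex_limit\<close>.\<close>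
  obtain \<phi> \<phi>' \<phi>'' K C0 where "refinable m c (real m + \<tau>' - 1) \<phi> \<phi>' \<phi>'' \<beta> K C0"
  proof (rule ex_refinable[OF card_n _ \<beta>(1)])
    show "Ck_holder_at (2 * m + 1) 2 \<beta> A Q" if "2 * m + 1 \<le> length Q" for Q
      using assms(13) that \<beta> unfolding linear_almost_Ck_holder_def almost_Ck_holder_at_def n by blast
    show "\<exists>c. \<forall>p\<in>set Q. p = c"
      if "2 * m + 1 \<le> length Q" "limit_curve (2 * m + 1) A Q \<Phi>" "\<Phi> constant_on {0<..<param_length (2 * m + 1) Q}" for Q \<Phi>
      using assms(13) that unfolding linear_almost_Ck_holder_def n by blast
  qed
  then interpret refinable m c "real m + \<tau>' - 1" \<phi> \<phi>' \<phi>'' \<beta> K C0 .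
  obtain \<delta> C where \<delta>: "0 < \<delta>" and C: "0 \<le> C" and near:
    "\<And>l y v x \<rho>. \<lbrakk>l < 2; v \<noteq> 0; \<And>j. j \<le> m \<Longrightarrow> norm (y j - x - real j *\<^sub>R v) \<le> \<rho>; \<rho> \<le> \<delta> * norm v\<rbrakk>
      \<Longrightarrow> norm (g l (tup y) - (\<Sum>j\<le>m. c l j *\<^sub>R y j)) \<le> C * \<rho> * (\<rho> / norm v) powr \<nu>"
    using rule_near_line by blast
  \<comment> \<open>Values at indices outside the chain are arbitrary. The assumptions of
    \<open>perturbed\<close> only concern windows inside it and the points they produce.\<close>
  define X where "X l i = (G ^^ l) P ! nat i" for l i
  define L where "L = int (length P) - 2 * int m"
  have L: "1 \<le> L" using P by (simp add: L_def)
  have len: "int (length ((G ^^ l) P)) = 2 ^ l * L + 2 * int m" for l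
    unfolding G.length_pow[OF P] L_def using P by (simp add: of_nat_diff)
  have X_step: "X (Suc l) i = g (nat (i mod 2)) (tup (\<lambda>j. X l (i div 2 + int j)))"
    if i: "0 \<le> i" "i < 2 ^ Suc l * L + 2 * int m" for l i
  proof -
    define Q where "Q = (G ^^ l) P"
    have Q: "2 * m + 1 \<le> length Q" unfolding Q_def by (rule G.length_pow_ge[OF P])
    have r: "nat i < length (G Q)" using i len[of "Suc l"] by (simp add: Q_def)
    have "X (Suc l) i = g (nat i mod 2) (tup (\<lambda>j. Q ! (nat i div 2 + j)))"
      using G.G_nth[OF Q r] by (simp add: X_def Q_def)
    moreover have "nat i mod 2 = nat (i mod 2)" "nat i div 2 + j = nat (i div 2 + int j)" for j
      using i by (simp_all add: nat_mod_distrib nat_div_distrib nat_add_distrib)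
    ultimately show ?thesis by (simp add: X_def Q_def)
  qed
  interpret perturbed m c "real m + \<tau>' - 1" \<phi> \<phi>' \<phi>'' \<beta> K C0 X L \<delta> C \<nu>
  proof
    fix b l \<rho> i
    assume b: "0 \<le> b" "b < 2 ^ l * L" and ne: "X l (b + 1) \<noteq> X l b"
      and dev: "\<And>j. j \<le> 2 * m \<Longrightarrow> norm (X l (b + int j) - X l b - real j *\<^sub>R (X l (b + 1) - X l b)) \<le> \<rho>"
      and \<rho>: "\<rho> \<le> \<delta> * norm (X l (b + 1) - X l b)" and i: "2 * b \<le> i" "i \<le> 2 * b + 2 * int m + 1"
    define v where "v = X l (b + 1) - X l b"
    \<comment> \<open>The \<open>m + 1\<close> points read by the rule start at \<open>b + k\<close>
      with \<open>k \<le> m\<close> and so stay in the window of \<open>b\<close>. The reference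
      line is that of the window, restarted at its index \<open>k\<close>.\<close>
    define k where "k = nat (i div 2 - b)"
    have k: "k \<le> m" "i div 2 = b + int k" using i by (auto simp: k_def)
    have "norm (g (nat (i mod 2)) (tup (\<lambda>j. X l (i div 2 + int j))) -
        (\<Sum>j\<le>m. c (nat (i mod 2)) j *\<^sub>R X l (i div 2 + int j))) \<le> C * \<rho> * (\<rho> / norm v) powr \<nu>"
    proof (rule near[of "nat (i mod 2)" v "\<lambda>j. X l (i div 2 + int j)" "X l b + real k *\<^sub>R v" \<rho>])
      fix j assume "j \<le> m"
      then show "norm (X l (i div 2 + int j) - (X l b + real k *\<^sub>R v) - real j *\<^sub>R v) \<le> \<rho>"
        using dev[of "k + j"] k by (simp add: v_def algebra_simps)
    qed (use ne \<rho> in \<open>auto simp: v_def\<close>)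
    moreover have "i < 2 ^ Suc l * L + 2 * int m" using b i by simp
    ultimately show "norm (X (Suc l) i - subdiv m c (X l) i) \<le>
        C * \<rho> * (\<rho> / norm (X l (b + 1) - X l b)) powr \<nu>"
      using X_step[of i l] b i by (simp add: subdiv_def v_def)
  next
    fix \<eta> :: real assume \<eta>: "0 < \<eta>"
    have "3 \<le> n" using n assms(1) by simp
    from straightened_diff2[OF assms(12) this \<eta>] obtain l where l:
      "\<And>b. b + n \<le> length ((G ^^ l) P) \<Longrightarrow> (G ^^ l) P ! (b + 1) \<noteq> (G ^^ l) P ! b"
      "\<And>b j. b + n \<le> length ((G ^^ l) P) \<Longrightarrow> j + 2 < n \<Longrightarrow>
        norm ((G ^^ l) P ! (b + j + 2) - 2 *\<^sub>R (G ^^ l) P ! (b + j + 1) + (G ^^ l) P ! (b + j))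
         \<le> \<eta> * norm ((G ^^ l) P ! (b + 1) - (G ^^ l) P ! b)"
      by blast
    have "X l (b + 1) \<noteq> X l b \<and> (\<forall>j. 0 \<le> j \<and> j \<le> 2 * int m - 2 \<longrightarrow>
          norm (diff2 (X l) (b + j)) \<le> \<eta> * norm (X l (b + 1) - X l b))"
      if b: "0 \<le> b \<and> b < 2 ^ l * L" for b
    proof -
      have bl: "nat b + n \<le> length ((G ^^ l) P)" using b len[of l] n by linarith
      have b1: "nat (b + 1) = nat b + 1" using b by (simp add: nat_add_distrib)
      have "norm (diff2 (X l) (b + j)) \<le> \<eta> * norm (X l (b + 1) - X l b)"
        if j: "0 \<le> j" "j \<le> 2 * int m - 2" for j
      proof -
        have "nat (b + j + 2) = nat b + nat j + 2" "nat (b + j + 1) = nat b + nat j + 1"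
          "nat (b + j) = nat b + nat j" using b j by (simp_all add: nat_add_distrib)
        moreover have "nat j + 2 < n" using j n by linarith
        ultimately show ?thesis using l(2)[OF bl, of "nat j"] by (simp only: diff2_def X_def b1)
      qed
      moreover have "X l (b + 1) \<noteq> X l b" unfolding X_def b1 by (rule l(1)[OF bl])
      ultimately show ?thesis by blast
    qed
    then show "\<exists>l. \<forall>b. 0 \<le> b \<and> b < 2 ^ l * L \<longrightarrow> X l (b + 1) \<noteq> X l b \<and>
        (\<forall>j. 0 \<le> j \<and> j \<le> 2 * int m - 2 \<longrightarrow> norm (diff2 (X l) (b + j)) \<le> \<eta> * norm (X l (b + 1) - X l b))"
      by blast
  qed (use L \<delta> C G.nu_pos in auto)
  obtain \<Phi> \<Phi>' \<Phi>'' :: "real \<Rightarrow> 'd point" and H where \<Phi>: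
    "\<And>t. (\<Phi> has_vector_derivative \<Phi>' t) (at t)"
    "\<And>t. (\<Phi>' has_vector_derivative \<Phi>'' t) (at t)"
    "\<And>s t. norm (\<Phi>'' s - \<Phi>'' t) \<le> H * \<bar>s - t\<bar> powr \<beta>"
    "\<And>\<epsilon>. 0 < \<epsilon> \<Longrightarrow> \<forall>\<^sub>F l in sequentially. \<forall>i. 0 < i \<and> i < 2 ^ l * L \<longrightarrow>
       norm (\<Phi> (of_int i / 2 ^ l) - X l i) \<le> \<epsilon>"
    by (rule ex_limit[OF \<beta>(3)]) (rule that, blast+)
  have pl: "param_length n P = of_int L" by (simp add: param_length_def L_def n)
  have "limit_curve n G P \<Phi>"
  proof (rule limit_curveI)
    show "continuous_on UNIV \<Phi>"
      using \<Phi>(1) has_vector_derivative_continuous by (blast intro: continuous_at_imp_continuous_on)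
    fix \<epsilon> :: real assume "0 < \<epsilon>"
    from \<Phi>(4)[OF this] show "\<forall>\<^sub>F l in sequentially. \<forall>i::nat. 0 < i \<and> real i < 2 ^ l * param_length n P \<longrightarrow>
       norm (\<Phi> (real i / 2 ^ l) - (G ^^ l) P ! i) \<le> \<epsilon>"
    proof eventually_elim
      case (elim l)
      show ?case
      proof (intro allI impI)
        fix i :: nat assume i: "0 < i \<and> real i < 2 ^ l * param_length n P"
        then have "real_of_int (int i) < of_int (2 ^ l * L)" by (simp add: pl)
        then have "int i < 2 ^ l * L" unfolding of_int_less_iff .
        then show "norm (\<Phi> (real i / 2 ^ l) - (G ^^ l) P ! i) \<le> \<epsilon>"
          using elim[rule_format, of "int i"] i by (simp add: X_def)
      qed
    qed
  qed
  moreover have "Ck_holder_curve 2 \<beta> (param_length n P) \<Phi>"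
    using \<Phi>(1-3) \<beta>(1) by (rule Ck_holder_curveI)
  ultimately show "Ck_holder_at n 2 \<beta> G P" unfolding Ck_holder_at_def by blast
qed

end
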